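(* Let $\mathcal P=(\Delta,\mathcal F)$ be a simple lattice multi-polytope of dimension $n$. Then: (1) $\sharp(\nu\mathcal P)$ and $\sharp(\nu\mathcal P^\circ)$ are polynomials in the integer $\nu$ of degree at most $n$. (2) $\sharp(\nu\mathcal P^\circ)=(-1)^n\sharp(-\nu\mathcal P)$ for any integer $\nu$. (3) The coefficient of $\nu^n$ in $\sharp(\nu\mathcal P)$ is $\mathrm{vol}(\mathcal P)$, and the constant term in $\sharp(\nu\mathcal P)$ is $\deg(\Delta)$.
   Context: **Multi-fans.** Let $N$ be a lattice of rank $n$ and $N_{\mathbb R}=N\otimes\mathbb R$. A cone in $N$ is a strongly convex rational polyhedral cone in $N_{\mathbb R}$ (the set of nonnegative real combinations of finitely many vectors of $N$, containing no line). $\mathrm{Cone}(N)$ is the set of all cones, partially ordered by $\tau\prec\sigma$ iff $\tau$ is a proper face of $\sigma$. A multi-fan of dimension $n$ in $N$ is a triple $\Delta=(\Sigma,C,w^{\pm})$ where $\Sigma$ is a finite partially ordered set with a unique minimum element $*$; $C:\Sigma\to\mathrm{Cone}(N)$ is a map with (1) $C( * )=\{0\}$, (2) $I<J$ implies $C(I)\prec C(J)$, (3) for each $J\in\Sigma$, $C$ restricts to an isomorphism of ordered sets from $\{I\in\Sigma: I\le J\}$ onto $\{\kappa\in\mathrm{Cone}(N):\kappa\preceq C(J)\}$; and, with $\Sigma^{(m)}=\{I\in\Sigma:\dim C(I)=m\}$ (write $|I|=m$ for $I\in\Sigma^{(m)}$), $w^+,w^-:\Sigma^{(n)}\to\mathbb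 Z_{\ge0}$ are functions such that $w^+(I)>0$ or $w^-(I)>0$ for each $I$. Put $w=w^+-w^-$. A vector $v\in N_{\mathbb R}$ is generic if it lies on no linear subspace spanned by a cone $C(I)$ of dimension $<n$. $\Delta$ is pre-complete if $\Sigma^{(n)}\ne\emptyset$ and $d_v=\sum_{v\in C(I),\,I\in\Sigma^{(n)}}w(I)$ is independent of the generic vector $v$; this integer is $\deg(\Delta)$. For $K\in\Sigma$ the projected multi-fan $\Delta_K=(\Sigma_K,C_K,w_K^\pm)$ has $\Sigma_K=\{J\in\Sigma:K\le J\}$, $C_K(J)$ = the image of $C(J)$ in the quotient of $N_{\mathbb R}$ by the span of $C(K)$ (with lattice the quotient of $N$ by the subgroup generated by $C(K)\cap N$), and $w_K^\pm$ the restrictions of $w^\pm$. $\Delta$ is complete if $\Delta$ and all $\Delta_K$, $K\in\Sigma$, are pre-complete. $\Delta$ is simplicial if every $C(I)$ is generated by linearly independent vectors; then $\Sigma$ is identified with an augmented simplicial set (abstract simplicial complex including the empty set as minimum) of subsets of $\{1,\dots,d\}$ with $\Sigma^{(1)}=\{\{1\},\dots,\{d\}\}$, and $|I|$ is the cardinality of $I$. **Multi-polytopes.** Put $V=N_{\mathbb R}$, $V^*=\mathrm{Hom}(V,\mathbb R)$, $N^*=\mathrm{Hom}(N,\mathbb Z)\subset V^*$. A multi-polytope is a pair $\mathcal P=(\Delta,\mathcal F)$ where $\Delta$ is a complete multi-fan and $\mathcal F$ assigns to each $I\in\Sigma^{(1)}$ an affine hyperplane $\mathcal F(I)\subset V^*$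 on which the elements of $C(I)$ are constant; its dimension is that of $\Delta$. It is simple if $\Delta$ is simplicial. For simple $\mathcal P$ let $v_i$ be the primitive vector of $N$ in $C(\{i\})$ and write $F_i=\mathcal F(\{i\})=\{u\in V^*:\langle u,v_i\rangle=c_i\}$, $c_i\in\mathbb R$. For $I\in\Sigma^{(n)}$, $\bigcap_{i\in I}F_i$ is a point $u_I$ (a vertex); let $\{u_i^I\}_{i\in I}\subset V^*$ be the basis dual to $\{v_i\}_{i\in I}$. $\mathcal P$ is a lattice multi-polytope if every vertex $u_I$ lies in $N^*$. **Duistermaat-Heckman function.** Fix a generic $v\in V$. For $I\in\Sigma^{(n)}$ put $(-1)^I=(-1)^{\sharp\{i\in I:\langle u_i^I,v\rangle>0\}}$, $(u_i^I)^+=u_i^I$ if $\langle u_i^I,v\rangle>0$ and $-u_i^I$ if $\langle u_i^I,v\rangle<0$; let $\phi_I$ be the characteristic function of the cone with apex $u_I$ spanned by the $(u_i^I)^+$, $i\in I$. Then $\mathrm{DH}_{\mathcal P}=\sum_{I\in\Sigma^{(n)}}(-1)^Iw(I)\phi_I$ on $V^*\setminus\bigcup_iF_i$ (it is independent of $v$ and has bounded support). **Counting.** $\mathcal P_+$ (resp. $\mathcal P_-$) is the multi-polytope on $\Delta$ obtained by moving each $F_i$ slightly in the direction of $v_i$ (resp. $-v_i$), i.e. replacing $c_i$ by $c_i+\varepsilon$ (resp. $c_i-\varepsilon$) for sufficiently small $\varepsilon>0$; the moved hyperplanes miss $N^*$. Define $\sharp(\mathcal P)=\sum_{u\in N^*}\mathrm{DH}_{\mathcal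 P_+}(u)$ and $\sharp(\mathcal P^\circ)=\sum_{u\in N^*}\mathrm{DH}_{\mathcal P_-}(u)$. For an integer $\nu$ (not necessarily positive), $\nu\mathcal P=(\Delta,\nu\mathcal F)$ with $(\nu\mathcal F)(\{i\})=\{u:\langle u,v_i\rangle=\nu c_i\}$, and $\sharp(\nu\mathcal P^\circ)$ means $\sharp((\nu\mathcal P)^\circ)$. The volume is $\mathrm{vol}(\mathcal P)=\int_{V^*}\mathrm{DH}_{\mathcal P}\,dV^*$, where $dV^*$ is the volume element for which the unit cube determined by a basis of $N^*$ has volume $1$. *)

theory Defs
  imports "HOL-Analysis.Analysis" "HOL-Computational_Algebra.Polynomial"
begin

section \<open>Lattices and cones\<close>

text \<open>A lattice \<open>N\<close> is a subgroup of a real vector space that is freely generated by finitely many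
  linearly independent vectors. Its real span plays the role of \<open>N \<otimes> \<real>\<close>, and its rank is
  \<open>dim N\<close>. The ambient space may be larger than \<open>span N\<close>; this is needed for projected multi-fans.\<close>

definition is_lattice :: "'a::real_vector set \<Rightarrow> bool" where
  "is_lattice N \<longleftrightarrow> (\<exists>B. finite B \<and> independent B \<and>
     N = {\<Sum>b\<in>B. of_int (k b) *\<^sub>R b | k :: 'a \<Rightarrow> int. True})"

definition nonneg_hull :: "'a::real_vector set \<Rightarrow> 'a set" where
  "nonneg_hull S = {\<Sum>s\<in>S. a s *\<^sub>R s | a. \<forall>s\<in>S. 0 \<le> a s}"

definition cones :: "'a::real_vector set \<Rightarrow> 'a set set" where
  "cones N = {\<sigma>. (\<exists>S. finite S \<and> S \<subseteq> N \<and> \<sigma> = nonneg_hull S) \<and>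
                 (\<forall>x. x \<in> \<sigma> \<and> - x \<in> \<sigma> \<longrightarrow> x = 0)}"

definition primitive_in :: "'a::real_vector set \<Rightarrow> 'a \<Rightarrow> bool" where
  "primitive_in N x \<longleftrightarrow> x \<in> N \<and> x \<noteq> 0 \<and>
     (\<forall>y\<in>N. \<forall>k::int. x = of_int k *\<^sub>R y \<longrightarrow> \<bar>k\<bar> = 1)"

section \<open>Multi-fans\<close>

text \<open>The poset is a carrier \<open>idx\<close> with a relation \<open>leq\<close>, the set of pairs \<open>(I, J)\<close>
  with \<open>I \<le> J\<close>. The weights matter only on the indices of top-dimensional cones.\<close>

record ('s, 'a) multifan =
  lat :: "'a set"
  idx :: "'s set"
  leq :: "('s \<times> 's) set"
  cone_of :: "'s \<Rightarrow> 'a set"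
  wplus :: "'s \<Rightarrow> nat"
  wminus :: "'s \<Rightarrow> nat"

definition fan_dim :: "('s, 'a::real_vector) multifan \<Rightarrow> nat" where
  "fan_dim \<Delta> = dim (lat \<Delta>)"

definition idx_dim :: "('s, 'a::real_vector) multifan \<Rightarrow> nat \<Rightarrow> 's set" where
  "idx_dim \<Delta> m = {I \<in> idx \<Delta>. dim (cone_of \<Delta> I) = m}"

definition weight :: "('s, 'a::real_vector) multifan \<Rightarrow> 's \<Rightarrow> int" where
  "weight \<Delta> I = int (wplus \<Delta> I) - int (wminus \<Delta> I)"

text \<open>The faces of a cone that are themselves cones are its nonempty faces: \<open>face_of\<close> also admits the
  empty set, which is not in \<open>cones\<close>.\<close>

definition is_multifan :: "('s, 'a::real_vector) multifan \<Rightarrow> bool" where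
  "is_multifan \<Delta> \<longleftrightarrow>
     is_lattice (lat \<Delta>) \<and>
     finite (idx \<Delta>) \<and> leq \<Delta> \<subseteq> idx \<Delta> \<times> idx \<Delta> \<and> partial_order_on (idx \<Delta>) (leq \<Delta>) \<and>
     cone_of \<Delta> ` idx \<Delta> \<subseteq> cones (lat \<Delta>) \<and>
     (\<exists>z\<in>idx \<Delta>. (\<forall>I\<in>idx \<Delta>. (z, I) \<in> leq \<Delta>) \<and> cone_of \<Delta> z = {0}) \<and>
     (\<forall>I J. (I, J) \<in> leq \<Delta> \<and> I \<noteq> J \<longrightarrow>
        cone_of \<Delta> I face_of cone_of \<Delta> J \<and> cone_of \<Delta> I \<noteq> cone_of \<Delta> J) \<and>
     (\<forall>J\<in>idx \<Delta>.
        bij_betw (cone_of \<Delta>) {I \<in> idx \<Delta>. (I, J) \<in> leq \<Delta>}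
          {\<kappa> \<in> cones (lat \<Delta>). \<kappa> face_of cone_of \<Delta> J} \<and>
        (\<forall>I I'. (I, J) \<in> leq \<Delta> \<and> (I', J) \<in> leq \<Delta> \<longrightarrow>
           ((I, I') \<in> leq \<Delta> \<longleftrightarrow> cone_of \<Delta> I face_of cone_of \<Delta> I'))) \<and>
     (\<forall>I\<in>idx_dim \<Delta> (fan_dim \<Delta>). wplus \<Delta> I > 0 \<or> wminus \<Delta> I > 0)"

definition generic :: "('s, 'a::real_vector) multifan \<Rightarrow> 'a \<Rightarrow> bool" where
  "generic \<Delta> v \<longleftrightarrow> v \<in> span (lat \<Delta>) \<and>
     (\<forall>I\<in>idx \<Delta>. dim (cone_of \<Delta> I) < fan_dim \<Delta> \<longrightarrow> v \<notin> span (cone_of \<Delta> I))"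

definition deg_at :: "('s, 'a::real_vector) multifan \<Rightarrow> 'a \<Rightarrow> int" where
  "deg_at \<Delta> v = (\<Sum>I | I \<in> idx_dim \<Delta> (fan_dim \<Delta>) \<and> v \<in> cone_of \<Delta> I. weight \<Delta> I)"

definition pre_complete :: "('s, 'a::real_vector) multifan \<Rightarrow> bool" where
  "pre_complete \<Delta> \<longleftrightarrow> idx_dim \<Delta> (fan_dim \<Delta>) \<noteq> {} \<and>
     (\<exists>d. \<forall>v. generic \<Delta> v \<longrightarrow> deg_at \<Delta> v = d)"

definition fan_deg :: "('s, 'a::real_vector) multifan \<Rightarrow> int" where
  "fan_deg \<Delta> = (THE d. \<forall>v. generic \<Delta> v \<longrightarrow> deg_at \<Delta> v = d)"

text \<open>The quotient of a space by a subspace \<open>W\<close> is realised, inside the same type, as the image of a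
  chosen linear map with kernel \<open>W\<close> (a projection along \<open>W\<close> is an example). The lattice of the
  projected multi-fan is then the image of \<open>N\<close>, which is \<open>N\<close> modulo \<open>N \<inter> W\<close>; for
  \<open>W = span (C K)\<close> this intersection is the subgroup generated by \<open>C K \<inter> N\<close>, as \<open>C K\<close> is
  rational.\<close>

definition quotient_map :: "'a::real_vector set \<Rightarrow> 'a \<Rightarrow> 'a" where
  "quotient_map W = (SOME \<pi>. linear \<pi> \<and> {x. \<pi> x = 0} = W)"

definition projected :: "('s, 'a::real_vector) multifan \<Rightarrow> 's \<Rightarrow> ('s, 'a) multifan" where
  "projected \<Delta> K =
     (let \<pi> = quotient_map (span (cone_of \<Delta> K)); S = {J \<in> idx \<Delta>. (K, J) \<in> leq \<Delta>}
      in \<lparr> lat = \<pi> ` lat \<Delta>, idx = S, leq = leq \<Delta> \<inter> S \<times> S, cone_of = (\<lambda>J. \<pi> ` cone_of \<Delta> J),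
           wplus = wplus \<Delta>, wminus = wminus \<Delta> \<rparr>)"

definition fan_complete :: "('s, 'a::real_vector) multifan \<Rightarrow> bool" where
  "fan_complete \<Delta> \<longleftrightarrow> pre_complete \<Delta> \<and> (\<forall>K\<in>idx \<Delta>. pre_complete (projected \<Delta> K))"

definition simplicial :: "('s, 'a::real_vector) multifan \<Rightarrow> bool" where
  "simplicial \<Delta> \<longleftrightarrow>
     (\<forall>I\<in>idx \<Delta>. \<exists>S. finite S \<and> independent S \<and> cone_of \<Delta> I = nonneg_hull S)"

text \<open>The elements of \<open>I\<close>, when \<open>I\<close> is regarded as a simplex on the vertex set
  \<open>idx_dim \<Delta> 1\<close>.\<close>

definition verts :: "('s, 'a::real_vector) multifan \<Rightarrow> 's \<Rightarrow> 's set" where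
  "verts \<Delta> I = {i \<in> idx_dim \<Delta> 1. (i, I) \<in> leq \<Delta>}"

definition prim_vec :: "('s, 'a::real_vector) multifan \<Rightarrow> 's \<Rightarrow> 'a" where
  "prim_vec \<Delta> i = (THE x. x \<in> cone_of \<Delta> i \<and> primitive_in (lat \<Delta>) x)"

section \<open>Multi-polytopes\<close>

text \<open>From here on \<open>N\<close> spans the whole type \<open>'a\<close>, so that \<open>V = 'a\<close> and the dual space
  consists of the linear functionals on \<open>'a\<close>. A hyperplane in the dual is a level set of a nonzero
  linear form on it, that is, of evaluation at a nonzero vector.\<close>

type_synonym ('s, 'a) multipolytope = "('s, 'a) multifan \<times> ('s \<Rightarrow> ('a \<Rightarrow> real) set)"

definition level_set :: "'a::real_vector \<Rightarrow> real \<Rightarrow> ('a \<Rightarrow> real) set" where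
  "level_set x c = {u. linear u \<and> u x = c}"

definition is_multipolytope :: "('s, 'a::real_vector) multipolytope \<Rightarrow> bool" where
  "is_multipolytope P \<longleftrightarrow> (case P of (\<Delta>, F) \<Rightarrow>
     is_multifan \<Delta> \<and> span (lat \<Delta>) = UNIV \<and> fan_complete \<Delta> \<and>
     (\<forall>i\<in>idx_dim \<Delta> 1. (\<exists>x c. x \<noteq> 0 \<and> F i = level_set x c) \<and>
        (\<forall>x\<in>cone_of \<Delta> i. \<forall>u\<in>F i. \<forall>u'\<in>F i. u x = u' x)))"

definition simple_multipolytope :: "('s, 'a::real_vector) multipolytope \<Rightarrow> bool" where
  "simple_multipolytope P \<longleftrightarrow> is_multipolytope P \<and> simplicial (fst P)"

text \<open>The constant \<open>c\<^sub>i\<close> of the \<open>i\<close>-th hyperplane.\<close>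

definition offset :: "('s, 'a::real_vector) multipolytope \<Rightarrow> 's \<Rightarrow> real" where
  "offset P i = (THE c. snd P i = level_set (prim_vec (fst P) i) c)"

definition vertex :: "('s, 'a::real_vector) multipolytope \<Rightarrow> 's \<Rightarrow> 'a \<Rightarrow> real" where
  "vertex P I = (THE u. linear u \<and> (\<forall>i\<in>verts (fst P) I. u \<in> snd P i))"

definition dual_vec :: "('s, 'a::real_vector) multifan \<Rightarrow> 's \<Rightarrow> 's \<Rightarrow> 'a \<Rightarrow> real" where
  "dual_vec \<Delta> I i =
     (THE u. linear u \<and> (\<forall>j\<in>verts \<Delta> I. u (prim_vec \<Delta> j) = (if j = i then 1 else 0)))"

definition dual_lattice :: "'a::real_vector set \<Rightarrow> ('a \<Rightarrow> real) set" where
  "dual_lattice N = {u. linear u \<and> (\<forall>x\<in>N. u x \<in> \<int>)}"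

definition lattice_multipolytope :: "('s, 'a::real_vector) multipolytope \<Rightarrow> bool" where
  "lattice_multipolytope P \<longleftrightarrow> is_multipolytope P \<and>
     (\<forall>I\<in>idx_dim (fst P) (fan_dim (fst P)). vertex P I \<in> dual_lattice (lat (fst P)))"

text \<open>\<open>dilate\<close> is \<open>\<nu>P\<close>, and \<open>shift\<close> moves every hyperplane by \<open>e\<close> in the direction
  of its primitive vector.\<close>

definition dilate :: "int \<Rightarrow> ('s, 'a::real_vector) multipolytope \<Rightarrow> ('s, 'a) multipolytope" where
  "dilate \<nu> P = (fst P, \<lambda>i. level_set (prim_vec (fst P) i) (of_int \<nu> * offset P i))"

definition shift :: "real \<Rightarrow> ('s, 'a::real_vector) multipolytope \<Rightarrow> ('s, 'a) multipolytope" where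
  "shift e P = (fst P, \<lambda>i. level_set (prim_vec (fst P) i) (offset P i + e))"

section \<open>The Duistermaat-Heckman function, counting and volume\<close>

definition dual_vec_pos ::
    "('s, 'a::real_vector) multifan \<Rightarrow> 'a \<Rightarrow> 's \<Rightarrow> 's \<Rightarrow> 'a \<Rightarrow> real" where
  "dual_vec_pos \<Delta> v I i =
     (\<lambda>x. if dual_vec \<Delta> I i v > 0 then dual_vec \<Delta> I i x else - dual_vec \<Delta> I i x)"

definition vertex_cone ::
    "('s, 'a::real_vector) multipolytope \<Rightarrow> 'a \<Rightarrow> 's \<Rightarrow> ('a \<Rightarrow> real) set" where
  "vertex_cone P v I =
     {\<lambda>x. vertex P I x + (\<Sum>i\<in>verts (fst P) I. a i * dual_vec_pos (fst P) v I i x) | a.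
        \<forall>i\<in>verts (fst P) I. 0 \<le> a i}"

text \<open>The auxiliary generic vector \<open>v\<close> is kept as an argument. The function is given by the formula
  on the hyperplanes as well; they form a null set, and after a small shift they contain no lattice
  points, so these values are irrelevant for the volume and for counting.\<close>

definition DH :: "('s, 'a::real_vector) multipolytope \<Rightarrow> 'a \<Rightarrow> ('a \<Rightarrow> real) \<Rightarrow> int" where
  "DH P v u = (\<Sum>I\<in>idx_dim (fst P) (fan_dim (fst P)).
     (- 1) ^ card {i \<in> verts (fst P) I. dual_vec (fst P) I i v > 0} *
     weight (fst P) I * indicator (vertex_cone P v I) u)"

text \<open>The sum over the dual lattice has finite support once no lattice point lies on a hyperplane.\<close>

definition DH_sum :: "('s, 'a::real_vector) multipolytope \<Rightarrow> 'a \<Rightarrow> int" where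
  "DH_sum P v = (\<Sum>u | u \<in> dual_lattice (lat (fst P)) \<and> DH P v u \<noteq> 0. DH P v u)"

definition num_points :: "('s, 'a::real_vector) multipolytope \<Rightarrow> 'a \<Rightarrow> int" where
  "num_points P v = (THE k. \<forall>\<^sub>F e in at_right 0. DH_sum (shift e P) v = k)"

definition num_points_interior :: "('s, 'a::real_vector) multipolytope \<Rightarrow> 'a \<Rightarrow> int" where
  "num_points_interior P v = (THE k. \<forall>\<^sub>F e in at_right 0. DH_sum (shift (- e) P) v = k)"

text \<open>\<open>B\<close> is a \<open>\<int>\<close>-basis of the dual lattice: every element is a unique integral combination
  of \<open>B\<close>.\<close>

definition dual_lattice_basis :: "'a::real_vector set \<Rightarrow> ('a \<Rightarrow> real) set \<Rightarrow> bool" where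
  "dual_lattice_basis N B \<longleftrightarrow> finite B \<and>
     bij_betw (\<lambda>k x. \<Sum>b\<in>B. of_int (k b) * b x) (B \<rightarrow>\<^sub>E (UNIV :: int set)) (dual_lattice N)"

text \<open>Integration over the dual space in the coordinates given by a basis of the dual lattice, whose
  unit cube thus has volume one. The value does not depend on the basis.\<close>

definition mp_volume :: "('s, 'a::real_vector) multipolytope \<Rightarrow> 'a \<Rightarrow> real" where
  "mp_volume P v =
     (let B = (SOME B. dual_lattice_basis (lat (fst P)) B)
      in \<integral>t. real_of_int (DH P v (\<lambda>x. \<Sum>b\<in>B. t b * b x)) \<partial>(\<Pi>\<^sub>M b\<in>B. lborel))"

end

theory Submission
  imports Defs
begin

text \<open>Let \<open>n\<close> be the dimension and \<open>v\<close> generic. Off the hyperplanes, the Duistermaat-Heckman function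
  is \<open>\<Sum>\<^sub>I w(I) \<Prod>\<^sub>i ([u(v\<^sub>i) < c\<^sub>i] - [u\<^sub>i\<^sup>I(v) > 0])\<close>, the product being over \<open>i \<in> I\<close>. Expanding
  the product over the faces \<open>K\<close> of \<open>I\<close>, the coefficient of \<open>\<Prod>\<^sub>i [u(v\<^sub>i) < c\<^sub>i]\<close>, \<open>i \<in> K\<close>, is up to sign the
  degree of the projected multi-fan \<open>\<Delta>\<^sub>K\<close>; hence the function does not depend on \<open>v\<close>. A point \<open>u\<close> of
  its support lies in one of the cones, so \<open>u(v)\<close> is at least the minimum of the \<open>u\<^sub>I(v)\<close>; as this holds
  for every generic \<open>v\<close>, the support is bounded, and for \<open>\<nu> = 0\<close> only \<open>u = 0\<close> contributes, with value
  the degree. Replacing \<open>u\<close> and \<open>v\<close> by their negatives exchanges \<open>P\<^sub>+\<close> and \<open>P\<^sub>-\<close>, which is (2).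

  For polynomiality, weight the lattice point \<open>u\<close> by \<open>exp(s u(v))\<close> with \<open>s < 0\<close>. Translating each cone by
  its vertex, the weighted count becomes \<open>\<Sum>\<^sub>I w(I) exp(s \<nu> u\<^sub>I(v)) g\<^sub>I(s)\<close> with \<open>g\<^sub>I(s) = O(\<bar>s\<bar>\<^sup>-\<^sup>n)\<close>
  independent of \<open>\<nu>\<close>. The \<open>(n+1)\<close>-st difference in \<open>\<nu>\<close> multiplies the summand by
  \<open>(exp(s u\<^sub>I(v)) - 1)\<^sup>n\<^sup>+\<^sup>1 = O(\<bar>s\<bar>\<^sup>n\<^sup>+\<^sup>1)\<close>, so it vanishes in the limit \<open>s \<rightarrow> 0\<close>, where the
  weighted count is the number of points. The leading coefficient is a limit of Riemann sums.\<close>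

section \<open>Finite differences and Riemann sums\<close>

text \<open>The obstacle is that the cones are only simplicial: the vectors \<open>v\<^sub>i\<close>
  of a top-dimensional cone need not be a \<int>-basis of the lattice, so \<open>g\<^sub>I\<close>
  is in general not a product of geometric series. But the map from \<open>u\<close> to the integers
  \<open>u(v\<^sub>i)\<close> is injective on the dual lattice, and on the cone of \<open>I\<close>
  the weight factors over these integers. So \<open>g\<^sub>I\<close> is bounded by a product of
  \<open>n\<close> two-sided geometric series, each with a simple pole at \<open>s = 0\<close>; this
  is the origin of the exponent \<open>-n\<close>. The sign \<open>s < 0\<close> is forced: along
  every edge of the cones the value \<open>u(v)\<close> grows, and the weight has to decay there.
  That the vertices are lattice points enters twice: translation by \<nu> times a vertex permutes
  the dual lattice, so \<open>g\<^sub>I\<close> does not see \<nu>; and the offsets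
  \<open>c\<^sub>i\<close> are integers, so at lattice points every shift by an amount in (0,1)
  amounts to replacing \<open><\<close> by \<le> (outward) or to keeping \<open><\<close> (inward).
  The bound on the support is proportional to the absolute value of \<nu>. It gives finiteness, the
  case \<nu> = 0 and the bounded domain of the integral at once.\<close>

definition fwd_diff :: "(int \<Rightarrow> real) \<Rightarrow> int \<Rightarrow> real" where
  "fwd_diff f \<nu> = f (\<nu> + 1) - f \<nu>"

text \<open>Newton's forward difference formula. By Pascal's rule and the induction hypothesis for
  \<open>fwd_diff f\<close>, the series \<open>h\<close> has the same first difference as
  \<open>f\<close>; both agree at 0, and stepping up and down from 0 reaches every integer, negative
  ones included.\<close>

lemma newton_forward_expansion:
  assumes "(fwd_diff ^^ m) f = (\<lambda>_. 0)"
  shows "f \<nu> = (\<Sum>k<m. (fwd_diff ^^ k) f 0 * (of_int \<nu> gchoose k))"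
  using assms
proof (induction m arbitrary: f \<nu>)
  case 0
  then show ?case by (simp add: fun_eq_iff)
next
  case (Suc m)
  define h where "h \<nu> = (\<Sum>k<Suc m. (fwd_diff ^^ k) f 0 * (of_int \<nu> gchoose k))" for \<nu> :: int
  have IH: "fwd_diff f \<nu> = (\<Sum>k<m. (fwd_diff ^^ k) (fwd_diff f) 0 * (of_int \<nu> gchoose k))" for \<nu>
    by (rule Suc.IH) (use Suc.prems in \<open>simp add: funpow_Suc_right del: funpow.simps\<close>)
  have dh: "h (\<nu> + 1) - h \<nu> = f (\<nu> + 1) - f \<nu>" for \<nu>
  proof -
    have "h (\<nu> + 1) - h \<nu> =
        (\<Sum>k<Suc m. (fwd_diff ^^ k) f 0 * ((of_int \<nu> + 1 gchoose k) - (of_int \<nu> gchoose k)))"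
      unfolding h_def by (simp only: sum_subtractf[symmetric] right_diff_distrib[symmetric] of_int_add of_int_1)
    also have "\<dots> = (\<Sum>k<m. (fwd_diff ^^ Suc k) f 0 * (of_int \<nu> gchoose k))"
      by (simp only: sum.lessThan_Suc_shift gbinomial_Suc_Suc gbinomial_0 of_nat_Suc
          add_diff_cancel_right' diff_self mult_zero_right add_0_left)
    also have "\<dots> = fwd_diff f \<nu>"
      by (simp only: funpow_Suc_right o_apply IH[of \<nu>, symmetric])
    finally show ?thesis by (simp add: fwd_diff_def)
  qed
  have h0: "h 0 = f 0"
    unfolding h_def by (subst sum.lessThan_Suc_shift) (simp add: gbinomial_0_left)
  have "h \<nu> = f \<nu>"
  proof (induction \<nu> rule: int_induct[where k = 0])
    case (step1 i) with dh[of i] show ?case by simp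
  next
    case (step2 i) with dh[of "i - 1"] show ?case by simp
  qed (fact h0)
  then show ?case by (simp add: h_def)
qed

lemma poly_gchoose:
  fixes x :: real
  shows "poly (smult (1 / fact k) (\<Prod>i<k. [:- of_nat i, 1:])) x = x gchoose k"
  by (simp add: poly_prod gbinomial_prod_rev atLeast0LessThan)

lemma degree_prod_linear_le: "degree (\<Prod>i<k. [:- of_nat i, 1:] :: real poly) \<le> k"
  using degree_prod_sum_le[of "{..<k}" "\<lambda>i. [:- of_nat i, 1:] :: real poly"] by simp

lemma polynomial_if_fwd_diff_zero:
  assumes "(fwd_diff ^^ Suc n) f = (\<lambda>_. 0)"
  obtains p :: "real poly" where "degree p \<le> n" "\<And>\<nu>. f \<nu> = poly p (of_int \<nu>)"
proof
  define p where "p = (\<Sum>k<Suc n. smult ((fwd_diff ^^ k) f 0)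
    (smult (1 / fact k) (\<Prod>i<k. [:- of_nat i, 1:])) :: real poly)"
  show "degree p \<le> n" unfolding p_def
  proof (rule degree_sum_le)
    fix k assume "k \<in> {..<Suc n}"
    then show "degree (smult ((fwd_diff ^^ k) f 0)
        (smult (1 / fact k) (\<Prod>i<k. [:- of_nat i, 1:])) :: real poly) \<le> n"
      using degree_prod_linear_le[of k] by (meson degree_smult_le lessThan_iff less_Suc_eq_le order_trans)
  qed simp
  show "f \<nu> = poly p (of_int \<nu>)" for \<nu>
    unfolding p_def poly_sum poly_smult[of "(fwd_diff ^^ _) f 0"] poly_gchoose
    by (rule newton_forward_expansion[OF assms])
qed

text \<open>Exponentials are eigenvectors of the difference operator, with eigenvalue
  \<open>exp a - 1\<close>, which is small when \<open>a\<close> is.\<close>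

lemma fwd_diff_exp:
  "(fwd_diff ^^ m) (\<lambda>\<nu>. C * exp (of_int \<nu> * a)) = (\<lambda>\<nu>. C * (exp a - 1) ^ m * exp (of_int \<nu> * a))"
proof (induction m)
  case (Suc m)
  show ?case
    by (simp only: funpow.simps o_apply Suc.IH) (simp add: fwd_diff_def fun_eq_iff exp_add algebra_simps)
qed simp

lemma fwd_diff_sum:
  "(fwd_diff ^^ m) (\<lambda>\<nu>. \<Sum>i\<in>A. f i \<nu>) = (\<lambda>\<nu>. \<Sum>i\<in>A. (fwd_diff ^^ m) (f i) \<nu>)"
  by (induction m) (simp_all add: fwd_diff_def fun_eq_iff sum_subtractf)

lemma tendsto_fwd_diff:
  assumes "\<And>\<nu>. ((\<lambda>s. f s \<nu>) \<longlongrightarrow> g \<nu>) F"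
  shows "((\<lambda>s. (fwd_diff ^^ m) (f s) \<nu>) \<longlongrightarrow> (fwd_diff ^^ m) g \<nu>) F"
  using assms by (induction m arbitrary: \<nu>) (auto simp: fwd_diff_def intro!: tendsto_diff)

text \<open>Only a degree bound is assumed, so the limit is 0 when the degree drops below
  \<open>n\<close>. The points \<open>Suc m\<close> avoid a division by zero.\<close>

lemma coeff_limit_of_poly:
  fixes p :: "real poly"
  assumes "degree p \<le> n"
  shows "(\<lambda>m. poly p (real (Suc m)) / real (Suc m) ^ n) \<longlonglongrightarrow> coeff p n"
proof -
  have "(\<lambda>m. \<Sum>k\<le>n. coeff p k * (real (Suc m) ^ k / real (Suc m) ^ n))
      \<longlonglongrightarrow> (\<Sum>k\<le>n. coeff p k * (if k = n then 1 else 0))"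
  proof (intro tendsto_sum tendsto_mult tendsto_const)
    fix k assume k: "k \<in> {..n}"
    show "(\<lambda>m. real (Suc m) ^ k / real (Suc m) ^ n) \<longlonglongrightarrow> (if k = n then 1 else 0)"
    proof (cases "k = n")
      case False
      with k have "k < n" by simp
      have "(\<lambda>m. inverse (real (Suc m)) ^ (n - k)) \<longlonglongrightarrow> 0 ^ (n - k)"
        by (intro tendsto_power LIMSEQ_inverse_real_of_nat)
      moreover have "inverse (real (Suc m)) ^ (n - k) = real (Suc m) ^ k / real (Suc m) ^ n" for m
        using \<open>k < n\<close> by (simp add: power_diff power_inverse field_simps del: of_nat_Suc)
      ultimately show ?thesis using \<open>k < n\<close> by (simp add: zero_power del: of_nat_Suc)
    qed simp
  qed
  moreover have "(\<Sum>k\<le>n. coeff p k * (real (Suc m) ^ k / real (Suc m) ^ n))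
      = poly p (real (Suc m)) / real (Suc m) ^ n" for m
  proof -
    have "poly p (real (Suc m)) = (\<Sum>k\<le>n. coeff p k * real (Suc m) ^ k)"
      unfolding poly_altdef by (rule sum.mono_neutral_left) (use assms in \<open>auto simp: coeff_eq_0\<close>)
    then show ?thesis by (simp add: sum_divide_distrib del: of_nat_Suc)
  qed
  ultimately show ?thesis by (simp add: if_distrib[of "(*) _"] cong: if_cong)
qed

text \<open>Reduction modulo 2: the integral linear map given by \<open>M\<close> induces a surjection of
  \<open>(\<int>/2)\<^sup>A\<close> onto \<open>(\<int>/2)\<^sup>B\<close>.\<close>

lemma card_le_of_integral_surj:
  fixes M :: "'a \<Rightarrow> 'b \<Rightarrow> int"
  assumes A: "finite A" and B: "finite B"
    and surj: "\<And>y. \<exists>x. \<forall>b\<in>B. y b = (\<Sum>a\<in>A. x a * M a b)"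
  shows "card B \<le> card A"
proof -
  define f where "f x = (\<lambda>b\<in>B. (\<Sum>a\<in>A. x a * M a b) mod 2)" for x :: "'a \<Rightarrow> int"
  have "(B \<rightarrow>\<^sub>E {0, 1}) \<subseteq> f ` (A \<rightarrow>\<^sub>E {0, 1})"
  proof
    fix y :: "'b \<Rightarrow> int" assume y: "y \<in> B \<rightarrow>\<^sub>E {0, 1}"
    obtain x where x: "\<And>b. b \<in> B \<Longrightarrow> y b = (\<Sum>a\<in>A. x a * M a b)" using surj by metis
    let ?x = "\<lambda>a\<in>A. x a mod 2"
    have "f ?x = y"
    proof
      fix b
      show "f ?x b = y b"
      proof (cases "b \<in> B")
        case True
        have "f ?x b = (\<Sum>a\<in>A. (x a mod 2) * M a b) mod 2" using True by (simp add: f_def)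
        also have "\<dots> = (\<Sum>a\<in>A. ((x a mod 2) * M a b) mod 2) mod 2" by (simp add: mod_sum_eq)
        also have "\<dots> = (\<Sum>a\<in>A. (x a * M a b) mod 2) mod 2" by (simp add: mod_mult_left_eq)
        also have "\<dots> = y b mod 2" by (simp add: mod_sum_eq x[OF True])
        also have "y b = 0 \<or> y b = 1" using y True by auto
        then have "y b mod 2 = y b" by auto
        finally show ?thesis .
      next
        case False
        with y show ?thesis by (auto simp: f_def PiE_def extensional_def)
      qed
    qed
    moreover have "?x \<in> A \<rightarrow>\<^sub>E {0, 1}" by auto
    ultimately show "y \<in> f ` (A \<rightarrow>\<^sub>E {0, 1})" by blast
  qed
  moreover have "finite (A \<rightarrow>\<^sub>E {0::int, 1})" using A by (intro finite_PiE) auto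
  ultimately have "card (B \<rightarrow>\<^sub>E {0::int, 1}) \<le> card (A \<rightarrow>\<^sub>E {0::int, 1})"
    by (rule surj_card_le[rotated])
  then show ?thesis using A B by (simp add: card_PiE)
qed

section \<open>Two-sided geometric sums\<close>

lemma sum_symmetric_interval_le:
  fixes f :: "nat \<Rightarrow> real"
  assumes "\<And>j. 0 \<le> f j"
  shows "(\<Sum>m\<in>{- int M..int M}. f (nat \<bar>m\<bar>)) \<le> 2 * (\<Sum>j\<le>M. f j)"
proof (induction M)
  case 0
  then show ?case using assms[of 0] by simp
next
  case (Suc M)
  have "{- int (Suc M)..int (Suc M)} = insert (- int (Suc M)) (insert (int (Suc M)) {- int M..int M})"
    by auto
  then have "(\<Sum>m\<in>{- int (Suc M)..int (Suc M)}. f (nat \<bar>m\<bar>))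
      = f (Suc M) + (f (Suc M) + (\<Sum>m\<in>{- int M..int M}. f (nat \<bar>m\<bar>)))"
    by (simp add: nat_add_distrib)
  then show ?case using Suc.IH by (simp add: algebra_simps)
qed

text \<open>The factor 2 accounts for the two signs of \<open>m\<close>. What matters later is that
  the bound is uniform in \<open>M\<close> and has a simple pole at \<open>r = 1\<close>.\<close>

lemma sum_two_sided_geometric_le:
  fixes r :: real
  assumes "0 \<le> r" "r < 1"
  shows "(\<Sum>m\<in>{- int M..int M}. r ^ nat \<bar>m\<bar>) \<le> 2 / (1 - r)"
proof -
  have "(\<Sum>j\<le>M. r ^ j) = (1 - r ^ Suc M) / (1 - r)"
    using assms sum_gp0[of r M] by simp
  also have "\<dots> \<le> 1 / (1 - r)" using assms by (intro divide_right_mono) auto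
  finally have "2 * (\<Sum>j\<le>M. r ^ j) \<le> 2 / (1 - r)" by simp
  then show ?thesis
    using sum_symmetric_interval_le[of "\<lambda>j. r ^ j" M] assms by simp
qed

section \<open>Null sets and Riemann sums for products of Lebesgue measure\<close>

lemma product_sigma_finite_lborel: "product_sigma_finite (\<lambda>_. lborel :: real measure)"
  by standard

text \<open>Fubini in the coordinate \<open>b0\<close>: once the other coordinates are fixed, the
  equation leaves a single value for \<open>t b0\<close>, and points are null sets.\<close>

lemma AE_PiM_hyperplane:
  fixes \<beta> :: "'b \<Rightarrow> real"
  assumes B: "finite B" and b0: "b0 \<in> B" "\<beta> b0 \<noteq> 0"
  shows "AE t in \<Pi>\<^sub>M b\<in>B. lborel. (\<Sum>b\<in>B. t b * \<beta> b) \<noteq> c"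
proof -
  interpret product_sigma_finite "\<lambda>_::'b. lborel :: real measure"
    by (rule product_sigma_finite_lborel)
  define B' where "B' = B - {b0}"
  have B': "B = insert b0 B'" "b0 \<notin> B'" "finite B'" using B b0 by (auto simp: B'_def)
  let ?M = "\<Pi>\<^sub>M b\<in>B. lborel :: real measure"
  define N where "N = {t \<in> space ?M. (\<Sum>b\<in>B. t b * \<beta> b) = c}"
  have N [measurable]: "N \<in> sets ?M" unfolding N_def by measurable
  have inner: "(\<integral>\<^sup>+ y. indicator N (x(b0 := y)) \<partial>lborel) = 0" for x :: "'b \<Rightarrow> real"
  proof -
    let ?y = "(c - (\<Sum>b\<in>B'. x b * \<beta> b)) / \<beta> b0"
    have "indicator N (x(b0 := y)) \<le> (indicator {?y} y :: ennreal)" for y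
    proof (cases "x(b0 := y) \<in> N")
      case True
      then have "(\<Sum>b\<in>B. (x(b0 := y)) b * \<beta> b) = c" by (simp add: N_def)
      also have "(\<Sum>b\<in>B. (x(b0 := y)) b * \<beta> b) = y * \<beta> b0 + (\<Sum>b\<in>B'. (x(b0 := y)) b * \<beta> b)"
        using B' by simp
      also have "(\<Sum>b\<in>B'. (x(b0 := y)) b * \<beta> b) = (\<Sum>b\<in>B'. x b * \<beta> b)"
        by (rule sum.cong) (use B' in auto)
      finally have "y = ?y" using b0 by (simp add: field_simps)
      then show ?thesis by (simp add: indicator_def)
    qed simp
    then have "(\<integral>\<^sup>+ y. indicator N (x(b0 := y)) \<partial>lborel) \<le> (\<integral>\<^sup>+ y. indicator {?y} y \<partial>lborel)"
      by (intro nn_integral_mono) auto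
    then show ?thesis by simp
  qed
  have "emeasure ?M N = (\<integral>\<^sup>+ t. indicator N t \<partial>?M)" by simp
  also have "\<dots> = (\<integral>\<^sup>+ x. (\<integral>\<^sup>+ y. indicator N (x(b0 := y)) \<partial>lborel) \<partial>(\<Pi>\<^sub>M b\<in>B'. lborel))"
    using N unfolding B' by (intro product_nn_integral_insert) (use B' in auto)
  also have "\<dots> = 0" by (simp only: inner nn_integral_const mult_zero_left)
  finally have "N \<in> null_sets ?M" by (simp add: null_sets_def N del: fun_upd_apply)
  then show ?thesis by (rule AE_I') (auto simp: N_def)
qed

lemma emeasure_PiM_lborel_box:
  fixes l u :: "'b \<Rightarrow> real"
  assumes "finite B" "\<And>b. b \<in> B \<Longrightarrow> l b \<le> u b"
  shows "emeasure (\<Pi>\<^sub>M b\<in>B. lborel) (\<Pi>\<^sub>E b\<in>B. {l b..<u b}) = ennreal (\<Prod>b\<in>B. u b - l b)"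
    and "emeasure (\<Pi>\<^sub>M b\<in>B. lborel) (\<Pi>\<^sub>E b\<in>B. {l b..u b}) = ennreal (\<Prod>b\<in>B. u b - l b)"
proof -
  interpret product_sigma_finite "\<lambda>_::'b. lborel :: real measure"
    by (rule product_sigma_finite_lborel)
  have *: "(\<Prod>b\<in>B. ennreal (u b - l b)) = ennreal (\<Prod>b\<in>B. u b - l b)"
    by (rule prod_ennreal) (use assms in auto)
  show "emeasure (\<Pi>\<^sub>M b\<in>B. lborel) (\<Pi>\<^sub>E b\<in>B. {l b..<u b}) = ennreal (\<Prod>b\<in>B. u b - l b)"
    by (subst emeasure_PiM) (use assms * in auto)
  show "emeasure (\<Pi>\<^sub>M b\<in>B. lborel) (\<Pi>\<^sub>E b\<in>B. {l b..u b}) = ennreal (\<Prod>b\<in>B. u b - l b)"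
    by (subst emeasure_PiM) (use assms * in auto)
qed

text \<open>The scaled sum is the integral of the step function \<open>f m\<close>, which on each
  cube of side \<open>1 / Suc m\<close> takes the value of \<open>h\<close> at the lower corner;
  dominated convergence does the rest. Continuity is asked for only along the lower corners of the
  cubes that contain \<open>t\<close>.\<close>

lemma riemann_sum_tendsto_integral_PiM:
  fixes h :: "('b \<Rightarrow> real) \<Rightarrow> real"
  assumes B: "finite B"
    and bounded: "\<And>t. \<bar>h t\<bar> \<le> C"
    and supp: "\<And>t b. t \<in> B \<rightarrow>\<^sub>E UNIV \<Longrightarrow> h t \<noteq> 0 \<Longrightarrow> b \<in> B \<Longrightarrow> \<bar>t b\<bar> \<le> R"
    and meas [measurable]: "h \<in> borel_measurable (\<Pi>\<^sub>M b\<in>B. lborel)"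
    and cont: "AE t in \<Pi>\<^sub>M b\<in>B. lborel.
      (\<lambda>m. h (\<lambda>b\<in>B. of_int \<lfloor>real (Suc m) * t b\<rfloor> / real (Suc m))) \<longlonglongrightarrow> h t"
  shows "(\<lambda>m. (\<Sum>k | k \<in> B \<rightarrow>\<^sub>E (UNIV :: int set) \<and> h (\<lambda>b\<in>B. of_int (k b) / real (Suc m)) \<noteq> 0.
      h (\<lambda>b\<in>B. of_int (k b) / real (Suc m))) / real (Suc m) ^ card B)
    \<longlonglongrightarrow> (\<integral>t. h t \<partial>(\<Pi>\<^sub>M b\<in>B. lborel))"
proof -
  let ?M = "\<Pi>\<^sub>M b\<in>B. lborel :: real measure"
  interpret product_sigma_finite "\<lambda>_::'b. lborel :: real measure"
    by (rule product_sigma_finite_lborel)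
  define r where "r m k = (\<lambda>b\<in>B. of_int (k b) / real (Suc m))" for m and k :: "'b \<Rightarrow> int"
  define f where "f m t = h (r m (\<lambda>b. \<lfloor>real (Suc m) * t b\<rfloor>))" for m and t :: "'b \<Rightarrow> real"
  define S where "S m = {k \<in> B \<rightarrow>\<^sub>E (UNIV :: int set). h (r m k) \<noteq> 0}" for m
  \<comment> \<open>Half-open cubes partition the space, so each \<open>t\<close> lies in exactly
    one of them, the one indexed by the floors.\<close>
  define box where "box m k = (\<Pi>\<^sub>E b\<in>B. {of_int (k b) / real (Suc m)..<(of_int (k b) + 1) / real (Suc m)})"
    for m and k :: "'b \<Rightarrow> int"
  have C0: "0 \<le> C" using bounded[of undefined] by linarith
  have r_PiE: "r m k \<in> B \<rightarrow>\<^sub>E UNIV" for m k by (auto simp: r_def)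
  have finS: "finite (S m)" for m
  proof (rule finite_subset)
    show "S m \<subseteq> B \<rightarrow>\<^sub>E {\<lfloor>- (R * real (Suc m))\<rfloor>..\<lceil>R * real (Suc m)\<rceil>}"
    proof
      fix k assume k: "k \<in> S m"
      have "k b \<in> {\<lfloor>- (R * real (Suc m))\<rfloor>..\<lceil>R * real (Suc m)\<rceil>}" if "b \<in> B" for b
      proof -
        have "\<bar>of_int (k b) / real (Suc m)\<bar> \<le> R"
          using supp[OF r_PiE, of m k b] k that by (simp add: S_def r_def)
        then have "\<bar>of_int (k b)\<bar> \<le> R * real (Suc m)" by (simp add: field_simps)
        then show ?thesis by (simp only: atLeastAtMost_iff) linarith
      qed
      then show "k \<in> B \<rightarrow>\<^sub>E {\<lfloor>- (R * real (Suc m))\<rfloor>..\<lceil>R * real (Suc m)\<rceil>}"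
        using k by (auto simp: S_def PiE_iff)
    qed
    show "finite (B \<rightarrow>\<^sub>E {\<lfloor>- (R * real (Suc m))\<rfloor>..\<lceil>R * real (Suc m)\<rceil>})"
      using B by (intro finite_PiE) auto
  qed
  have box_iff: "t \<in> box m k \<longleftrightarrow> k = (\<lambda>b\<in>B. \<lfloor>real (Suc m) * t b\<rfloor>)"
    if "t \<in> B \<rightarrow>\<^sub>E UNIV" "k \<in> B \<rightarrow>\<^sub>E UNIV" for t m k
  proof -
    have "t \<in> box m k \<longleftrightarrow> (\<forall>b\<in>B. \<lfloor>real (Suc m) * t b\<rfloor> = k b)"
      using that by (simp add: box_def PiE_iff floor_eq_iff field_simps)
    also have "\<dots> \<longleftrightarrow> k = (\<lambda>b\<in>B. \<lfloor>real (Suc m) * t b\<rfloor>)"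
      using that by (auto simp: fun_eq_iff PiE_iff extensional_def)
    finally show ?thesis .
  qed
  have box_sets [measurable]: "box m k \<in> sets ?M" for m k
    unfolding box_def by (intro sets_PiM_I_finite B) auto
  have box_measure: "measure ?M (box m k) = 1 / real (Suc m) ^ card B"
    and box_finite: "emeasure ?M (box m k) < \<infinity>" for m k
  proof -
    have side: "(of_int (k b) + 1) / real (Suc m) - of_int (k b) / real (Suc m) = 1 / real (Suc m)" for b
      by (simp only: diff_divide_distrib[symmetric] add_diff_cancel_left')
    have "emeasure ?M (box m k) = ennreal
        (\<Prod>b\<in>B. (of_int (k b) + 1) / real (Suc m) - of_int (k b) / real (Suc m))"
      unfolding box_def by (rule emeasure_PiM_lborel_box(1)[OF B]) (simp add: divide_right_mono)
    then have e: "emeasure ?M (box m k) = ennreal (1 / real (Suc m) ^ card B)"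
      by (simp only: side prod_constant power_one_over)
    show "measure ?M (box m k) = 1 / real (Suc m) ^ card B" by (simp add: measure_def e)
    show "emeasure ?M (box m k) < \<infinity>" by (simp add: e)
  qed
  have f_step: "f m t = (\<Sum>k\<in>S m. h (r m k) * indicator (box m k) t)" if "t \<in> space ?M" for m t
  proof -
    have t: "t \<in> B \<rightarrow>\<^sub>E UNIV" using that by (simp add: space_PiM)
    let ?k = "\<lambda>b\<in>B. \<lfloor>real (Suc m) * t b\<rfloor>"
    have rk: "r m ?k = r m (\<lambda>b. \<lfloor>real (Suc m) * t b\<rfloor>)" by (auto simp: r_def)
    have "(\<Sum>k\<in>S m. h (r m k) * indicator (box m k) t) = (\<Sum>k\<in>S m. if k = ?k then h (r m ?k) else 0)"
      by (rule sum.cong) (use box_iff[OF t] in \<open>auto simp: S_def indicator_def\<close>)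
    also have "\<dots> = (if ?k \<in> S m then h (r m ?k) else 0)" using finS by (simp add: sum.delta)
    also have "\<dots> = h (r m ?k)" by (auto simp: S_def)
    finally show ?thesis by (simp only: f_def rk)
  qed
  have int_f: "(\<integral>t. f m t \<partial>?M) = (\<Sum>k\<in>S m. h (r m k)) / real (Suc m) ^ card B" for m
  proof -
    have "(\<integral>t. f m t \<partial>?M) = (\<integral>t. (\<Sum>k\<in>S m. h (r m k) * indicator (box m k) t) \<partial>?M)"
      by (rule Bochner_Integration.integral_cong[OF refl]) (rule f_step)
    also have "\<dots> = (\<Sum>k\<in>S m. \<integral>t. h (r m k) * indicator (box m k) t \<partial>?M)"
      by (rule Bochner_Integration.integral_sum)
        (use box_finite in \<open>auto intro!: integrable_mult_right integrable_real_indicator\<close>)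
    also have "\<dots> = (\<Sum>k\<in>S m. h (r m k) * (1 / real (Suc m) ^ card B))"
      by (rule sum.cong) (simp_all add: box_measure Int_absorb2 sets.sets_into_space del: of_nat_Suc)
    finally show ?thesis by (simp add: sum_divide_distrib)
  qed
  \<comment> \<open>Where \<open>f m t\<close> is nonzero, the corner has coordinates of size at
    most \<open>R\<close>, and \<open>t\<close> is within \<open>1 / Suc m \<le> 1\<close> of it.
    The absolute value keeps the endpoints ordered for every real \<open>R\<close>.\<close>
  define D where "D = (\<Pi>\<^sub>E b\<in>B. {- (\<bar>R\<bar> + 1)..\<bar>R\<bar> + 1})"
  have D_sets [measurable]: "D \<in> sets ?M" unfolding D_def by (intro sets_PiM_I_finite B) auto
  have D_fin: "emeasure ?M D < \<infinity>"
    unfolding D_def by (subst emeasure_PiM_lborel_box(2)) (use B in auto)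
  have f_bound: "\<bar>f m t\<bar> \<le> C * indicator D t" if "t \<in> space ?M" for m t
  proof (cases "f m t = 0")
    case True
    then show ?thesis using C0 by (simp add: indicator_def)
  next
    case False
    have "\<bar>t b\<bar> \<le> \<bar>R\<bar> + 1" if b: "b \<in> B" for b
    proof -
      have 1: "\<bar>of_int \<lfloor>real (Suc m) * t b\<rfloor> / real (Suc m)\<bar> \<le> R"
        using supp[OF r_PiE, of m "\<lambda>b. \<lfloor>real (Suc m) * t b\<rfloor>" b] False b by (simp add: f_def r_def)
      have "t b - of_int \<lfloor>real (Suc m) * t b\<rfloor> / real (Suc m)
          = (real (Suc m) * t b - of_int \<lfloor>real (Suc m) * t b\<rfloor>) / real (Suc m)"
        by (simp add: diff_divide_distrib del: of_nat_Suc)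
      then have "\<bar>t b - of_int \<lfloor>real (Suc m) * t b\<rfloor> / real (Suc m)\<bar>
          = \<bar>real (Suc m) * t b - of_int \<lfloor>real (Suc m) * t b\<rfloor>\<bar> / real (Suc m)"
        by (simp only: abs_divide abs_of_nat)
      also have "\<dots> \<le> 1 / real (Suc m)"
        by (intro divide_right_mono) linarith+
      also have "\<dots> \<le> 1" by simp
      finally show ?thesis using 1 by linarith
    qed
    then have "- (\<bar>R\<bar> + 1) \<le> t b" "t b \<le> \<bar>R\<bar> + 1" if "b \<in> B" for b
      using that by (simp_all only: abs_le_iff) (metis minus_le_iff)
    then have "t \<in> D" using that by (simp add: D_def space_PiM PiE_iff)
    then show ?thesis using bounded by (simp add: f_def)
  qed
  have f_meas: "f m \<in> borel_measurable ?M" for m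
  proof -
    have "(\<lambda>t. \<Sum>k\<in>S m. h (r m k) * indicator (box m k) t) \<in> borel_measurable ?M"
      by (intro borel_measurable_sum borel_measurable_times borel_measurable_const
          borel_measurable_indicator box_sets)
    then show ?thesis by (simp only: measurable_cong[OF f_step])
  qed
  have "(\<lambda>m. \<integral>t. f m t \<partial>?M) \<longlonglongrightarrow> (\<integral>t. h t \<partial>?M)"
  proof (rule integral_dominated_convergence[where w = "\<lambda>t. C * indicator D t"])
    show "integrable ?M (\<lambda>t. C * indicator D t :: real)"
      using D_fin by (auto intro!: integrable_mult_right integrable_real_indicator)
    show "AE t in ?M. (\<lambda>m. f m t) \<longlonglongrightarrow> h t" using cont by (simp add: f_def r_def)
    show "AE t in ?M. norm (f m t) \<le> C * indicator D t" for m
      using f_bound by (intro AE_I2) simp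
  qed (fact meas f_meas)+
  then show ?thesis unfolding int_f S_def r_def .
qed

section \<open>Lattice points in signed sums of cones\<close>

text \<open>A top-dimensional cone \<open>I\<close> has generators \<open>p i\<close> and dual basis \<open>d I i\<close> (\<open>i \<in> vs I\<close>); \<open>B\<close> is a
  basis of the dual lattice with coordinates given by evaluation at \<open>x b\<close>. For a point \<open>u\<close> off the
  hyperplanes and \<open>Q i = (u (p i) < c i)\<close>, the number \<open>crossing Q g\<close> is the value of the
  Duistermaat-Heckman function at \<open>u\<close>.\<close>

locale dual_cones =
  fixes T :: "'s set" and vs :: "'s \<Rightarrow> 'i set" and p :: "'i \<Rightarrow> 'a::real_vector"
    and d :: "'s \<Rightarrow> 'i \<Rightarrow> 'a \<Rightarrow> real" and w :: "'s \<Rightarrow> int" and c :: "'i \<Rightarrow> real" and n :: nat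
    and G :: "'a set" and g :: 'a and B :: "('a \<Rightarrow> real) set" and x :: "('a \<Rightarrow> real) \<Rightarrow> 'a"
  assumes finite_T: "finite T"
    and finite_vs: "I \<in> T \<Longrightarrow> finite (vs I)"
    and card_vs: "I \<in> T \<Longrightarrow> card (vs I) = n"
    and dual_expand: "I \<in> T \<Longrightarrow> linear u \<Longrightarrow> u y = (\<Sum>i\<in>vs I. u (p i) * d I i y)"
    and linear_d: "I \<in> T \<Longrightarrow> i \<in> vs I \<Longrightarrow> linear (d I i)"
    and d_p: "I \<in> T \<Longrightarrow> i \<in> vs I \<Longrightarrow> j \<in> vs I \<Longrightarrow> d I i (p j) = (if i = j then 1 else 0)"
    and generic_nonzero: "h \<in> G \<Longrightarrow> I \<in> T \<Longrightarrow> i \<in> vs I \<Longrightarrow> d I i h \<noteq> 0"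
    and g: "g \<in> G"
    and uminus_G: "h \<in> G \<Longrightarrow> - h \<in> G"
    and span_G: "span G = UNIV"
    and generic_indep: "h \<in> G \<Longrightarrow> h' \<in> G \<Longrightarrow>
      (\<Sum>I\<in>T. w I * (\<Prod>i\<in>vs I. of_bool (Q i) - of_bool (d I i h > 0))) =
      (\<Sum>I\<in>T. w I * (\<Prod>i\<in>vs I. of_bool (Q i) - of_bool (d I i h' > 0)))"
    and finite_B: "finite B"
    and linear_B: "b \<in> B \<Longrightarrow> linear b"
    and card_B: "card B = n"
    and B_x: "b \<in> B \<Longrightarrow> b' \<in> B \<Longrightarrow> b (x b') = (if b = b' then 1 else 0)"
    and B_p_int: "I \<in> T \<Longrightarrow> i \<in> vs I \<Longrightarrow> b \<in> B \<Longrightarrow> b (p i) \<in> \<int>"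
    and B_p_nonzero: "I \<in> T \<Longrightarrow> i \<in> vs I \<Longrightarrow> \<exists>b\<in>B. b (p i) \<noteq> 0"
    and vertex_integral: "I \<in> T \<Longrightarrow>
      \<exists>k. (\<lambda>y. \<Sum>i\<in>vs I. c i * d I i y) = (\<lambda>y. \<Sum>b\<in>B. of_int (k b) * b y)"
begin

definition comb :: "(('a \<Rightarrow> real) \<Rightarrow> real) \<Rightarrow> 'a \<Rightarrow> real" where
  "comb t = (\<lambda>y. \<Sum>b\<in>B. t b * b y)"

definition Lat :: "('a \<Rightarrow> real) set" where
  "Lat = {comb (\<lambda>b. of_int (k b)) | k. True}"

definition vtx :: "'s \<Rightarrow> 'a \<Rightarrow> real" where
  "vtx I y = (\<Sum>i\<in>vs I. c i * d I i y)"

definition crossing :: "('i \<Rightarrow> bool) \<Rightarrow> 'a \<Rightarrow> int" where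
  "crossing Q h = (\<Sum>I\<in>T. w I * (\<Prod>i\<in>vs I. of_bool (Q i) - of_bool (d I i h > 0)))"

definition closed_at :: "real \<Rightarrow> ('a \<Rightarrow> real) \<Rightarrow> int" where
  "closed_at \<nu> u = crossing (\<lambda>i. u (p i) \<le> \<nu> * c i) g"

definition open_at :: "real \<Rightarrow> ('a \<Rightarrow> real) \<Rightarrow> int" where
  "open_at \<nu> u = crossing (\<lambda>i. u (p i) < \<nu> * c i) g"

definition closed_count :: "real \<Rightarrow> int" where
  "closed_count \<nu> = (\<Sum>u | u \<in> Lat \<and> closed_at \<nu> u \<noteq> 0. closed_at \<nu> u)"

definition open_count :: "real \<Rightarrow> int" where
  "open_count \<nu> = (\<Sum>u | u \<in> Lat \<and> open_at \<nu> u \<noteq> 0. open_at \<nu> u)"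

section \<open>Support of the counting function, and reciprocity\<close>

lemma crossing_generic: "h \<in> G \<Longrightarrow> h' \<in> G \<Longrightarrow> crossing Q h = crossing Q h'"
  unfolding crossing_def by (rule generic_indep)

lemma crossing_nonzeroE:
  assumes "crossing Q h \<noteq> 0"
  obtains I where "I \<in> T" "\<And>i. i \<in> vs I \<Longrightarrow> Q i \<noteq> (d I i h > 0)"
proof -
  from assms obtain I where I: "I \<in> T" "w I * (\<Prod>i\<in>vs I. of_bool (Q i) - of_bool (d I i h > 0)) \<noteq> 0"
    unfolding crossing_def by (meson sum.neutral)
  then have "\<forall>i\<in>vs I. of_bool (Q i) - of_bool (d I i h > 0) \<noteq> (0::int)"
    using finite_vs[OF I(1)] by auto
  then have "Q i \<noteq> (d I i h > 0)" if "i \<in> vs I" for i using that by fastforce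
  with I(1) show ?thesis by (rule that)
qed

lemma crossing_abs_le: "\<bar>crossing Q h\<bar> \<le> (\<Sum>I\<in>T. \<bar>w I\<bar>)"
proof -
  have "\<bar>w I * (\<Prod>i\<in>vs I. of_bool (Q i) - of_bool (d I i h > 0))\<bar> \<le> \<bar>w I\<bar>" for I
  proof -
    have "\<bar>\<Prod>i\<in>vs I. of_bool (Q i) - of_bool (d I i h > 0)\<bar> \<le> (1::int)"
      unfolding abs_prod by (rule prod_le_1) auto
    from mult_left_mono[OF this, of "\<bar>w I\<bar>"] show ?thesis by (simp add: abs_mult)
  qed
  then show ?thesis unfolding crossing_def by (intro order_trans[OF sum_abs] sum_mono)
qed

text \<open>Each factor changes its sign: \<open>d I i h\<close> is nonzero, so both indicators turn
  into one minus themselves when \<open>Q\<close> is negated and \<open>h\<close> reversed, and the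
  two ones cancel. There are \<open>n\<close> factors.\<close>

lemma crossing_complement:
  assumes "h \<in> G"
  shows "crossing (\<lambda>i. \<not> Q i) h = (- 1) ^ n * crossing Q (- h)"
proof -
  have "(\<Prod>i\<in>vs I. of_bool (\<not> Q i) - of_bool (d I i h > 0) :: int)
      = (- 1) ^ n * (\<Prod>i\<in>vs I. of_bool (Q i) - of_bool (d I i (- h) > 0))" if I: "I \<in> T" for I
  proof -
    have "(\<Prod>i\<in>vs I. of_bool (\<not> Q i) - of_bool (d I i h > 0) :: int)
        = (\<Prod>i\<in>vs I. (- 1) * (of_bool (Q i) - of_bool (d I i (- h) > 0)))"
    proof (rule prod.cong[OF refl])
      fix i assume i: "i \<in> vs I"
      have "d I i (- h) = - d I i h" using linear_d[OF I i] by (simp add: linear_neg)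
      moreover have "d I i h \<noteq> 0" using generic_nonzero[OF assms I i] .
      ultimately show "of_bool (\<not> Q i) - of_bool (d I i h > 0) =
          (- 1) * (of_bool (Q i) - of_bool (d I i (- h) > 0) :: int)" by auto
    qed
    also have "\<dots> = (- 1) ^ n * (\<Prod>i\<in>vs I. of_bool (Q i) - of_bool (d I i (- h) > 0))"
      by (subst prod.distrib) (simp add: card_vs[OF I])
    finally show ?thesis .
  qed
  then show ?thesis unfolding crossing_def sum_distrib_left
    by (intro sum.cong) (auto simp: mult_ac)
qed

lemma linear_comb: "linear (comb t)"
  unfolding comb_def
  by (intro linear_compose_sum ballI linear_compose_scale_right[where 'b = real, unfolded real_scaleR_def] linear_B)

lemma linear_Lat: "u \<in> Lat \<Longrightarrow> linear u"
  unfolding Lat_def using linear_comb by auto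

lemma comb_x: "b \<in> B \<Longrightarrow> comb t (x b) = t b"
  unfolding comb_def using finite_B by (simp add: B_x if_distrib cong: if_cong)

lemma comb_cong: "(\<And>b. b \<in> B \<Longrightarrow> t b = t' b) \<Longrightarrow> comb t = comb t'"
  unfolding comb_def by (auto intro!: sum.cong)

lemma Lat_x_int: "u \<in> Lat \<Longrightarrow> b \<in> B \<Longrightarrow> u (x b) \<in> \<int>"
  unfolding Lat_def by (auto simp: comb_x)

lemma Lat_eqI:
  assumes "u \<in> Lat" "u' \<in> Lat" "\<And>b. b \<in> B \<Longrightarrow> u (x b) = u' (x b)"
  shows "u = u'"
  using assms unfolding Lat_def by (auto simp: comb_x intro!: comb_cong)

lemma Lat_p_int:
  assumes "u \<in> Lat" "I \<in> T" "i \<in> vs I"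
  shows "u (p i) \<in> \<int>"
  using assms B_p_int unfolding Lat_def comb_def by (auto intro!: Ints_sum Ints_mult)

lemma comb_int_in_Lat: "comb (\<lambda>b. of_int (k b)) \<in> Lat"
  unfolding Lat_def by blast

lemma Lat_add:
  assumes "u \<in> Lat" "u' \<in> Lat"
  shows "(\<lambda>y. u y + of_int m * u' y) \<in> Lat"
proof -
  obtain k k' where u: "u = comb (\<lambda>b. of_int (k b))" and u': "u' = comb (\<lambda>b. of_int (k' b))"
    using assms unfolding Lat_def by auto
  have "(\<lambda>y. u y + of_int m * u' y) = comb (\<lambda>b. of_int (k b + m * k' b))"
    unfolding u u' comb_def by (simp add: fun_eq_iff sum_distrib_left sum.distrib algebra_simps)
  then show ?thesis by (simp only: comb_int_in_Lat)
qed

lemma Lat_uminus: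
  assumes "u \<in> Lat"
  shows "(\<lambda>y. - u y) \<in> Lat"
proof -
  obtain k where u: "u = comb (\<lambda>b. of_int (k b))" using assms unfolding Lat_def by auto
  have "(\<lambda>y. - u y) = comb (\<lambda>b. of_int (- k b))"
    unfolding u comb_def by (simp add: fun_eq_iff sum_negf)
  then show ?thesis by (simp only: comb_int_in_Lat)
qed

lemma zero_in_Lat: "(\<lambda>_. 0) \<in> Lat"
  unfolding Lat_def comb_def by (auto intro!: exI[of _ "\<lambda>_. 0"])

lemma vtx_in_Lat: "I \<in> T \<Longrightarrow> vtx I \<in> Lat"
  using vertex_integral[of I] unfolding Lat_def comb_def vtx_def[abs_def] by auto

lemma vtx_p: "I \<in> T \<Longrightarrow> i \<in> vs I \<Longrightarrow> vtx I (p i) = c i"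
  unfolding vtx_def using finite_vs[of I] by (simp add: d_p if_distrib cong: if_cong)

text \<open>Independence of the generic vector moves the computation from \<open>g\<close> to
  \<open>h\<close>. A nonzero summand then forces every \<open>u (p i) - \<nu> * c i\<close> to have
  the sign of \<open>d I i h\<close> or to vanish, and the sum of these products is
  \<open>u h - \<nu> * vtx I h\<close>.\<close>

lemma closed_support:
  assumes u: "linear u" and h: "h \<in> G" and nz: "closed_at \<nu> u \<noteq> 0"
  shows "\<exists>I\<in>T. \<nu> * vtx I h \<le> u h"
proof -
  have "crossing (\<lambda>i. u (p i) \<le> \<nu> * c i) h \<noteq> 0"
    using nz crossing_generic[OF g h] by (simp add: closed_at_def)
  then obtain I where I: "I \<in> T" and *: "\<And>i. i \<in> vs I \<Longrightarrow> (u (p i) \<le> \<nu> * c i) \<noteq> (d I i h > 0)"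
    by (rule crossing_nonzeroE) blast
  have "0 \<le> (\<Sum>i\<in>vs I. (u (p i) - \<nu> * c i) * d I i h)"
  proof (rule sum_nonneg)
    fix i assume "i \<in> vs I"
    from *[OF this] show "0 \<le> (u (p i) - \<nu> * c i) * d I i h"
      by (cases "d I i h > 0") (auto intro: mult_nonpos_nonpos)
  qed
  also have "\<dots> = u h - \<nu> * vtx I h"
    unfolding vtx_def dual_expand[OF I u, of h]
    by (simp add: sum_subtractf sum_distrib_left algebra_simps)
  finally show ?thesis using I by auto
qed

text \<open>For generic \<open>y\<close> the bound comes from \<open>closed_support\<close> at
  \<open>y\<close> and at \<open>- y\<close>; it extends to all \<open>y\<close> because the generic
  vectors span. The constant depends on \<open>y\<close> alone, so the bound collapses for \<nu> =
  0.\<close>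

lemma closed_bound:
  "\<exists>C\<ge>0. \<forall>\<nu> u. linear u \<longrightarrow> closed_at \<nu> u \<noteq> 0 \<longrightarrow> \<bar>u y\<bar> \<le> \<bar>\<nu>\<bar> * C"
proof -
  have "y \<in> span G" by (simp add: span_G)
  then show ?thesis
  proof (induction rule: span_induct_alt)
    case base
    show ?case by (intro exI[of _ 0]) (auto simp: linear_0)
  next
    case (step a h y)
    define C where "C = (\<Sum>I\<in>T. \<bar>vtx I h\<bar>)"
    have C: "\<bar>u h\<bar> \<le> \<bar>\<nu>\<bar> * C" if u: "linear u" and nz: "closed_at \<nu> u \<noteq> 0" for \<nu> u
    proof -
      have *: "- (\<bar>\<nu>\<bar> * C) \<le> \<nu> * vtx I h" "\<nu> * vtx I h \<le> \<bar>\<nu>\<bar> * C" if "I \<in> T" for I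
      proof -
        have "\<bar>\<nu> * vtx I h\<bar> \<le> \<bar>\<nu>\<bar> * C"
          unfolding C_def abs_mult using finite_T that by (intro mult_left_mono member_le_sum) auto
        then show "- (\<bar>\<nu>\<bar> * C) \<le> \<nu> * vtx I h" "\<nu> * vtx I h \<le> \<bar>\<nu>\<bar> * C" by linarith+
      qed
      obtain I where I: "I \<in> T" "\<nu> * vtx I h \<le> u h" using closed_support[OF u step(1) nz] by blast
      obtain J where J: "J \<in> T" "\<nu> * vtx J (- h) \<le> u (- h)"
        using closed_support[OF u uminus_G[OF step(1)] nz] by blast
      have "vtx J (- h) = - vtx J h" "u (- h) = - u h"
        using linear_Lat[OF vtx_in_Lat[OF J(1)]] u by (auto simp: linear_neg)
      with I J *[OF I(1)] *[OF J(1)] show ?thesis by (simp add: abs_le_iff)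
    qed
    from step obtain C' where C': "0 \<le> C'"
      "\<And>\<nu> u. linear u \<Longrightarrow> closed_at \<nu> u \<noteq> 0 \<Longrightarrow> \<bar>u y\<bar> \<le> \<bar>\<nu>\<bar> * C'" by blast
    have "\<bar>u (a *\<^sub>R h + y)\<bar> \<le> \<bar>\<nu>\<bar> * (\<bar>a\<bar> * C + C')" if u: "linear u" and nz: "closed_at \<nu> u \<noteq> 0" for \<nu> u
    proof -
      have "\<bar>u (a *\<^sub>R h + y)\<bar> \<le> \<bar>a\<bar> * \<bar>u h\<bar> + \<bar>u y\<bar>"
        using u by (simp add: linear_add linear_scale abs_mult[symmetric] abs_triangle_ineq)
      also have "\<dots> \<le> \<bar>a\<bar> * (\<bar>\<nu>\<bar> * C) + \<bar>\<nu>\<bar> * C'"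
        using C[OF u nz] C'(2)[OF u nz] by (intro add_mono mult_left_mono) auto
      finally show ?thesis by (simp add: algebra_simps)
    qed
    moreover have "0 \<le> \<bar>a\<bar> * C + C'" using C'(1) by (simp add: C_def sum_nonneg)
    ultimately show ?case by blast
  qed
qed

lemma finite_bounded_Lat:
  assumes "S \<subseteq> Lat" and bound: "\<And>b. b \<in> B \<Longrightarrow> \<exists>C. \<forall>u\<in>S. \<bar>u (x b)\<bar> \<le> C"
  shows "finite S"
proof -
  obtain C where C: "\<And>b u. b \<in> B \<Longrightarrow> u \<in> S \<Longrightarrow> \<bar>u (x b)\<bar> \<le> C b" using bound by metis
  let ?f = "\<lambda>u. \<lambda>b\<in>B. \<lfloor>u (x b)\<rfloor>"
  have "inj_on ?f S"
  proof (rule inj_onI)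
    fix u u' assume u: "u \<in> S" "u' \<in> S" and eq: "?f u = ?f u'"
    have "u (x b) = u' (x b)" if b: "b \<in> B" for b
    proof -
      have "\<lfloor>u (x b)\<rfloor> = \<lfloor>u' (x b)\<rfloor>" using fun_cong[OF eq, of b] b by simp
      moreover have "u (x b) \<in> \<int>" "u' (x b) \<in> \<int>" using u assms(1) Lat_x_int b by auto
      ultimately show ?thesis by (metis Ints_cases floor_of_int)
    qed
    then show "u = u'" using u assms(1) by (intro Lat_eqI) auto
  qed
  moreover have "?f ` S \<subseteq> (\<Pi>\<^sub>E b\<in>B. {\<lfloor>- C b\<rfloor>..\<lceil>C b\<rceil>})"
  proof (clarsimp)
    fix u b assume "u \<in> S" "b \<in> B"
    from C[OF this(2,1)] show "\<lfloor>- C b\<rfloor> \<le> \<lfloor>u (x b)\<rfloor> \<and> \<lfloor>u (x b)\<rfloor> \<le> \<lceil>C b\<rceil>"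
      by linarith
  qed
  moreover have "finite (\<Pi>\<^sub>E b\<in>B. {\<lfloor>- C b\<rfloor>..\<lceil>C b\<rceil>})" using finite_B by (intro finite_PiE) auto
  ultimately show ?thesis by (meson finite_imageD finite_subset)
qed

lemma finite_closed_support: "finite {u \<in> Lat. closed_at \<nu> u \<noteq> 0}"
proof (rule finite_bounded_Lat)
  fix b
  obtain C where "\<And>\<nu> u. linear u \<Longrightarrow> closed_at \<nu> u \<noteq> 0 \<Longrightarrow> \<bar>u (x b)\<bar> \<le> \<bar>\<nu>\<bar> * C"
    using closed_bound by blast
  then show "\<exists>C. \<forall>u\<in>{u \<in> Lat. closed_at \<nu> u \<noteq> 0}. \<bar>u (x b)\<bar> \<le> C"
    using linear_Lat by blast
qed auto

text \<open>At the zero functional every condition reads \<open>0 \<le> 0 * c i\<close>, whence the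
  constantly true predicate.\<close>

lemma closed_count_zero: "closed_count 0 = crossing (\<lambda>_. True) g"
proof -
  have "u = (\<lambda>_. 0)" if "u \<in> Lat" "closed_at 0 u \<noteq> 0" for u
  proof
    fix y
    obtain C where "\<And>\<nu> u. linear u \<Longrightarrow> closed_at \<nu> u \<noteq> 0 \<Longrightarrow> \<bar>u y\<bar> \<le> \<bar>\<nu>\<bar> * C"
      using closed_bound by blast
    from this[OF linear_Lat[OF that(1)] that(2)] show "u y = 0" by simp
  qed
  then have "{u. u \<in> Lat \<and> closed_at 0 u \<noteq> 0} \<subseteq> {\<lambda>_. 0}" by blast
  then have "closed_count 0 = (\<Sum>u\<in>{\<lambda>_. 0}. closed_at 0 u)"
    unfolding closed_count_def by (intro sum.mono_neutral_left) (auto simp: zero_in_Lat)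
  then show ?thesis by (simp add: closed_at_def)
qed

lemma open_count_reciprocity: "open_count \<nu> = (- 1) ^ n * closed_count (- \<nu>)"
proof -
  \<comment> \<open>The strict inequality for \<open>- u\<close> at \<nu> is the negation of the
    weak one for \<open>u\<close> at \<open>- \<nu>\<close>. The reversal of \<open>g\<close> caused
    by \<open>crossing_complement\<close> is undone by independence of the generic vector.\<close>
  have *: "open_at \<nu> (\<lambda>y. - u y) = (- 1) ^ n * closed_at (- \<nu>) u" for u
  proof -
    have "open_at \<nu> (\<lambda>y. - u y) = crossing (\<lambda>i. \<not> u (p i) \<le> - \<nu> * c i) g"
      unfolding open_at_def by (rule arg_cong[where f = "\<lambda>Q. crossing Q g"]) (auto simp: fun_eq_iff)
    also have "\<dots> = (- 1) ^ n * crossing (\<lambda>i. u (p i) \<le> - \<nu> * c i) (- g)"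
      by (rule crossing_complement[OF g])
    also have "crossing (\<lambda>i. u (p i) \<le> - \<nu> * c i) (- g) = closed_at (- \<nu>) u"
      unfolding closed_at_def by (rule crossing_generic[OF uminus_G[OF g] g])
    finally show ?thesis .
  qed
  have "open_count \<nu> = (\<Sum>u | u \<in> Lat \<and> closed_at (- \<nu>) u \<noteq> 0. (- 1) ^ n * closed_at (- \<nu>) u)"
    unfolding open_count_def
  proof (rule sum.reindex_bij_witness[of _ "\<lambda>u y. - u y" "\<lambda>u y. - u y"])
    fix u assume u: "u \<in> {u. u \<in> Lat \<and> open_at \<nu> u \<noteq> 0}"
    have "open_at \<nu> u = (- 1) ^ n * closed_at (- \<nu>) (\<lambda>y. - u y)" using *[of "\<lambda>y. - u y"] by simp
    with u show "(\<lambda>y. - u y) \<in> {u. u \<in> Lat \<and> closed_at (- \<nu>) u \<noteq> 0}"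
      "(- 1) ^ n * closed_at (- \<nu>) (\<lambda>y. - u y) = open_at \<nu> u"
      by (auto simp: Lat_uminus)
  next
    fix u assume "u \<in> {u. u \<in> Lat \<and> closed_at (- \<nu>) u \<noteq> 0}"
    then show "(\<lambda>y. - u y) \<in> {u. u \<in> Lat \<and> open_at \<nu> u \<noteq> 0}" by (auto simp: Lat_uminus *)
  qed auto
  then show ?thesis by (simp add: closed_count_def sum_distrib_left)
qed

end

lemma has_sum_finite_sum:
  fixes f :: "'i \<Rightarrow> 'b \<Rightarrow> 'c::topological_comm_monoid_add"
  assumes "finite T" "\<And>i. i \<in> T \<Longrightarrow> (f i has_sum s i) A"
  shows "((\<lambda>x. \<Sum>i\<in>T. f i x) has_sum (\<Sum>i\<in>T. s i)) A"
  using assms by (induction T rule: finite_induct) (simp_all add: has_sum_add)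

lemma floor_scale_tendsto: "(\<lambda>m. of_int \<lfloor>real (Suc m) * a\<rfloor> / real (Suc m)) \<longlonglongrightarrow> a"
proof (rule tendsto_sandwich)
  show "\<forall>\<^sub>F m in sequentially. a - inverse (real (Suc m)) \<le> of_int \<lfloor>real (Suc m) * a\<rfloor> / real (Suc m)"
  proof (rule always_eventually, rule allI)
    fix m
    have "real (Suc m) * a - 1 \<le> of_int \<lfloor>real (Suc m) * a\<rfloor>" by linarith
    then show "a - inverse (real (Suc m)) \<le> of_int \<lfloor>real (Suc m) * a\<rfloor> / real (Suc m)"
      by (simp add: pos_le_divide_eq left_diff_distrib right_diff_distrib mult.commute del: of_nat_Suc)
  qed
  show "\<forall>\<^sub>F m in sequentially. of_int \<lfloor>real (Suc m) * a\<rfloor> / real (Suc m) \<le> a"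
  proof (rule always_eventually, rule allI)
    fix m
    have "of_int \<lfloor>real (Suc m) * a\<rfloor> \<le> real (Suc m) * a" by linarith
    then show "of_int \<lfloor>real (Suc m) * a\<rfloor> / real (Suc m) \<le> a"
      by (simp add: field_simps del: of_nat_Suc)
  qed
  show "(\<lambda>m. a - inverse (real (Suc m))) \<longlonglongrightarrow> a"
    using tendsto_diff[OF tendsto_const LIMSEQ_inverse_real_of_nat, of a] by simp
qed simp

section \<open>Exponentially weighted sums over cones, and polynomiality\<close>

context dual_cones
begin

text \<open>The signed indicator of the cone of \<open>I\<close>, half-open and moved to the apex 0.
  Where it is nonzero, \<open>u (p i) > 0\<close> if \<open>d I i g > 0\<close> and
  \<open>u (p i) \<le> 0\<close> otherwise.\<close>

definition cone_sign :: "'s \<Rightarrow> ('a \<Rightarrow> real) \<Rightarrow> real" where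
  "cone_sign I u = (\<Prod>i\<in>vs I. of_bool (u (p i) \<le> 0) - of_bool (d I i g > 0))"

lemma closed_at_eq_cone_sign:
  "of_int (closed_at \<nu> u) = (\<Sum>I\<in>T. of_int (w I) * cone_sign I (\<lambda>y. u y - \<nu> * vtx I y))"
  unfolding closed_at_def crossing_def cone_sign_def of_int_sum of_int_mult of_int_prod of_int_diff
    of_int_of_bool
  by (intro sum.cong refl arg_cong2[where f = "(*)"] prod.cong) (simp add: vtx_p)

text \<open>On the support of \<open>cone_sign\<close> all products \<open>u (p i) * d I i g\<close>
  are nonnegative, so \<open>u g\<close> is the sum of their absolute values and the exponential
  splits into one factor per \<open>i\<close>. Integrality of \<open>u (p i)\<close> turns each
  factor into a natural power.\<close>

lemma cone_term_le:
  assumes I: "I \<in> T" and u: "u \<in> Lat"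
  shows "\<bar>cone_sign I u * exp (s * u g)\<bar> \<le> (\<Prod>i\<in>vs I. exp (s * \<bar>d I i g\<bar>) ^ nat \<bar>\<lfloor>u (p i)\<rfloor>\<bar>)"
proof (cases "cone_sign I u = 0")
  case True
  then show ?thesis by (simp add: prod_nonneg)
next
  case False
  have lin: "linear u" by (rule linear_Lat[OF u])
  have pos: "u (p i) * d I i g = \<bar>u (p i)\<bar> * \<bar>d I i g\<bar>" if i: "i \<in> vs I" for i
  proof -
    have "of_bool (u (p i) \<le> 0) - of_bool (d I i g > 0) \<noteq> (0::real)"
      using False i finite_vs[OF I] by (auto simp: cone_sign_def)
    then have "0 \<le> u (p i) * d I i g"
      by (cases "d I i g > 0"; cases "u (p i) \<le> 0") (auto intro: mult_nonpos_nonpos)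
    then show ?thesis by (simp add: abs_mult[symmetric])
  qed
  have "\<bar>cone_sign I u\<bar> \<le> 1"
    unfolding cone_sign_def abs_prod by (rule prod_le_1) auto
  then have "\<bar>cone_sign I u * exp (s * u g)\<bar> \<le> exp (s * u g)"
    by (simp add: abs_mult mult_left_le_one_le)
  also have "exp (s * u g) = exp (\<Sum>i\<in>vs I. s * (\<bar>u (p i)\<bar> * \<bar>d I i g\<bar>))"
    unfolding dual_expand[OF I lin, of g] sum_distrib_left by (simp add: pos)
  also have "\<dots> = (\<Prod>i\<in>vs I. exp (s * (\<bar>u (p i)\<bar> * \<bar>d I i g\<bar>)))"
    by (rule exp_sum[OF finite_vs[OF I]])
  also have "\<dots> = (\<Prod>i\<in>vs I. exp (s * \<bar>d I i g\<bar>) ^ nat \<bar>\<lfloor>u (p i)\<rfloor>\<bar>)"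
  proof (rule prod.cong[OF refl])
    fix i assume "i \<in> vs I"
    then obtain m where m: "u (p i) = of_int m" using Lat_p_int[OF u I] by (meson Ints_cases)
    have "exp (s * \<bar>d I i g\<bar>) ^ nat \<bar>m\<bar> = exp (real (nat \<bar>m\<bar>) * (s * \<bar>d I i g\<bar>))"
      by (rule exp_of_nat_mult[symmetric])
    then show "exp (s * (\<bar>u (p i)\<bar> * \<bar>d I i g\<bar>)) = exp (s * \<bar>d I i g\<bar>) ^ nat \<bar>\<lfloor>u (p i)\<rfloor>\<bar>"
      by (simp add: m mult_ac)
  qed
  finally show ?thesis .
qed

text \<open>The floors are the values themselves, which are integers and determine \<open>u\<close>
  through the dual basis. The image may be a proper subset of the integer tuples, since the
  \<open>p i\<close> need not be a lattice basis.\<close>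

lemma inj_on_floor_p:
  assumes I: "I \<in> T"
  shows "inj_on (\<lambda>u. \<lambda>i\<in>vs I. \<lfloor>u (p i)\<rfloor>) Lat"
proof (rule inj_onI)
  fix u u' assume u: "u \<in> Lat" "u' \<in> Lat"
    and eq: "(\<lambda>i\<in>vs I. \<lfloor>u (p i)\<rfloor>) = (\<lambda>i\<in>vs I. \<lfloor>u' (p i)\<rfloor>)"
  have "u (p i) = u' (p i)" if i: "i \<in> vs I" for i
  proof -
    have "\<lfloor>u (p i)\<rfloor> = \<lfloor>u' (p i)\<rfloor>" using fun_cong[OF eq, of i] i by simp
    moreover have "u (p i) \<in> \<int>" "u' (p i) \<in> \<int>" using u Lat_p_int I i by auto
    ultimately show ?thesis by (metis Ints_cases floor_of_int)
  qed
  then show "u = u'"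
    by (intro ext, subst (1 2) dual_expand[OF I]) (auto simp: linear_Lat u intro!: sum.cong)
qed

text \<open>Each of the \<open>n\<close> factors has a simple pole at \<open>s = 0\<close>, as
  \<open>d I i g\<close> is nonzero. The total order \<open>n\<close> is what \<open>n + 1\<close>
  differences have to beat.\<close>

definition cone_bound :: "'s \<Rightarrow> real \<Rightarrow> real" where
  "cone_bound I s = (\<Prod>i\<in>vs I. 2 / (1 - exp (s * \<bar>d I i g\<bar>)))"

text \<open>Injectivity lets the sum be enlarged to a full box of integer tuples, over which the
  product form factorizes. The bound is the same for all finite \<open>A\<close>, which yields
  absolute summability.\<close>

lemma cone_sum_le:
  assumes I: "I \<in> T" and A: "finite A" "A \<subseteq> Lat" and s: "s < 0"
  shows "(\<Sum>u\<in>A. \<bar>cone_sign I u * exp (s * u g)\<bar>) \<le> cone_bound I s"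
proof -
  let ?f = "\<lambda>u. \<lambda>i\<in>vs I. \<lfloor>u (p i)\<rfloor>"
  let ?t = "\<lambda>k. \<Prod>i\<in>vs I. exp (s * \<bar>d I i g\<bar>) ^ nat \<bar>k i\<bar>"
  \<comment> \<open>A crude size for the box that holds all coordinates of points of
    \<open>A\<close>; it disappears with the geometric bound.\<close>
  define M where "M = (\<Sum>u\<in>A. \<Sum>i\<in>vs I. nat \<bar>\<lfloor>u (p i)\<rfloor>\<bar>)"
  have M: "\<lfloor>u (p i)\<rfloor> \<in> {- int M..int M}" if "u \<in> A" "i \<in> vs I" for u i
  proof -
    have "nat \<bar>\<lfloor>u (p i)\<rfloor>\<bar> \<le> (\<Sum>i\<in>vs I. nat \<bar>\<lfloor>u (p i)\<rfloor>\<bar>)"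
      using that finite_vs[OF I] by (intro member_le_sum) auto
    also have "\<dots> \<le> M" unfolding M_def using that A
      by (intro member_le_sum[of u A "\<lambda>u. \<Sum>i\<in>vs I. nat \<bar>\<lfloor>u (p i)\<rfloor>\<bar>"]) auto
    finally show ?thesis by auto
  qed
  have "(\<Sum>u\<in>A. \<bar>cone_sign I u * exp (s * u g)\<bar>) \<le> (\<Sum>u\<in>A. ?t (?f u))"
  proof (rule sum_mono)
    fix u assume "u \<in> A"
    then show "\<bar>cone_sign I u * exp (s * u g)\<bar> \<le> ?t (?f u)"
      using cone_term_le[OF I, of u s] A(2) by (auto cong: prod.cong)
  qed
  also have "\<dots> = (\<Sum>k\<in>?f ` A. ?t k)"
    by (subst sum.reindex) (auto intro: inj_on_subset[OF inj_on_floor_p[OF I] A(2)])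
  also have "\<dots> \<le> (\<Sum>k\<in>(\<Pi>\<^sub>E i\<in>vs I. {- int M..int M}). ?t k)"
  proof (rule sum_mono2)
    show "finite (\<Pi>\<^sub>E i\<in>vs I. {- int M..int M})" using finite_vs[OF I] by (intro finite_PiE) auto
    show "?f ` A \<subseteq> (\<Pi>\<^sub>E i\<in>vs I. {- int M..int M})" using M by fastforce
  qed (simp add: prod_nonneg)
  also have "\<dots> = (\<Prod>i\<in>vs I. \<Sum>m\<in>{- int M..int M}. exp (s * \<bar>d I i g\<bar>) ^ nat \<bar>m\<bar>)"
    by (rule prod_sum_PiE[symmetric]) (use finite_vs[OF I] in auto)
  also have "\<dots> \<le> cone_bound I s"
    unfolding cone_bound_def
  proof (rule prod_mono, intro conjI)
    fix i assume i: "i \<in> vs I"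
    show "0 \<le> (\<Sum>m\<in>{- int M..int M}. exp (s * \<bar>d I i g\<bar>) ^ nat \<bar>m\<bar>)" by (intro sum_nonneg) simp
    have "s * \<bar>d I i g\<bar> < 0" using s generic_nonzero[OF g I i] by (simp add: mult_less_0_iff)
    then show "(\<Sum>m\<in>{- int M..int M}. exp (s * \<bar>d I i g\<bar>) ^ nat \<bar>m\<bar>) \<le> 2 / (1 - exp (s * \<bar>d I i g\<bar>))"
      by (intro sum_two_sided_geometric_le) auto
  qed
  finally show ?thesis .
qed

definition cone_series :: "'s \<Rightarrow> real \<Rightarrow> real" where
  "cone_series I s = infsum (\<lambda>u. cone_sign I u * exp (s * u g)) Lat"

lemma cone_series:
  assumes I: "I \<in> T" and s: "s < 0"
  shows "((\<lambda>u. cone_sign I u * exp (s * u g)) has_sum cone_series I s) Lat"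
    and "\<bar>cone_series I s\<bar> \<le> cone_bound I s"
proof -
  let ?f = "\<lambda>u. cone_sign I u * exp (s * u g)"
  have abs: "(\<lambda>u. norm (?f u)) summable_on Lat"
  proof (rule nonneg_bdd_above_summable_on)
    show "bdd_above (sum (\<lambda>u. norm (?f u)) ` {F. F \<subseteq> Lat \<and> finite F})"
      using cone_sum_le[OF I _ _ s] by (intro bdd_aboveI[of _ "cone_bound I s"]) auto
  qed simp
  then show "(?f has_sum cone_series I s) Lat"
    unfolding cone_series_def by (rule has_sum_infsum[OF abs_summable_summable])
  have "\<bar>cone_series I s\<bar> \<le> infsum (\<lambda>u. norm (?f u)) Lat"
    using norm_infsum_bound[OF abs] by (simp add: cone_series_def)
  also have "\<dots> \<le> cone_bound I s"
    by (rule infsum_le_finite_sums[OF abs]) (use cone_sum_le[OF I _ _ s] in auto)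
  finally show "\<bar>cone_series I s\<bar> \<le> cone_bound I s" .
qed

definition char_sum :: "real \<Rightarrow> int \<Rightarrow> real" where
  "char_sum s \<nu> = (\<Sum>u | u \<in> Lat \<and> closed_at (of_int \<nu>) u \<noteq> 0. of_int (closed_at (of_int \<nu>) u) * exp (s * u g))"

text \<open>Both sides are sums of the same function over the whole lattice: on the left its support
  is finite, on the right it is split cone by cone, where only the decay for \<open>s < 0\<close>
  gives convergence. Reindexing by the lattice translation \<open>of_int \<nu> * vtx I\<close>
  produces the exponential factor.\<close>

lemma char_sum_eq:
  assumes s: "s < 0"
  shows "char_sum s \<nu> = (\<Sum>I\<in>T. of_int (w I) * cone_series I s * exp (of_int \<nu> * (s * vtx I g)))"
proof (rule has_sum_unique)
  let ?f = "\<lambda>u. of_int (closed_at (of_int \<nu>) u) * exp (s * u g)"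
  show "(?f has_sum char_sum s \<nu>) Lat"
    unfolding char_sum_def by (rule has_sum_finite_neutralI[OF finite_closed_support]) auto
  have "((\<lambda>u. cone_sign I (\<lambda>y. u y - of_int \<nu> * vtx I y) * exp (s * u g))
      has_sum cone_series I s * exp (of_int \<nu> * (s * vtx I g))) Lat" if I: "I \<in> T" for I
  proof -
    have bij: "bij_betw (\<lambda>u y. u y - of_int \<nu> * vtx I y) Lat Lat"
    proof (rule bij_betw_byWitness[where f' = "\<lambda>u y. u y + of_int \<nu> * vtx I y"])
      show "(\<lambda>u y. u y - of_int \<nu> * vtx I y) ` Lat \<subseteq> Lat"
        using Lat_add[OF _ vtx_in_Lat[OF I], of _ "- \<nu>"] by auto
      show "(\<lambda>u y. u y + of_int \<nu> * vtx I y) ` Lat \<subseteq> Lat"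
        using Lat_add[OF _ vtx_in_Lat[OF I], of _ "\<nu>"] by auto
    qed auto
    have "((\<lambda>u. cone_sign I u * exp (s * u g) * exp (of_int \<nu> * (s * vtx I g)))
        has_sum cone_series I s * exp (of_int \<nu> * (s * vtx I g))) Lat"
      by (rule has_sum_cmult_left[OF cone_series(1)[OF I s]])
    then have "((\<lambda>u. cone_sign I (\<lambda>y. u y - of_int \<nu> * vtx I y) * exp (s * (u g - of_int \<nu> * vtx I g))
          * exp (of_int \<nu> * (s * vtx I g)))
        has_sum cone_series I s * exp (of_int \<nu> * (s * vtx I g))) Lat"
      by (subst (asm) has_sum_reindex_bij_betw[OF bij, symmetric])
    moreover have "exp (s * (a - of_int \<nu> * b)) * exp (of_int \<nu> * (s * b)) = exp (s * a)" for a b :: real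
      by (simp add: exp_add[symmetric] algebra_simps)
    ultimately show ?thesis by (simp only: mult.assoc)
  qed
  then have "((\<lambda>u. \<Sum>I\<in>T. of_int (w I) * (cone_sign I (\<lambda>y. u y - of_int \<nu> * vtx I y) * exp (s * u g)))
      has_sum (\<Sum>I\<in>T. of_int (w I) * (cone_series I s * exp (of_int \<nu> * (s * vtx I g))))) Lat"
    by (intro has_sum_finite_sum finite_T has_sum_cmult_right)
  then show "(?f has_sum (\<Sum>I\<in>T. of_int (w I) * cone_series I s * exp (of_int \<nu> * (s * vtx I g)))) Lat"
    by (simp add: closed_at_eq_cone_sign sum_distrib_right mult.assoc)
qed

text \<open>Of the \<open>n + 1\<close> small factors, \<open>n\<close> are paired with the poles of
  \<open>cone_bound\<close> and leave finite limits; the remaining one tends to 0.\<close>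

lemma cone_bound_limit:
  assumes I: "I \<in> T"
  shows "((\<lambda>s. \<bar>exp (s * a) - 1\<bar> ^ Suc n * cone_bound I s) \<longlongrightarrow> 0) (at_left 0)"
proof -
  have quot: "((\<lambda>s. (exp (s * b) - 1) / s) \<longlongrightarrow> b) (at_left (0::real))" for b :: real
  proof -
    have "((\<lambda>s. exp (s * b)) has_real_derivative b) (at 0 within {..<0})"
      by (auto intro!: derivative_eq_intros)
    then show ?thesis by (simp add: has_field_derivative_iff)
  qed
  have "((\<lambda>s. \<bar>exp (s * a) - 1\<bar> * (2 / (1 - exp (s * \<bar>d I i g\<bar>)))) \<longlongrightarrow> \<bar>a\<bar> * (2 / \<bar>d I i g\<bar>)) (at_left 0)"
    if i: "i \<in> vs I" for i
  proof -
    \<comment> \<open>Numerator and denominator are both divided by \<open>s\<close>, so that each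
      becomes a difference quotient of an exponential at 0. The signs match because
      \<open>\<bar>s\<bar> = - s\<close> on the left of 0.\<close>
    have "((\<lambda>s. \<bar>(exp (s * a) - 1) / s\<bar> * (2 / ((exp (s * \<bar>d I i g\<bar>) - 1) / s)))
        \<longlongrightarrow> \<bar>a\<bar> * (2 / \<bar>d I i g\<bar>)) (at_left 0)"
      by (intro tendsto_intros quot) (use generic_nonzero[OF g I i] in auto)
    moreover have "\<forall>\<^sub>F s in at_left 0. \<bar>(exp (s * a) - 1) / s\<bar> * (2 / ((exp (s * \<bar>d I i g\<bar>) - 1) / s))
        = \<bar>exp (s * a) - 1\<bar> * (2 / (1 - exp (s * \<bar>d I i g\<bar>)))"
    proof (rule eventually_at_leftI[of "-1"])
      fix s :: real assume s: "s \<in> {-1<..<0}"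
      have Y: "exp (s * \<bar>d I i g\<bar>) - 1 \<noteq> 0" using s generic_nonzero[OF g I i] by auto
      have "X / - s * (2 / (Y / s)) = X * (2 / - Y)" if "Y \<noteq> 0" for X Y :: real
        using that s by simp
      from this[OF Y, of "\<bar>exp (s * a) - 1\<bar>"] s
      show "\<bar>(exp (s * a) - 1) / s\<bar> * (2 / ((exp (s * \<bar>d I i g\<bar>) - 1) / s))
          = \<bar>exp (s * a) - 1\<bar> * (2 / (1 - exp (s * \<bar>d I i g\<bar>)))"
        by (simp only: abs_divide greaterThanLessThan_iff abs_of_neg minus_diff_eq)
    qed simp
    ultimately show ?thesis by (rule Lim_transform_eventually)
  qed
  then have "((\<lambda>s. \<Prod>i\<in>vs I. \<bar>exp (s * a) - 1\<bar> * (2 / (1 - exp (s * \<bar>d I i g\<bar>))))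
      \<longlongrightarrow> (\<Prod>i\<in>vs I. \<bar>a\<bar> * (2 / \<bar>d I i g\<bar>))) (at_left 0)"
    by (rule tendsto_prod)
  moreover have "((\<lambda>s. \<bar>exp (s * a) - 1\<bar>) \<longlongrightarrow> \<bar>exp (0 * a) - 1\<bar>) (at_left 0)"
    by (intro tendsto_intros)
  ultimately have "((\<lambda>s. \<bar>exp (s * a) - 1\<bar> * (\<Prod>i\<in>vs I. \<bar>exp (s * a) - 1\<bar> * (2 / (1 - exp (s * \<bar>d I i g\<bar>)))))
      \<longlongrightarrow> \<bar>exp (0 * a) - 1\<bar> * (\<Prod>i\<in>vs I. \<bar>a\<bar> * (2 / \<bar>d I i g\<bar>))) (at_left 0)"
    by (rule tendsto_mult[rotated])
  moreover have "\<bar>exp (s * a) - 1\<bar> * (\<Prod>i\<in>vs I. \<bar>exp (s * a) - 1\<bar> * (2 / (1 - exp (s * \<bar>d I i g\<bar>))))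
      = \<bar>exp (s * a) - 1\<bar> ^ Suc n * cone_bound I s" for s
    by (simp only: cone_bound_def prod.distrib prod_constant card_vs[OF I] power_Suc mult.assoc)
  ultimately show ?thesis by (simp only: mult_zero_left exp_zero diff_self abs_zero)
qed

text \<open>A difference at a fixed argument involves finitely many values of
  \<open>char_sum s\<close>, each a finite sum continuous in \<open>s\<close>, so the limit may be
  taken before or after differencing. Differencing first gives the limit 0 by
  \<open>cone_bound_limit\<close>.\<close>

lemma fwd_diff_closed_count: "(fwd_diff ^^ Suc n) (\<lambda>\<nu>. of_int (closed_count (of_int \<nu>))) = (\<lambda>_. 0)"
proof
  fix \<nu>
  have "((\<lambda>s. (fwd_diff ^^ Suc n) (char_sum s) \<nu>) \<longlongrightarrow>
      (fwd_diff ^^ Suc n) (\<lambda>\<nu>. of_int (closed_count (of_int \<nu>))) \<nu>) (at_left 0)"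
  proof (rule tendsto_fwd_diff)
    fix \<nu> :: int
    have "((\<lambda>s. char_sum s \<nu>) \<longlongrightarrow> (\<Sum>u | u \<in> Lat \<and> closed_at (of_int \<nu>) u \<noteq> 0.
        of_int (closed_at (of_int \<nu>) u) * exp (0 * u g))) (at_left 0)"
      unfolding char_sum_def by (intro tendsto_intros)
    then show "((\<lambda>s. char_sum s \<nu>) \<longlongrightarrow> of_int (closed_count (of_int \<nu>))) (at_left 0)"
      by (simp add: closed_count_def)
  qed
  moreover have "((\<lambda>s. (fwd_diff ^^ Suc n) (char_sum s) \<nu>) \<longlongrightarrow> 0) (at_left 0)"
  proof (rule Lim_null_comparison)
    let ?b = "\<lambda>s. \<Sum>I\<in>T. \<bar>of_int (w I)\<bar> * exp (of_int \<nu> * (s * vtx I g)) *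
      (\<bar>exp (s * vtx I g) - 1\<bar> ^ Suc n * cone_bound I s)"
    have le: "norm ((fwd_diff ^^ Suc n) (char_sum s) \<nu>) \<le> ?b s" if s: "s < 0" for s
    proof -
      have eq: "(fwd_diff ^^ Suc n) (char_sum s) \<nu> = (\<Sum>I\<in>T. of_int (w I) * cone_series I s *
          (exp (s * vtx I g) - 1) ^ Suc n * exp (of_int \<nu> * (s * vtx I g)))"
        unfolding char_sum_eq[OF s, abs_def] fwd_diff_sum fwd_diff_exp ..
      show ?thesis unfolding eq
      proof (rule sum_norm_le)
        fix I assume I: "I \<in> T"
        have "norm (of_int (w I) * cone_series I s * (exp (s * vtx I g) - 1) ^ Suc n *
            exp (of_int \<nu> * (s * vtx I g)))
          = \<bar>of_int (w I)\<bar> * exp (of_int \<nu> * (s * vtx I g)) *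
            (\<bar>exp (s * vtx I g) - 1\<bar> ^ Suc n * \<bar>cone_series I s\<bar>)"
          by (simp only: real_norm_def abs_mult power_abs abs_exp_cancel mult_ac)
        also have "\<dots> \<le> \<bar>of_int (w I)\<bar> * exp (of_int \<nu> * (s * vtx I g)) *
            (\<bar>exp (s * vtx I g) - 1\<bar> ^ Suc n * cone_bound I s)"
          using cone_series(2)[OF I s] by (intro mult_left_mono) auto
        finally show "norm (of_int (w I) * cone_series I s * (exp (s * vtx I g) - 1) ^ Suc n *
            exp (of_int \<nu> * (s * vtx I g))) \<le> \<dots>" .
      qed
    qed
    show "\<forall>\<^sub>F s in at_left 0. norm ((fwd_diff ^^ Suc n) (char_sum s) \<nu>) \<le> ?b s"
    proof (rule eventually_at_leftI)
      show "norm ((fwd_diff ^^ Suc n) (char_sum s) \<nu>) \<le> ?b s" if "s \<in> {- 1<..<0}" for s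
        using that by (intro le) simp
    qed simp
    have "(?b \<longlongrightarrow> (\<Sum>I\<in>T. \<bar>of_int (w I)\<bar> * exp (of_int \<nu> * (0 * vtx I g)) * 0)) (at_left 0)"
      by (intro tendsto_sum tendsto_mult[OF _ cone_bound_limit] tendsto_intros)
    then show "(?b \<longlongrightarrow> 0) (at_left 0)" by simp
  qed
  ultimately show "(fwd_diff ^^ Suc n) (\<lambda>\<nu>. of_int (closed_count (of_int \<nu>))) \<nu> = 0"
    by (rule tendsto_unique[rotated]) simp
qed

lemma closed_count_polynomial:
  obtains q :: "real poly" where "degree q \<le> n"
    "\<And>\<nu>. of_int (closed_count (of_int \<nu>)) = poly q (of_int \<nu>)"
  using polynomial_if_fwd_diff_zero[OF fwd_diff_closed_count] by blast

section \<open>The volume as a limit of rescaled counts\<close>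

lemma closed_at_scale:
  assumes "0 < m"
  shows "closed_at m (comb t) = closed_at 1 (comb (\<lambda>b. t b / m))"
proof -
  have "comb (\<lambda>b. t b / m) y = comb t y / m" for y
    by (simp add: comb_def sum_divide_distrib)
  with assms show ?thesis by (simp add: closed_at_def divide_le_eq mult.commute)
qed

lemma comb_measurable [measurable]: "(\<lambda>t. comb t y) \<in> borel_measurable (\<Pi>\<^sub>M b\<in>B. lborel)"
  unfolding comb_def by (intro borel_measurable_sum borel_measurable_times borel_measurable_const) simp

lemma bij_betw_comb: "bij_betw (\<lambda>k. comb (\<lambda>b. of_int (k b))) (B \<rightarrow>\<^sub>E (UNIV :: int set)) Lat"
proof (rule bij_betwI')
  fix k k' :: "('a \<Rightarrow> real) \<Rightarrow> int" assume k: "k \<in> B \<rightarrow>\<^sub>E UNIV" "k' \<in> B \<rightarrow>\<^sub>E UNIV"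
  show "comb (\<lambda>b. of_int (k b)) = comb (\<lambda>b. of_int (k' b)) \<longleftrightarrow> k = k'"
  proof
    assume eq: "comb (\<lambda>b. of_int (k b)) = comb (\<lambda>b. of_int (k' b))"
    have "k b = k' b" if "b \<in> B" for b
      using fun_cong[OF eq, of "x b"] that by (simp add: comb_x)
    with k show "k = k'" by (intro PiE_ext) auto
  qed simp
next
  fix u assume "u \<in> Lat"
  then obtain k where "u = comb (\<lambda>b. of_int (k b))" by (auto simp: Lat_def)
  then have "u = comb (\<lambda>b. of_int ((\<lambda>b\<in>B. k b) b))" by (auto intro: comb_cong)
  then show "\<exists>k\<in>B \<rightarrow>\<^sub>E (UNIV :: int set). u = comb (\<lambda>b. of_int (k b))"
    by (intro bexI[of _ "\<lambda>b\<in>B. k b"]) auto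
qed (rule comb_int_in_Lat)

lemma AE_off_hyperplanes:
  "AE t in \<Pi>\<^sub>M b\<in>B. lborel. \<forall>I\<in>T. \<forall>i\<in>vs I. comb t (p i) \<noteq> c i"
proof -
  have "AE t in \<Pi>\<^sub>M b\<in>B. lborel. comb t (p i) \<noteq> c i" if I: "I \<in> T" "i \<in> vs I" for I i
  proof -
    obtain b where "b \<in> B" "b (p i) \<noteq> 0" using B_p_nonzero[OF I] by blast
    then show ?thesis unfolding comb_def by (rule AE_PiM_hyperplane[OF finite_B])
  qed
  then show ?thesis
    by (intro AE_finite_allI finite_T finite_vs)
qed

text \<open>Off the hyperplanes all comparisons at \<open>t\<close> are strict and hence persist
  nearby; the sequence is eventually constant.\<close>

lemma closed_at_tendsto:
  assumes off: "\<forall>I\<in>T. \<forall>i\<in>vs I. comb t (p i) \<noteq> c i"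
    and lim: "\<And>b. b \<in> B \<Longrightarrow> (\<lambda>m. r m b) \<longlonglongrightarrow> t b"
  shows "(\<lambda>m. real_of_int (closed_at 1 (comb (r m)))) \<longlonglongrightarrow> real_of_int (closed_at 1 (comb t))"
proof -
  have "\<forall>\<^sub>F m in sequentially. comb (r m) (p i) \<le> c i \<longleftrightarrow> comb t (p i) \<le> c i"
    if I: "I \<in> T" "i \<in> vs I" for I i
  proof -
    have lim': "(\<lambda>m. comb (r m) (p i)) \<longlonglongrightarrow> comb t (p i)"
      unfolding comb_def by (intro tendsto_intros lim)
    consider "comb t (p i) < c i" | "comb t (p i) > c i" using off I by fastforce
    then show ?thesis
    proof cases
      case 1
      from order_tendstoD(2)[OF lim' 1] show ?thesis by eventually_elim (use 1 in auto)
    next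
      case 2
      from order_tendstoD(1)[OF lim' 2] show ?thesis by eventually_elim (use 2 in auto)
    qed
  qed
  then have "\<forall>\<^sub>F m in sequentially. \<forall>I\<in>T. \<forall>i\<in>vs I. comb (r m) (p i) \<le> c i \<longleftrightarrow> comb t (p i) \<le> c i"
    by (intro eventually_ball_finite finite_T ballI finite_vs)
  then have "\<forall>\<^sub>F m in sequentially. real_of_int (closed_at 1 (comb t)) = real_of_int (closed_at 1 (comb (r m)))"
  proof eventually_elim
    case (elim m)
    then show ?case unfolding closed_at_def crossing_def
      by (intro arg_cong[where f = real_of_int] sum.cong refl arg_cong2[where f = "(*)"] prod.cong) simp
  qed
  then show ?thesis by (rule Lim_transform_eventually[OF tendsto_const])
qed

lemma closed_count_tendsto_integral:
  "(\<lambda>m. of_int (closed_count (real (Suc m))) / real (Suc m) ^ n) \<longlonglongrightarrow>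
    (\<integral>t. of_int (closed_at 1 (comb t)) \<partial>(\<Pi>\<^sub>M b\<in>B. lborel))"
proof -
  let ?h = "\<lambda>t. real_of_int (closed_at 1 (comb t))"
  let ?r = "\<lambda>m k. \<lambda>b\<in>B. of_int (k b) / real (Suc m)"
  have "\<forall>b. \<exists>C. \<forall>u. linear u \<longrightarrow> closed_at 1 u \<noteq> 0 \<longrightarrow> \<bar>u (x b)\<bar> \<le> C"
  proof
    fix b
    obtain C where "\<And>\<nu> u. linear u \<Longrightarrow> closed_at \<nu> u \<noteq> 0 \<Longrightarrow> \<bar>u (x b)\<bar> \<le> \<bar>\<nu>\<bar> * C"
      using closed_bound by blast
    from this[of _ 1] show "\<exists>C. \<forall>u. linear u \<longrightarrow> closed_at 1 u \<noteq> 0 \<longrightarrow> \<bar>u (x b)\<bar> \<le> C" by auto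
  qed
  then obtain C where C: "\<And>b u. linear u \<Longrightarrow> closed_at 1 u \<noteq> 0 \<Longrightarrow> \<bar>u (x b)\<bar> \<le> C b"
    by (elim choice[THEN exE]) blast
  have lim: "(\<lambda>m. (\<Sum>k | k \<in> B \<rightarrow>\<^sub>E (UNIV :: int set) \<and> ?h (?r m k) \<noteq> 0. ?h (?r m k)) / real (Suc m) ^ card B)
    \<longlonglongrightarrow> (\<integral>t. ?h t \<partial>(\<Pi>\<^sub>M b\<in>B. lborel))"
  proof (rule riemann_sum_tendsto_integral_PiM[OF finite_B])
    show "\<bar>?h t\<bar> \<le> real_of_int (\<Sum>I\<in>T. \<bar>w I\<bar>)" for t
      using crossing_abs_le[of _ g] unfolding closed_at_def by (simp only: of_int_abs[symmetric] of_int_le_iff)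
    show "\<bar>t b\<bar> \<le> (\<Sum>b\<in>B. \<bar>C b\<bar>)" if "?h t \<noteq> 0" "b \<in> B" for t b
    proof -
      have "\<bar>comb t (x b)\<bar> \<le> C b" using that by (intro C linear_comb) auto
      also have "C b \<le> \<bar>C b\<bar>" by simp
      also have "\<bar>C b\<bar> \<le> (\<Sum>b\<in>B. \<bar>C b\<bar>)" using finite_B that by (intro member_le_sum) auto
      finally show ?thesis using that by (simp add: comb_x)
    qed
    show "?h \<in> borel_measurable (\<Pi>\<^sub>M b\<in>B. lborel)"
      unfolding closed_at_def crossing_def of_int_sum of_int_mult of_int_prod of_int_diff
        of_int_of_bool unfolding of_bool_def by measurable
    show "AE t in \<Pi>\<^sub>M b\<in>B. lborel. (\<lambda>m. ?h (?r m (\<lambda>b. \<lfloor>real (Suc m) * t b\<rfloor>))) \<longlonglongrightarrow> ?h t"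
      using AE_off_hyperplanes
    proof eventually_elim
      case (elim t)
      then show ?case by (rule closed_at_tendsto) (use floor_scale_tendsto in simp)
    qed
  qed
  have "(\<Sum>k | k \<in> B \<rightarrow>\<^sub>E (UNIV :: int set) \<and> ?h (?r m k) \<noteq> 0. ?h (?r m k)) =
      of_int (closed_count (real (Suc m)))" for m
  proof -
    have eq: "closed_at 1 (comb (?r m k)) = closed_at (real (Suc m)) (comb (\<lambda>b. of_int (k b)))" for k
    proof -
      have "comb (?r m k) = comb (\<lambda>b. of_int (k b) / real (Suc m))" by (rule comb_cong) simp
      then show ?thesis by (simp only: closed_at_scale[of "real (Suc m)"] of_nat_0_less_iff zero_less_Suc)
    qed
    have "(\<Sum>k | k \<in> B \<rightarrow>\<^sub>E (UNIV :: int set) \<and> closed_at (real (Suc m)) (comb (\<lambda>b. of_int (k b))) \<noteq> 0.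
        closed_at (real (Suc m)) (comb (\<lambda>b. of_int (k b)))) = closed_count (real (Suc m))"
      unfolding closed_count_def
    proof (rule sum.reindex_bij_betw[of "\<lambda>k. comb (\<lambda>b. of_int (k b))"])
      show "bij_betw (\<lambda>k. comb (\<lambda>b. of_int (k b)))
          {k \<in> B \<rightarrow>\<^sub>E UNIV. closed_at (real (Suc m)) (comb (\<lambda>b. real_of_int (k b))) \<noteq> 0}
          {u \<in> Lat. closed_at (real (Suc m)) u \<noteq> 0}"
        using bij_betw_comb by (auto simp: bij_betw_def inj_on_def image_iff) 
    qed
    from arg_cong[OF this, of real_of_int] show ?thesis unfolding eq by (simp only: of_int_sum of_int_eq_0_iff)
  qed
  with lim show ?thesis by (simp only: card_B)
qed

end

section \<open>Simplicial cones and lattices\<close>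

definition dual_family :: "'i set \<Rightarrow> ('i \<Rightarrow> 'a::real_vector) \<Rightarrow> ('i \<Rightarrow> 'a \<Rightarrow> real) \<Rightarrow> bool" where
  "dual_family V p d \<longleftrightarrow> finite V \<and> (\<forall>i\<in>V. linear (d i)) \<and>
     (\<forall>i\<in>V. \<forall>j\<in>V. d i (p j) = (if i = j then 1 else 0))"

lemma linear_functional_extend:
  fixes f :: "'a::real_vector \<Rightarrow> real"
  assumes "independent A"
  obtains u where "linear u" "\<And>a. a \<in> A \<Longrightarrow> u a = f a"
  using linear_independent_extend[OF assms, of f] by blast

lemma dual_family_exists:
  assumes "finite V" "inj_on p V" "independent (p ` V)"
  obtains d where "dual_family V p d"
proof -
  have "\<exists>u. linear u \<and> (\<forall>j\<in>V. u (p j) = (if i = j then 1 else 0 :: real))" for i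
  proof -
    obtain u where "linear u" "\<And>a. a \<in> p ` V \<Longrightarrow> u a = (if the_inv_into V p a = i then 1 else 0 :: real)"
      by (rule linear_functional_extend[OF assms(3), of "\<lambda>a. if the_inv_into V p a = i then 1 else 0"]) blast
    then show ?thesis using assms(2) by (intro exI[of _ u]) (auto simp: the_inv_into_f_f)
  qed
  then obtain d where "\<And>i. linear (d i) \<and> (\<forall>j\<in>V. d i (p j) = (if i = j then 1 else 0 :: real))"
    by metis
  then show ?thesis using assms(1) by (intro that[of d]) (simp add: dual_family_def)
qed

lemma dual_family_linear: "dual_family V p d \<Longrightarrow> i \<in> V \<Longrightarrow> linear (d i)"
  by (simp add: dual_family_def)

lemma dual_family_apply: "dual_family V p d \<Longrightarrow> i \<in> V \<Longrightarrow> j \<in> V \<Longrightarrow> d i (p j) = (if i = j then 1 else 0)"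
  by (simp add: dual_family_def)

lemma dual_family_subset: "dual_family V p d \<Longrightarrow> W \<subseteq> V \<Longrightarrow> dual_family W p d"
  unfolding dual_family_def by (meson finite_subset subsetD)

lemma dual_family_comb:
  assumes "dual_family V p d" "W \<subseteq> V" "i \<in> V"
  shows "d i (\<Sum>j\<in>W. a j *\<^sub>R p j) = (if i \<in> W then a i else 0)"
proof -
  have "finite W" using assms by (auto simp: dual_family_def intro: finite_subset)
  have "d i (\<Sum>j\<in>W. a j *\<^sub>R p j) = (\<Sum>j\<in>W. a j * d i (p j))"
    using dual_family_linear[OF assms(1,3)] by (simp add: linear_sum linear_scale)
  also have "\<dots> = (\<Sum>j\<in>W. if j = i then a i else 0)"
    using assms by (intro sum.cong) (auto simp: dual_family_apply[OF assms(1)] subset_iff)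
  finally show ?thesis using \<open>finite W\<close> by (simp add: sum.delta)
qed

lemma dual_family_inj: "dual_family V p d \<Longrightarrow> inj_on p V"
  by (rule inj_onI) (metis dual_family_apply zero_neq_one)

lemma dual_family_independent:
  assumes "dual_family V p d"
  shows "independent (p ` V)"
proof -
  have fin: "finite V" using assms by (simp add: dual_family_def)
  have "u (p i) = 0" if "(\<Sum>v\<in>p ` V. u v *\<^sub>R v) = 0" "i \<in> V" for u i
  proof -
    have "(\<Sum>j\<in>V. u (p j) *\<^sub>R p j) = 0"
      using that(1) by (simp add: sum.reindex[OF dual_family_inj[OF assms]])
    then show ?thesis
      using dual_family_comb[OF assms subset_refl that(2), of "\<lambda>j. u (p j)"] that(2)
        dual_family_linear[OF assms that(2)] by (simp add: linear_0)
  qed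
  then show ?thesis using fin by (auto simp: dependent_finite)
qed

lemma dual_family_expand:
  assumes "dual_family V p d" "W \<subseteq> V" "y \<in> span (p ` W)"
  shows "y = (\<Sum>j\<in>W. d j y *\<^sub>R p j)"
  using assms(3)
proof (induction rule: span_induct_alt)
  case base
  show ?case using assms(1,2) by (simp add: dual_family_linear subset_iff linear_0)
next
  case (step a z y)
  then obtain i where i: "i \<in> W" "z = p i" by blast
  have fin: "finite W" using assms(1,2) by (auto simp: dual_family_def intro: finite_subset)
  have z: "z = (\<Sum>j\<in>W. d j z *\<^sub>R p j)"
  proof -
    have "(\<Sum>j\<in>W. d j z *\<^sub>R p j) = (\<Sum>j\<in>W. if j = i then p i else 0)"
      using assms(1,2) i by (intro sum.cong) (auto simp: dual_family_apply[OF assms(1)] subset_iff)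
    then show ?thesis using fin i by (simp add: sum.delta)
  qed
  have "(\<Sum>j\<in>W. d j (a *\<^sub>R z + y) *\<^sub>R p j) = (\<Sum>j\<in>W. a *\<^sub>R (d j z *\<^sub>R p j) + d j y *\<^sub>R p j)"
    using assms(1,2) by (intro sum.cong)
      (auto simp: linear_add linear_scale subset_iff dual_family_linear[OF assms(1)] scaleR_add_left)
  also have "\<dots> = a *\<^sub>R (\<Sum>j\<in>W. d j z *\<^sub>R p j) + (\<Sum>j\<in>W. d j y *\<^sub>R p j)"
    by (simp only: sum.distrib scaleR_sum_right)
  also have "\<dots> = a *\<^sub>R z + y" by (simp only: z[symmetric] step.IH[symmetric])
  finally show ?case by (rule sym)
qed

lemma dual_family_span_zero:
  assumes "dual_family V p d" "W \<subseteq> V" "y \<in> span (p ` W)" "i \<in> V - W"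
  shows "d i y = 0"
proof -
  have "d i y = d i (\<Sum>j\<in>W. d j y *\<^sub>R p j)" using dual_family_expand[OF assms(1-3)] by simp
  also have "\<dots> = 0" using assms(4) by (subst dual_family_comb[OF assms(1,2)]) auto
  finally show ?thesis .
qed

lemma sum_in_span_image: "(\<Sum>j\<in>W. a j *\<^sub>R p j) \<in> span (p ` W)"
  by (intro span_sum span_scale span_base) auto

lemma dual_family_span_iff:
  assumes "dual_family V p d" "W \<subseteq> V" "y \<in> span (p ` V)"
  shows "y \<in> span (p ` W) \<longleftrightarrow> (\<forall>i\<in>V - W. d i y = 0)"
proof
  assume *: "\<forall>i\<in>V - W. d i y = 0"
  have "y = (\<Sum>j\<in>V. d j y *\<^sub>R p j)" by (rule dual_family_expand[OF assms(1) subset_refl assms(3)])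
  also have "\<dots> = (\<Sum>j\<in>W. d j y *\<^sub>R p j)"
    using assms(1,2) * by (intro sum.mono_neutral_right) (auto simp: dual_family_def)
  finally show "y \<in> span (p ` W)" by (metis sum_in_span_image)
qed (use dual_family_span_zero[OF assms(1,2)] in auto)

section \<open>Finitely generated cones and their faces\<close>

lemma nonneg_hull_image:
  assumes "inj_on p V"
  shows "nonneg_hull (p ` V) = {\<Sum>i\<in>V. a i *\<^sub>R p i | a. \<forall>i\<in>V. 0 \<le> a i}"
proof (intro set_eqI iffI)
  fix y assume "y \<in> nonneg_hull (p ` V)"
  then obtain a where "\<forall>s\<in>p ` V. 0 \<le> a s" "y = (\<Sum>s\<in>p ` V. a s *\<^sub>R s)" by (auto simp: nonneg_hull_def)
  then show "y \<in> {\<Sum>i\<in>V. a i *\<^sub>R p i | a. \<forall>i\<in>V. 0 \<le> a i}"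
    using assms by (auto simp: sum.reindex intro!: exI[of _ "\<lambda>i. a (p i)"])
next
  fix y assume "y \<in> {\<Sum>i\<in>V. a i *\<^sub>R p i | a. \<forall>i\<in>V. 0 \<le> a i}"
  then obtain a where a: "\<forall>i\<in>V. 0 \<le> a i" "y = (\<Sum>i\<in>V. a i *\<^sub>R p i)" by auto
  have "y = (\<Sum>s\<in>p ` V. a (the_inv_into V p s) *\<^sub>R s)"
    using assms by (simp add: sum.reindex the_inv_into_f_f a)
  then show "y \<in> nonneg_hull (p ` V)" unfolding nonneg_hull_def
    using assms a by (auto simp: the_inv_into_f_f intro!: exI[of _ "\<lambda>s. a (the_inv_into V p s)"])
qed

lemma dual_family_nonneg_hull_iff:
  assumes df: "dual_family V p d" and W: "W \<subseteq> V"
  shows "y \<in> nonneg_hull (p ` W) \<longleftrightarrow> y \<in> span (p ` W) \<and> (\<forall>i\<in>W. 0 \<le> d i y)"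
proof -
  have inj: "inj_on p W" using dual_family_inj[OF df] W by (rule inj_on_subset)
  show ?thesis
  proof
    assume "y \<in> nonneg_hull (p ` W)"
    then obtain a where a: "\<forall>i\<in>W. 0 \<le> a i" "y = (\<Sum>i\<in>W. a i *\<^sub>R p i)"
      by (auto simp: nonneg_hull_image[OF inj])
    have "d i y = a i" if "i \<in> W" for i
      using dual_family_comb[OF df W, of i a] that W a by auto
    with a show "y \<in> span (p ` W) \<and> (\<forall>i\<in>W. 0 \<le> d i y)" by (auto simp: sum_in_span_image)
  next
    assume y: "y \<in> span (p ` W) \<and> (\<forall>i\<in>W. 0 \<le> d i y)"
    then have "y = (\<Sum>j\<in>W. d j y *\<^sub>R p j)" using dual_family_expand[OF df W] by blast
    with y show "y \<in> nonneg_hull (p ` W)"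
      unfolding nonneg_hull_image[OF inj] mem_Collect_eq by (intro exI[of _ "\<lambda>j. d j y"]) simp
  qed
qed

lemma nonneg_hull_subset_span: "nonneg_hull S \<subseteq> span S"
  unfolding nonneg_hull_def by (auto intro!: span_sum span_scale intro: span_base)

lemma nonneg_hull_generator:
  assumes "finite S" "s \<in> S"
  shows "s \<in> nonneg_hull S"
  unfolding nonneg_hull_def
  using assms by (auto intro!: exI[of _ "\<lambda>t. if t = s then 1 else 0"] simp: if_distrib[of "\<lambda>c. c *\<^sub>R _"] cong: if_cong)

lemma span_nonneg_hull: "finite S \<Longrightarrow> span (nonneg_hull S) = span S"
  by (intro span_eq[THEN iffD2] conjI nonneg_hull_subset_span)
    (auto intro: span_base nonneg_hull_generator)

lemma nonneg_hull_add: "y \<in> nonneg_hull S \<Longrightarrow> z \<in> nonneg_hull S \<Longrightarrow> y + z \<in> nonneg_hull S"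
proof -
  assume "y \<in> nonneg_hull S" "z \<in> nonneg_hull S"
  then obtain a b where "\<forall>s\<in>S. 0 \<le> a s" "y = (\<Sum>s\<in>S. a s *\<^sub>R s)" "\<forall>s\<in>S. 0 \<le> b s" "z = (\<Sum>s\<in>S. b s *\<^sub>R s)"
    by (auto simp: nonneg_hull_def)
  then show ?thesis unfolding nonneg_hull_def
    by (auto intro!: exI[of _ "\<lambda>s. a s + b s"] simp: scaleR_add_left sum.distrib)
qed

lemma nonneg_hull_scale: "y \<in> nonneg_hull S \<Longrightarrow> 0 \<le> t \<Longrightarrow> t *\<^sub>R y \<in> nonneg_hull S"
  unfolding nonneg_hull_def
  by clarify (rule exI[where P = "\<lambda>b. _ = (\<Sum>s\<in>S. b s *\<^sub>R s) \<and> _ b"], auto simp: scaleR_sum_right)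

lemma zero_in_nonneg_hull: "0 \<in> nonneg_hull S"
  unfolding nonneg_hull_def by (auto intro!: exI[of _ "\<lambda>_. 0"])

lemma nonneg_hull_sum:
  assumes "\<And>s. s \<in> A \<Longrightarrow> f s \<in> nonneg_hull S"
  shows "(\<Sum>s\<in>A. f s) \<in> nonneg_hull S"
  using assms by (induction A rule: infinite_finite_induct) (auto simp: zero_in_nonneg_hull nonneg_hull_add)

lemma nonneg_hull_subset:
  assumes "A \<subseteq> nonneg_hull S"
  shows "nonneg_hull A \<subseteq> nonneg_hull S"
proof
  fix y assume "y \<in> nonneg_hull A"
  then obtain a where "\<forall>s\<in>A. 0 \<le> a s" "y = (\<Sum>s\<in>A. a s *\<^sub>R s)" by (auto simp: nonneg_hull_def)
  then show "y \<in> nonneg_hull S" using assms by (auto intro!: nonneg_hull_sum nonneg_hull_scale)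
qed

lemma convex_nonneg_hull: "convex (nonneg_hull S)"
  by (auto simp: convex_def intro!: nonneg_hull_add nonneg_hull_scale)

text \<open>The sum \<open>y + z\<close> is the midpoint of \<open>2 *\<^sub>R y\<close> and
  \<open>2 *\<^sub>R z\<close>, so the face contains these endpoints, and it is closed under
  scaling. For \<open>y = z\<close> the open segment is empty, but then \<open>y\<close> is half of
  the sum.\<close>

lemma face_of_coneD:
  assumes face: "nonneg_hull F face_of nonneg_hull S"
    and y: "y \<in> nonneg_hull S" and z: "z \<in> nonneg_hull S" and sum: "y + z \<in> nonneg_hull F"
  shows "y \<in> nonneg_hull F"
proof (cases "y = z")
  case True
  then have "y = (1/2) *\<^sub>R (y + z)" by (simp add: scaleR_2[symmetric])
  then show ?thesis using nonneg_hull_scale[OF sum, of "1/2"] by simp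
next
  case False
  have "y + z \<in> open_segment (2 *\<^sub>R y) (2 *\<^sub>R z)"
    using False by (auto simp: in_segment intro!: exI[of _ "1/2"])
  moreover have "2 *\<^sub>R y \<in> nonneg_hull S" "2 *\<^sub>R z \<in> nonneg_hull S"
    using y z by (auto intro: nonneg_hull_scale)
  ultimately have "2 *\<^sub>R y \<in> nonneg_hull F" using face_ofD[OF face _ _ _ sum] by blast
  from nonneg_hull_scale[OF this, of "1/2"] show ?thesis by simp
qed

lemma face_of_cone_summand:
  assumes face: "nonneg_hull F face_of nonneg_hull S" and "finite A"
    and f: "\<And>s. s \<in> A \<Longrightarrow> f s \<in> nonneg_hull S" and sum: "(\<Sum>s\<in>A. f s) \<in> nonneg_hull F" and "s \<in> A"
  shows "f s \<in> nonneg_hull F"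
proof (rule face_of_coneD[OF face])
  show "(\<Sum>t\<in>A - {s}. f t) \<in> nonneg_hull S" using f by (intro nonneg_hull_sum) auto
  show "f s + (\<Sum>t\<in>A - {s}. f t) \<in> nonneg_hull F"
    using sum assms(2,5) by (simp add: sum.remove[symmetric])
qed (use f \<open>s \<in> A\<close> in auto)

text \<open>The subcone is cut out by the vanishing of coordinates that are nonnegative on the whole
  cone; a convex combination of nonnegative numbers with positive weights vanishes only if both
  do.\<close>

lemma simplicial_face:
  assumes df: "dual_family V p d" and W: "W \<subseteq> V"
  shows "nonneg_hull (p ` W) face_of nonneg_hull (p ` V)"
  unfolding face_of_def
proof (intro conjI ballI impI convex_nonneg_hull)
  have fin: "finite V" using df by (simp add: dual_family_def)
  have *: "y \<in> nonneg_hull (p ` W) \<longleftrightarrow> y \<in> nonneg_hull (p ` V) \<and> (\<forall>i\<in>V - W. d i y = 0)" for y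
  proof -
    have sub: "span (p ` W) \<subseteq> span (p ` V)" using W by (intro span_mono) auto
    show ?thesis
    proof (cases "y \<in> span (p ` V)")
      case True
      have "(\<forall>i\<in>W. 0 \<le> d i y) \<longleftrightarrow> (\<forall>i\<in>V. 0 \<le> d i y)" if "\<forall>i\<in>V - W. d i y = 0"
        using that W by (metis Diff_iff order_refl subsetD)
      then show ?thesis
        unfolding dual_family_nonneg_hull_iff[OF df W] dual_family_nonneg_hull_iff[OF df subset_refl]
          dual_family_span_iff[OF df W True] using True by blast
    next
      case False
      then show ?thesis
        unfolding dual_family_nonneg_hull_iff[OF df W] dual_family_nonneg_hull_iff[OF df subset_refl]
        using sub by blast
    qed
  qed
  show "nonneg_hull (p ` W) \<subseteq> nonneg_hull (p ` V)" using * by blast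
  fix a b y assume a: "a \<in> nonneg_hull (p ` V)" and b: "b \<in> nonneg_hull (p ` V)"
    and y: "y \<in> nonneg_hull (p ` W)" and seg: "y \<in> open_segment a b"
  obtain t where t: "0 < t" "t < 1" "y = (1 - t) *\<^sub>R a + t *\<^sub>R b" using seg by (auto simp: in_segment)
  have "d i a = 0 \<and> d i b = 0" if i: "i \<in> V - W" for i
  proof -
    have "0 \<le> d i a" "0 \<le> d i b" using a b i dual_family_nonneg_hull_iff[OF df subset_refl] by auto
    moreover have "d i y = 0" using y i * by blast
    then have "(1 - t) * d i a + t * d i b = 0"
      using i dual_family_linear[OF df, of i] unfolding t(3) by (simp add: linear_add linear_scale)
    ultimately show ?thesis using t
      by (smt (verit, best) mult_nonneg_nonneg mult_pos_pos)
  qed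
  then show "a \<in> nonneg_hull (p ` W)" "b \<in> nonneg_hull (p ` W)" using a b * by blast+
qed

text \<open>A point of the face is a sum of nonnegative multiples of generators. Each summand lies
  in the face, and so does each generator with positive coefficient.\<close>

lemma cone_face_of_simplicial:
  assumes df: "dual_family V p d" and face: "nonneg_hull F face_of nonneg_hull (p ` V)"
  shows "nonneg_hull F = nonneg_hull (p ` {i \<in> V. p i \<in> nonneg_hull F})"
proof
  have fin: "finite V" using df by (simp add: dual_family_def)
  show "nonneg_hull (p ` {i \<in> V. p i \<in> nonneg_hull F}) \<subseteq> nonneg_hull F"
    by (rule nonneg_hull_subset) auto
  show "nonneg_hull F \<subseteq> nonneg_hull (p ` {i \<in> V. p i \<in> nonneg_hull F})"
  proof
    fix y assume y: "y \<in> nonneg_hull F"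
    then have "y \<in> nonneg_hull (p ` V)" using face by (auto simp: face_of_def)
    then have sp: "y \<in> span (p ` V)" and nn: "\<forall>i\<in>V. 0 \<le> d i y"
      by (auto simp: dual_family_nonneg_hull_iff[OF df subset_refl])
    have eq: "y = (\<Sum>i\<in>V. d i y *\<^sub>R p i)" by (rule dual_family_expand[OF df subset_refl sp])
    have "d i y *\<^sub>R p i \<in> nonneg_hull (p ` {i \<in> V. p i \<in> nonneg_hull F})" if i: "i \<in> V" for i
    proof (cases "d i y = 0")
      case False
      with nn i have pos: "d i y > 0" by fastforce
      have "d i y *\<^sub>R p i \<in> nonneg_hull F"
      proof (rule face_of_cone_summand[OF face fin])
        show "d j y *\<^sub>R p j \<in> nonneg_hull (p ` V)" if "j \<in> V" for j
          using that nn fin by (intro nonneg_hull_scale nonneg_hull_generator) auto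
      qed (use y eq i in auto)
      from nonneg_hull_scale[OF this, of "1 / d i y"] pos have "p i \<in> nonneg_hull F" by simp
      then show ?thesis using i fin nn by (intro nonneg_hull_scale nonneg_hull_generator) auto
    qed (simp add: zero_in_nonneg_hull)
    then have "(\<Sum>i\<in>V. d i y *\<^sub>R p i) \<in> nonneg_hull (p ` {i \<in> V. p i \<in> nonneg_hull F})"
      by (intro nonneg_hull_sum)
    with eq show "y \<in> nonneg_hull (p ` {i \<in> V. p i \<in> nonneg_hull F})" by simp
  qed
qed

lemma nonneg_hull_singleton: "nonneg_hull {s} = {t *\<^sub>R s | t. 0 \<le> t}"
  unfolding nonneg_hull_def by (auto intro: exI[of _ "\<lambda>_. _"])

lemma nonneg_hull_singleton_scale:
  assumes "0 < r"
  shows "nonneg_hull {r *\<^sub>R s} = nonneg_hull {s}"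
proof -
  have "r *\<^sub>R s \<in> nonneg_hull {s}"
    using assms unfolding nonneg_hull_singleton by auto
  moreover have "s \<in> nonneg_hull {r *\<^sub>R s}"
    using assms unfolding nonneg_hull_singleton mem_Collect_eq by (intro exI[of _ "1 / r"]) simp
  ultimately show ?thesis by (intro subset_antisym nonneg_hull_subset) auto
qed

section \<open>Lattices and bases of the dual lattice\<close>

lemma is_lattice_coords:
  assumes "is_lattice N"
  obtains A e where "dual_family A (\<lambda>a. a) e" "N = {y \<in> span A. \<forall>a\<in>A. e a y \<in> \<int>}"
proof -
  obtain A where A: "finite A" "independent A"
    and N: "N = {\<Sum>b\<in>A. of_int (k b) *\<^sub>R b | k :: 'a \<Rightarrow> int. True}"
    using assms by (auto simp: is_lattice_def)
  obtain e where e: "dual_family A (\<lambda>a. a) e" using dual_family_exists[of A "\<lambda>a. a"] A by auto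
  have "N = {y \<in> span A. \<forall>a\<in>A. e a y \<in> \<int>}"
  proof (intro set_eqI iffI)
    fix y assume "y \<in> N"
    then obtain k :: "'a \<Rightarrow> int" where y: "y = (\<Sum>b\<in>A. of_int (k b) *\<^sub>R b)" by (auto simp: N)
    have "e a y = of_int (k a)" if "a \<in> A" for a
      using dual_family_comb[OF e subset_refl that, of "\<lambda>b. of_int (k b)"] that by (simp add: y)
    moreover have "y \<in> span A" unfolding y by (intro span_sum span_scale span_base)
    ultimately show "y \<in> {y \<in> span A. \<forall>a\<in>A. e a y \<in> \<int>}" by auto
  next
    fix y assume y: "y \<in> {y \<in> span A. \<forall>a\<in>A. e a y \<in> \<int>}"
    then have "y = (\<Sum>a\<in>A. e a y *\<^sub>R a)" using dual_family_expand[OF e subset_refl, of y] by simp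
    also have "\<dots> = (\<Sum>a\<in>A. of_int \<lfloor>e a y\<rfloor> *\<^sub>R a)"
      using y by (intro sum.cong) (auto elim: Ints_cases)
    finally show "y \<in> N" unfolding N mem_Collect_eq by (intro exI[of _ "\<lambda>a. \<lfloor>e a y\<rfloor>"]) simp
  qed
  with e show ?thesis by (rule that)
qed

lemma lattice_span:
  assumes e: "dual_family A (\<lambda>a. a) e" and N: "N = {y \<in> span A. \<forall>a\<in>A. e a y \<in> \<int>}"
  shows "A \<subseteq> N" "span N = span A" "dim N = card A"
proof -
  show A: "A \<subseteq> N" using dual_family_apply[OF e] by (auto simp: N intro: span_base)
  have "N \<subseteq> span A" by (auto simp: N)
  with A show "span N = span A" by (metis span_eq subset_trans span_superset)
  then show "dim N = card A" using dual_family_independent[OF e] by (intro dim_eq_card) auto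
qed

lemma lattice_diff_scale:
  assumes "is_lattice N" "x \<in> N" "y \<in> N"
  shows "x - of_int k *\<^sub>R y \<in> N"
proof -
  obtain A e where e: "dual_family A (\<lambda>a. a) e" and N: "N = {y \<in> span A. \<forall>a\<in>A. e a y \<in> \<int>}"
    using is_lattice_coords[OF assms(1)] .
  have "e a (x - of_int k *\<^sub>R y) = e a x - of_int k * e a y" if "a \<in> A" for a
    using dual_family_linear[OF e that] by (simp add: linear_diff linear_scale)
  then show ?thesis using assms(2,3) by (auto simp: N intro: span_diff span_scale)
qed

lemma dual_lattice_apply_int: "u \<in> dual_lattice N \<Longrightarrow> y \<in> N \<Longrightarrow> u y \<in> \<int>"
  by (simp add: dual_lattice_def)

lemma dual_lattice_coords:
  assumes e: "dual_family A (\<lambda>a. a) e" and N: "N = {y \<in> span A. \<forall>a\<in>A. e a y \<in> \<int>}"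
    and sp: "span A = UNIV" and u: "linear u"
  shows "u y = (\<Sum>a\<in>A. u a * e a y)"
proof -
  have "u y = u (\<Sum>a\<in>A. e a y *\<^sub>R a)" using dual_family_expand[OF e subset_refl, of y] sp by simp
  then show ?thesis using u by (simp add: linear_sum linear_scale mult.commute)
qed

lemma dual_lattice_iff:
  assumes e: "dual_family A (\<lambda>a. a) e" and N: "N = {y \<in> span A. \<forall>a\<in>A. e a y \<in> \<int>}"
    and sp: "span A = UNIV"
  shows "u \<in> dual_lattice N \<longleftrightarrow> linear u \<and> (\<forall>a\<in>A. u a \<in> \<int>)"
proof
  assume u: "linear u \<and> (\<forall>a\<in>A. u a \<in> \<int>)"
  have "u y \<in> \<int>" if "y \<in> N" for y
    using that u by (subst dual_lattice_coords[OF e N sp, of u y]) (auto simp: N intro!: Ints_sum Ints_mult)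
  with u show "u \<in> dual_lattice N" by (simp add: dual_lattice_def)
next
  assume "u \<in> dual_lattice N"
  then show "linear u \<and> (\<forall>a\<in>A. u a \<in> \<int>)"
    using lattice_span(1)[OF e N] by (auto simp: dual_lattice_def)
qed

lemma linear_functional_sum:
  assumes "\<And>b. b \<in> B \<Longrightarrow> linear b"
  shows "linear (\<lambda>y. \<Sum>b\<in>B. t b * b y :: real)"
  using assms by (intro linearI) (simp_all add: linear_add linear_scale distrib_left sum.distrib
      sum_distrib_left mult.left_commute)

text \<open>The coordinate functionals of a lattice basis form a basis of the dual lattice.\<close>

lemma dual_lattice_basis_exists:
  assumes "is_lattice N" "span N = UNIV"
  shows "\<exists>B. dual_lattice_basis N B"
proof -
  obtain A e where e: "dual_family A (\<lambda>a. a) e" and N: "N = {y \<in> span A. \<forall>a\<in>A. e a y \<in> \<int>}"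
    using is_lattice_coords[OF assms(1)] .
  have sp: "span A = UNIV" using lattice_span(2)[OF e N] assms(2) by simp
  have fin: "finite A" using e by (simp add: dual_family_def)
  have inj: "inj_on e A"
    by (rule inj_onI) (metis dual_family_apply[OF e] zero_neq_one)
  let ?f = "\<lambda>k x. \<Sum>b\<in>e ` A. of_int (k b) * b x"
  have f_at: "?f k a = of_int (k (e a))" if "a \<in> A" for k :: "('a \<Rightarrow> real) \<Rightarrow> int" and a
  proof -
    have "?f k a = (\<Sum>a'\<in>A. if a' = a then of_int (k (e a)) else 0)"
      unfolding sum.reindex[OF inj] o_def
      by (rule sum.cong) (use dual_family_apply[OF e] that in auto)
    then show ?thesis using fin that by (simp add: sum.delta)
  qed
  have lin: "linear (?f k)" for k
    by (rule linear_functional_sum) (use dual_family_linear[OF e] in auto)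
  have "bij_betw ?f (e ` A \<rightarrow>\<^sub>E (UNIV :: int set)) (dual_lattice N)"
  proof (rule bij_betwI')
    fix k k' :: "('a \<Rightarrow> real) \<Rightarrow> int" assume k: "k \<in> e ` A \<rightarrow>\<^sub>E UNIV" "k' \<in> e ` A \<rightarrow>\<^sub>E UNIV"
    show "?f k = ?f k' \<longleftrightarrow> k = k'"
    proof
      assume eq: "?f k = ?f k'"
      have "k (e a) = k' (e a)" if "a \<in> A" for a
        using f_at[OF that, of k] f_at[OF that, of k'] fun_cong[OF eq, of a] by linarith
      with k show "k = k'" by (intro PiE_ext) auto
    qed simp
  next
    fix k :: "('a \<Rightarrow> real) \<Rightarrow> int"
    show "?f k \<in> dual_lattice N" unfolding dual_lattice_iff[OF e N sp] using lin f_at by auto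
  next
    fix u assume "u \<in> dual_lattice N"
    then have u: "linear u" "\<And>a. a \<in> A \<Longrightarrow> u a \<in> \<int>" by (auto simp: dual_lattice_iff[OF e N sp])
    let ?k = "\<lambda>b\<in>e ` A. \<lfloor>u (the_inv_into A e b)\<rfloor>"
    have "u = ?f ?k"
    proof (rule ext, rule linear_eq_on[OF u(1) lin])
      fix y show "y \<in> span A" using sp by simp
    next
      show "u a = ?f ?k a" if "a \<in> A" for a
        using that u(2)[OF that] inj by (subst f_at) (auto simp: the_inv_into_f_f elim: Ints_cases)
    qed
    then show "\<exists>k\<in>e ` A \<rightarrow>\<^sub>E (UNIV :: int set). u = ?f k" by (rule bexI[of _ ?k]) simp
  qed
  then show ?thesis using fin by (auto simp: dual_lattice_basis_def)
qed

text \<open>A basis is given only through unique integral representation, so its size and real dual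
  vectors have to be derived. Comparison with the dual \<open>e\<close> of a lattice basis
  \<open>A\<close> gives an integral matrix in each direction, both onto the integer vectors;
  reduction modulo 2 then equates the cardinalities.\<close>

lemma dual_lattice_basis_coords:
  assumes N': "is_lattice N" "span N = UNIV" and B: "dual_lattice_basis N B"
  shows "finite B" "B \<subseteq> dual_lattice N" "card B = dim N"
    and "\<exists>x. \<forall>b\<in>B. \<forall>b'\<in>B. b (x b') = (if b = b' then 1 else 0)"
    and "y \<noteq> 0 \<Longrightarrow> \<exists>b\<in>B. b y \<noteq> 0"
proof -
  obtain A e where e: "dual_family A (\<lambda>a. a) e" and N: "N = {y \<in> span A. \<forall>a\<in>A. e a y \<in> \<int>}"
    using is_lattice_coords[OF N'(1)] .
  have sp: "span A = UNIV" using lattice_span(2)[OF e N] N'(2) by simp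
  have finA: "finite A" using e by (simp add: dual_family_def)
  let ?f = "\<lambda>k x. \<Sum>b\<in>B. of_int (k b) * b x"
  show finB: "finite B" using B by (auto simp: dual_lattice_basis_def)
  have bij: "bij_betw ?f (B \<rightarrow>\<^sub>E (UNIV :: int set)) (dual_lattice N)"
    using B by (auto simp: dual_lattice_basis_def)
  have f_restrict: "?f (restrict k B) = ?f k" for k by (auto intro!: sum.cong)
  have f_in: "?f k \<in> dual_lattice N" for k
    unfolding f_restrict[of k, symmetric] by (rule bij_betwE[OF bij, rule_format]) auto
  have f_inj: "k b = k' b" if "?f k = ?f k'" "b \<in> B" for k k' b
  proof -
    have "restrict k B = restrict k' B"
      using bij that(1) unfolding bij_betw_def
      by (intro inj_onD[of ?f "B \<rightarrow>\<^sub>E UNIV"]) (auto simp only: f_restrict restrict_PiE_iff)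
    then show ?thesis using that(2) by (metis restrict_apply')
  qed
  have f_surj: "\<exists>k. u = ?f k" if "u \<in> dual_lattice N" for u
    using bij that unfolding bij_betw_def by blast
  show BL: "B \<subseteq> dual_lattice N"
  proof
    fix b assume b: "b \<in> B"
    have eq: "?f (\<lambda>b'. if b' = b then 1 else 0) = b"
    proof
      fix y
      have "?f (\<lambda>b'. if b' = b then 1 else 0) y = (\<Sum>b'\<in>B. if b' = b then b y else 0)"
        by (rule sum.cong) auto
      then show "?f (\<lambda>b'. if b' = b then 1 else 0) y = b y" using finB b by (simp add: sum.delta)
    qed
    show "b \<in> dual_lattice N" using f_in[of "\<lambda>b'. if b' = b then 1 else 0"] unfolding eq .
  qed
  have "e a \<in> dual_lattice N" if "a \<in> A" for a
    using that dual_family_apply[OF e that] dual_family_linear[OF e that]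
    by (auto simp: dual_lattice_iff[OF e N sp])
  then have "\<forall>a\<in>A. \<exists>k. e a = ?f k" using f_surj by blast
  then obtain M where "\<forall>a\<in>A. e a = ?f (M a)" by (rule bchoice[THEN exE])
  then have M: "e a = ?f (M a)" if "a \<in> A" for a using that by (rule bspec)
  \<comment> \<open>The coordinates of \<open>u\<close> in \<open>B\<close> depend linearly on the
    values of \<open>u\<close> on \<open>A\<close>, through the integral matrix \<open>M\<close>
    that writes the \<open>e a\<close> in terms of \<open>B\<close>.\<close>
  have coord: "of_int (k b) = (\<Sum>a\<in>A. u a * of_int (M a b))"
    if u: "u \<in> dual_lattice N" "u = ?f k" and b: "b \<in> B" for u k b
  proof -
    let ?m = "\<lambda>a. \<lfloor>u a\<rfloor>"
    have int: "of_int (?m a) = u a" if "a \<in> A" for a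
      using u(1) that by (auto simp: dual_lattice_iff[OF e N sp] elim: Ints_cases)
    have "?f k = ?f (\<lambda>b. \<Sum>a\<in>A. ?m a * M a b)"
    proof
      fix y
      have "?f k y = (\<Sum>a\<in>A. u a * e a y)"
        using dual_lattice_coords[OF e N sp, of u y] u by (auto simp: dual_lattice_def)
      also have "\<dots> = (\<Sum>a\<in>A. \<Sum>b\<in>B. of_int (?m a * M a b) * b y)"
        by (intro sum.cong refl) (simp only: fun_cong[OF M] int of_int_mult sum_distrib_left mult.assoc)
      also have "\<dots> = (\<Sum>b\<in>B. \<Sum>a\<in>A. of_int (?m a * M a b) * b y)" by (rule sum.swap)
      also have "\<dots> = ?f (\<lambda>b. \<Sum>a\<in>A. ?m a * M a b) y"
        unfolding of_int_sum sum_distrib_right ..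
      finally show "?f k y = ?f (\<lambda>b. \<Sum>a\<in>A. ?m a * M a b) y" .
    qed
    then have "k b = (\<Sum>a\<in>A. ?m a * M a b)" using b by (rule f_inj)
    then show ?thesis by (simp only: of_int_sum of_int_mult int cong: sum.cong)
  qed
  have "card B \<le> card A"
  proof (rule card_le_of_integral_surj[OF finA finB])
    fix y :: "('a \<Rightarrow> real) \<Rightarrow> int"
    have int: "of_int \<lfloor>?f y a\<rfloor> = ?f y a" if "a \<in> A" for a
      using f_in[of y] that by (auto simp: dual_lattice_iff[OF e N sp] elim: Ints_cases)
    have "real_of_int (y b) = real_of_int (\<Sum>a\<in>A. \<lfloor>?f y a\<rfloor> * M a b)" if b: "b \<in> B" for b
    proof -
      have "real_of_int (y b) = (\<Sum>a\<in>A. ?f y a * of_int (M a b))" by (rule coord[OF f_in refl b])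
      also have "\<dots> = real_of_int (\<Sum>a\<in>A. \<lfloor>?f y a\<rfloor> * M a b)"
        unfolding of_int_sum of_int_mult by (intro sum.cong refl) (simp only: int)
      finally show ?thesis .
    qed
    then show "\<exists>k. \<forall>b\<in>B. y b = (\<Sum>a\<in>A. k a * M a b)" by (intro exI[of _ "\<lambda>a. \<lfloor>?f y a\<rfloor>"] ballI) (simp only: of_int_eq_iff)
  qed
  \<comment> \<open>Here the matrix consists of the values of \<open>B\<close> on \<open>A\<close>,
    integral because \<open>A\<close> lies in the lattice.\<close>
  moreover have "card A \<le> card B"
  proof (rule card_le_of_integral_surj[OF finB finA, of "\<lambda>b a. \<lfloor>b a\<rfloor>"])
    fix y :: "'a \<Rightarrow> int"
    let ?u = "\<lambda>z. \<Sum>a\<in>A. of_int (y a) * e a z"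
    have at: "?u a = of_int (y a)" if a: "a \<in> A" for a
    proof -
      have "?u a = (\<Sum>a'\<in>A. if a' = a then of_int (y a) else 0)"
        by (rule sum.cong) (use a dual_family_apply[OF e] in auto)
      then show ?thesis using finA a by (simp add: sum.delta)
    qed
    have "linear ?u" using dual_family_linear[OF e]
      by (intro linearI) (simp_all add: linear_add linear_scale distrib_left sum.distrib
          sum_distrib_left mult.left_commute)
    then have "?u \<in> dual_lattice N" using at by (auto simp: dual_lattice_iff[OF e N sp])
    then obtain k where k: "?u = ?f k" using f_surj by blast
    have "y a = (\<Sum>b\<in>B. k b * \<lfloor>b a\<rfloor>)" if a: "a \<in> A" for a
    proof -
      have int: "of_int \<lfloor>b a\<rfloor> = b a" if "b \<in> B" for b
      proof -
        have "b a \<in> \<int>"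
          using BL that a lattice_span(1)[OF e N] by (intro dual_lattice_apply_int[of b N]) auto
        then show ?thesis by (rule Ints_cases) simp
      qed
      have "real_of_int (y a) = ?f k a" using fun_cong[OF k, of a] at[OF a] by simp
      also have "\<dots> = real_of_int (\<Sum>b\<in>B. k b * \<lfloor>b a\<rfloor>)"
        unfolding of_int_sum of_int_mult by (intro sum.cong refl) (simp only: int)
      finally show ?thesis by (simp only: of_int_eq_iff)
    qed
    then show "\<exists>k. \<forall>a\<in>A. y a = (\<Sum>b\<in>B. k b * \<lfloor>b a\<rfloor>)" by blast
  qed
  ultimately show "card B = dim N" using lattice_span(3)[OF e N] by simp
  \<comment> \<open>By \<open>coord\<close>, the coordinate at \<open>b\<close> of any
    \<open>u\<close> in the dual lattice is the value of \<open>u\<close> at this vector.\<close>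
  define x where "x b = (\<Sum>a\<in>A. of_int (M a b) *\<^sub>R a)" for b
  have "b (x b') = (if b = b' then 1 else 0)" if b: "b \<in> B" "b' \<in> B" for b b'
  proof -
    have bL: "b \<in> dual_lattice N" using BL b by blast
    have bf: "b = ?f (\<lambda>c. if c = b then 1 else 0)"
    proof
      fix y
      have "?f (\<lambda>b'. if b' = b then 1 else 0) y = (\<Sum>b'\<in>B. if b' = b then b y else 0)"
        by (rule sum.cong) auto
      then show "b y = ?f (\<lambda>b'. if b' = b then 1 else 0) y" using finB b by (simp add: sum.delta)
    qed
    have "b (x b') = (\<Sum>a\<in>A. b a * of_int (M a b'))"
      using bL by (simp add: x_def dual_lattice_def linear_sum linear_scale mult.commute)
    also have "\<dots> = of_int (if b' = b then 1 else 0)" by (rule coord[OF bL bf b(2), symmetric])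
    finally show ?thesis by auto
  qed
  then show "\<exists>x. \<forall>b\<in>B. \<forall>b'\<in>B. b (x b') = (if b = b' then 1 else 0)" by blast
  show "\<exists>b\<in>B. b y \<noteq> 0" if "y \<noteq> 0"
  proof (rule ccontr)
    assume "\<not> ?thesis"
    then have z: "b y = 0" if "b \<in> B" for b using that by blast
    have "e a y = 0" if "a \<in> A" for a
      unfolding fun_cong[OF M[OF that]]
    proof (rule sum.neutral, rule ballI)
      fix b assume "b \<in> B"
      from z[OF this] show "of_int (M a b) * b y = 0" by simp
    qed
    then have "y = 0" using dual_family_expand[OF e subset_refl, of y] sp by simp
    with that show False by simp
  qed
qed

lemma dual_lattice_eq_comb:
  assumes "dual_lattice_basis N B"
  shows "dual_lattice N = {\<lambda>y. \<Sum>b\<in>B. of_int (k b) * b y | k. True}"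
proof -
  let ?f = "\<lambda>k x. \<Sum>b\<in>B. of_int (k b) * b x"
  have bij: "bij_betw ?f (B \<rightarrow>\<^sub>E (UNIV :: int set)) (dual_lattice N)"
    using assms by (simp add: dual_lattice_basis_def)
  have "?f k \<in> dual_lattice N" for k
  proof -
    have "?f k = ?f (restrict k B)" by (auto intro!: sum.cong)
    also have "\<dots> \<in> dual_lattice N" by (rule bij_betwE[OF bij, rule_format]) auto
    finally show ?thesis .
  qed
  moreover have "\<exists>k. u = ?f k" if "u \<in> dual_lattice N" for u
    using bij that unfolding bij_betw_def by blast
  ultimately show ?thesis by blast
qed

section \<open>Rays and primitive vectors\<close>

lemma cone_dim_one_ray:
  assumes C: "C \<in> cones N" and dim: "dim C = 1"
  obtains s where "s \<in> N" "s \<noteq> 0" "C = nonneg_hull {s}"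
proof -
  obtain S where S: "finite S" "S \<subseteq> N" "C = nonneg_hull S" and pointed: "\<And>x. x \<in> C \<Longrightarrow> - x \<in> C \<Longrightarrow> x = 0"
    using C by (auto simp: cones_def)
  obtain D where D: "D \<subseteq> C" "C \<subseteq> span D" "card D = dim C" by (rule basis_exists)
  then obtain b where b: "D = {b}" using dim card_1_singletonE by metis
  have "\<exists>s\<in>S. s \<noteq> 0"
  proof (rule ccontr)
    assume "\<not> ?thesis"
    then have "C \<subseteq> span {}" using nonneg_hull_subset_span[of S] span_mono[of S "{0}"] by (auto simp: S)
    then have "dim C \<le> 0" using dim_le_card[of C "{}"] by simp
    with dim show False by simp
  qed
  then obtain s where s: "s \<in> S" "s \<noteq> 0" by blast
  have sC: "s \<in> C" using S s by (auto intro: nonneg_hull_generator)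
  then obtain r where r: "s = r *\<^sub>R b" using D b by (auto simp: span_singleton)
  have "C \<subseteq> nonneg_hull {s}"
  proof
    fix y assume y: "y \<in> C"
    then obtain q where q: "y = q *\<^sub>R b" using D b by (auto simp: span_singleton)
    define c where "c = q / r"
    have y_eq: "y = c *\<^sub>R s" using q r s by (auto simp: c_def)
    have "0 \<le> c"
    proof (rule ccontr)
      assume neg: "\<not> 0 \<le> c"
      \<comment> \<open>A negative multiple of \<open>s\<close> in the cone would, after rescaling,
        put \<open>- s\<close> there, against pointedness.\<close>
      have "(- 1 / c) *\<^sub>R y \<in> C"
        using y neg unfolding S(3) by (intro nonneg_hull_scale) (auto simp: divide_le_0_iff not_le)
      moreover have "(- 1 / c) *\<^sub>R y = - s" using y_eq neg by auto
      ultimately show False using pointed[OF sC] s by auto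
    qed
    then show "y \<in> nonneg_hull {s}" using y_eq by (auto simp: nonneg_hull_singleton)
  qed
  moreover have "nonneg_hull {s} \<subseteq> C" using sC unfolding S(3) by (intro nonneg_hull_subset) auto
  ultimately show ?thesis using s S by (intro that[of s]) auto
qed

text \<open>A coordinate functional nonzero at \<open>s\<close>, with its sign adjusted, takes
  positive integral values at the nonzero lattice points of the ray. A lattice point
  \<open>x\<close> that minimizes it generates all the others: a fractional remainder would be a
  lattice point with a smaller value.\<close>

lemma ray_primitive_generator:
  assumes N': "is_lattice N" and s: "s \<in> N" "s \<noteq> 0"
  obtains x where "primitive_in N x" "nonneg_hull {s} = nonneg_hull {x}"
    "\<And>y. y \<in> nonneg_hull {x} \<Longrightarrow> primitive_in N y \<Longrightarrow> y = x"
proof -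
  obtain A e where e: "dual_family A (\<lambda>a. a) e" and N: "N = {y \<in> span A. \<forall>a\<in>A. e a y \<in> \<int>}"
    using is_lattice_coords[OF N'] .
  have "\<exists>a\<in>A. e a s \<noteq> 0"
  proof (rule ccontr)
    assume "\<not> ?thesis"
    then have "s = 0" using dual_family_expand[OF e subset_refl, of s] s N by simp
    with s show False by simp
  qed
  then obtain a where a: "a \<in> A" "e a s \<noteq> 0" by blast
  define f where "f y = sgn (e a s) * e a y" for y
  have lin: "f (t *\<^sub>R y) = t * f y" for t y
    using dual_family_linear[OF e a(1)] by (simp add: f_def linear_scale)
  have fs: "0 < f s" using a by (simp add: f_def linorder_neq_iff) (auto simp: sgn_if)
  have f_int: "f y \<in> \<int>" if "y \<in> N" for y
    using that a by (auto simp: f_def N sgn_if)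
  let ?R = "\<lambda>y. y \<in> N \<and> (\<exists>t>0. y = t *\<^sub>R s)"
  have "?R s" using s by (auto intro: exI[of _ 1])
  then obtain x where x: "?R x" and min: "\<And>y. ?R y \<Longrightarrow> nat \<lfloor>f x\<rfloor> \<le> nat \<lfloor>f y\<rfloor>"
    using ex_has_least_nat[of ?R s "\<lambda>y. nat \<lfloor>f y\<rfloor>"] by blast
  obtain r where r: "0 < r" "x = r *\<^sub>R s" using x by blast
  have hull: "nonneg_hull {s} = nonneg_hull {x}" using r by (simp add: nonneg_hull_singleton_scale)
  have fx: "0 < f x" using r fs by (simp add: lin)
  have mult: "t \<in> \<int>" if t: "0 \<le> t" "t *\<^sub>R x \<in> N" for t
  proof (rule ccontr)
    assume "t \<notin> \<int>"
    then have fr: "0 < frac t" by (simp add: frac_gt_0_iff)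
    have eq: "t *\<^sub>R x - of_int \<lfloor>t\<rfloor> *\<^sub>R x = frac t *\<^sub>R x" by (simp add: frac_def scaleR_diff_left)
    have "frac t *\<^sub>R x \<in> N" using lattice_diff_scale[OF N' t(2), of x "\<lfloor>t\<rfloor>"] x eq by simp
    then have R: "?R (frac t *\<^sub>R x)" using fr r by (auto intro!: exI[of _ "frac t * r"])
    have "f (frac t *\<^sub>R x) < f x" using fx frac_lt_1[of t] by (simp add: lin)
    moreover have "f (frac t *\<^sub>R x) \<in> \<int>" "f x \<in> \<int>" using R x f_int by auto
    moreover have "0 < f (frac t *\<^sub>R x)" using fx fr by (simp add: lin)
    ultimately have "nat \<lfloor>f (frac t *\<^sub>R x)\<rfloor> < nat \<lfloor>f x\<rfloor>" by (auto elim!: Ints_cases)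
    with min[OF R] show False by simp
  qed
  have x0: "x \<noteq> 0" using r s by simp
  have prim: "primitive_in N x"
    unfolding primitive_in_def
  proof (intro conjI ballI allI impI x0)
    show "x \<in> N" using x by simp
    fix y k assume y: "y \<in> N" and k: "x = of_int k *\<^sub>R y"
    have k0: "k \<noteq> 0" using k x0 by auto
    \<comment> \<open>This vector is \<open>y\<close> or \<open>- y\<close>, hence a lattice point
      on the ray of \<open>x\<close>; so \<open>1 / \<bar>k\<bar>\<close> must be an
      integer.\<close>
    have "(1 / \<bar>of_int k\<bar>) *\<^sub>R x \<in> N"
    proof -
      have "(1 / \<bar>of_int k\<bar>) *\<^sub>R x = 0 *\<^sub>R y - of_int (- sgn k) *\<^sub>R y"
        using k0 unfolding k by (auto simp: sgn_if abs_if)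
      moreover have "0 *\<^sub>R y \<in> N" using lattice_diff_scale[OF N' y y, of 1] by simp
      ultimately show ?thesis using lattice_diff_scale[OF N' _ y] by metis
    qed
    then have "1 / \<bar>of_int k\<bar> \<in> (\<int> :: real set)" by (rule mult[rotated]) simp
    then obtain m where m: "1 / \<bar>of_int k\<bar> = (of_int m :: real)" by (auto elim: Ints_cases)
    then have "(1::real) = of_int (m * \<bar>k\<bar>)" using k0 by (simp add: field_simps)
    then have "m * \<bar>k\<bar> = 1" by linarith
    then show "\<bar>k\<bar> = 1" by (metis abs_abs abs_mult abs_one dvd_triv_right zdvd1_eq)
  qed
  have "y = x" if y: "y \<in> nonneg_hull {x}" "primitive_in N y" for y
  proof -
    obtain t where t: "0 \<le> t" "y = t *\<^sub>R x" using y by (auto simp: nonneg_hull_singleton)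
    have "t \<in> \<int>" using y t by (intro mult) (auto simp: primitive_in_def)
    then obtain k where k: "t = of_int k" by (auto elim: Ints_cases)
    have "\<bar>k\<bar> = 1" using y(2) x t k unfolding primitive_in_def by auto
    with t k show "y = x" by auto
  qed
  with prim hull show ?thesis by (rule that)
qed

section \<open>Complete simplicial multi-fans\<close>

text \<open>A basis of the subspace is extended to one of the whole space; the map kills the former
  part and fixes the rest. It justifies the choice in \<open>quotient_map\<close>.\<close>

lemma linear_map_with_kernel:
  fixes A :: "'a::real_vector set"
  shows "\<exists>\<pi> :: 'a \<Rightarrow> 'a. linear \<pi> \<and> {y. \<pi> y = 0} = span A"
proof -
  obtain A0 where A0: "A0 \<subseteq> span A" "independent A0" "span A \<subseteq> span A0"
    by (rule maximal_independent_subset)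
  then have sp: "span A0 = span A" by (simp add: span_minimal subset_antisym)
  obtain B where B: "A0 \<subseteq> B" "independent B" "(UNIV :: 'a set) \<subseteq> span B"
    using maximal_independent_subset_extend[OF subset_UNIV A0(2)] by metis
  obtain \<pi> where \<pi>: "linear \<pi>" "\<And>b. b \<in> B \<Longrightarrow> \<pi> b = (if b \<in> A0 then 0 else b :: 'a)"
    using linear_independent_extend[OF B(2), of "\<lambda>b. if b \<in> A0 then 0 else b"] by blast
  have lin0: "linear (\<lambda>_ :: 'a. 0 :: 'a)" by (intro linearI) simp_all
  have zero: "\<pi> y = 0" if "y \<in> span A0" for y
    by (rule linear_eq_on[OF \<pi>(1) lin0 that]) (use \<pi>(2) B(1) in auto)
  have id: "\<pi> y = y" if "y \<in> span (B - A0)" for y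
    by (rule linear_eq_on[OF \<pi>(1) linear_ident that]) (use \<pi>(2) in auto)
  have "y \<in> span A0" if "\<pi> y = 0" for y
  proof -
    have "y \<in> span (A0 \<union> (B - A0))" using B by (simp add: Un_absorb1 subset_iff)
    then obtain y1 y2 where y: "y = y1 + y2" "y1 \<in> span A0" "y2 \<in> span (B - A0)"
      unfolding span_Un by blast
    then have "\<pi> y = y2" using zero[OF y(2)] id[OF y(3)] \<pi>(1) by (simp add: linear_add)
    with that y show ?thesis by simp
  qed
  with zero sp \<pi>(1) show ?thesis by (intro exI[of _ \<pi>]) auto
qed

lemma quotient_map:
  shows "linear (quotient_map (span A))" "quotient_map (span A) y = 0 \<longleftrightarrow> y \<in> span A"
proof -
  have "linear (quotient_map (span A)) \<and> {x. quotient_map (span A) x = 0} = span A"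
    unfolding quotient_map_def by (rule someI_ex[OF linear_map_with_kernel])
  then show "linear (quotient_map (span A))" "quotient_map (span A) y = 0 \<longleftrightarrow> y \<in> span A" by auto
qed

text \<open>The images of \<open>B - A\<close> form a basis: the coordinate functionals at
  \<open>B - A\<close> vanish on the kernel, so a relation between the images forces all its
  coefficients to be zero.\<close>

lemma dim_quotient_image:
  fixes \<pi> :: "'a::real_vector \<Rightarrow> 'a"
  assumes \<pi>: "linear \<pi>" "\<And>y. \<pi> y = 0 \<longleftrightarrow> y \<in> span A"
    and B: "independent B" "finite B" "A \<subseteq> B" and X: "span X = span B"
  shows "dim (\<pi> ` X) = card B - card A"
proof -
  obtain d where d: "dual_family B (\<lambda>b. b) d" using dual_family_exists[of B "\<lambda>b. b"] B by auto
  have d_zero: "d b y = 0" if "y \<in> span A" "b \<in> B - A" for y b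
    using dual_family_span_zero[OF d B(3), of y b] that by simp
  have inj: "inj_on \<pi> (B - A)"
  proof (rule inj_onI)
    fix b b' assume b: "b \<in> B - A" "b' \<in> B - A" and "\<pi> b = \<pi> b'"
    then have "b - b' \<in> span A" using \<pi> by (simp add: linear_diff flip: \<pi>(2))
    then have "d b (b - b') = 0" using b by (intro d_zero) auto
    moreover have "d b (b - b') = 1 - (if b = b' then 1 else 0)"
      using b dual_family_linear[OF d, of b] dual_family_apply[OF d, of b] by (simp add: linear_diff)
    ultimately show "b = b'" by (simp split: if_splits)
  qed
  have "u (\<pi> b) = 0" if sum: "(\<Sum>v\<in>\<pi> ` (B - A). u v *\<^sub>R v) = 0" and b: "b \<in> B - A" for u b
  proof -
    let ?y = "\<Sum>b\<in>B - A. u (\<pi> b) *\<^sub>R b"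
    have "\<pi> ?y = (\<Sum>b\<in>B - A. u (\<pi> b) *\<^sub>R \<pi> b)"
      using \<pi>(1) by (simp add: linear_sum linear_scale)
    also have "\<dots> = 0" using sum by (simp add: sum.reindex[OF inj])
    finally have "d b ?y = 0" using b by (intro d_zero) (auto simp: \<pi>(2))
    then show ?thesis using dual_family_comb[OF d, of "B - A" b "\<lambda>b. u (\<pi> b)"] b by simp
  qed
  then have ind: "independent (\<pi> ` (B - A))" using B(2) by (auto simp: dependent_finite)
  have "span (\<pi> ` (B - A)) = span (\<pi> ` X)"
  proof -
    have "\<pi> ` B \<subseteq> span (\<pi> ` (B - A))"
    proof
      fix z assume "z \<in> \<pi> ` B"
      then obtain b where b: "b \<in> B" "z = \<pi> b" by blast
      show "z \<in> span (\<pi> ` (B - A))"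
      proof (cases "b \<in> A")
        case True
        then have "z = 0" using b \<pi>(2)[of b] by (simp add: span_base)
        then show ?thesis by (simp add: span_zero)
      qed (use b in \<open>auto intro: span_base\<close>)
    qed
    then have "span (\<pi> ` (B - A)) = span (\<pi> ` B)"
      by (intro subset_antisym span_mono span_minimal) auto
    also have "\<dots> = \<pi> ` span B" by (rule linear_span_image[OF \<pi>(1)])
    also have "\<dots> = span (\<pi> ` X)" by (simp only: X[symmetric] linear_span_image[OF \<pi>(1)])
    finally show ?thesis .
  qed
  then have "dim (\<pi> ` X) = card (\<pi> ` (B - A))" using ind by (rule dim_eq_card)
  also have "\<dots> = card B - card A" using card_image[OF inj] B by (simp add: card_Diff_subset finite_subset)
  finally show ?thesis .
qed

section \<open>The fan as a simplicial set on its rays\<close>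

locale simplicial_fan =
  fixes \<Delta> :: "('s, 'a::real_vector) multifan"
  assumes multifan: "is_multifan \<Delta>" and simplicial: "simplicial \<Delta>"
    and span_lat: "span (lat \<Delta>) = UNIV" and complete: "fan_complete \<Delta>"
begin

abbreviation "p \<equiv> prim_vec \<Delta>"
abbreviation "vs \<equiv> verts \<Delta>"
abbreviation "n \<equiv> fan_dim \<Delta>"

definition top :: "'s set" where "top = idx_dim \<Delta> n"

lemma lattice: "is_lattice (lat \<Delta>)" and finite_idx: "finite (idx \<Delta>)"
  and leq_idx: "(K, I) \<in> leq \<Delta> \<Longrightarrow> K \<in> idx \<Delta> \<and> I \<in> idx \<Delta>"
  and partial_order: "partial_order_on (idx \<Delta>) (leq \<Delta>)"
  and cone_cones: "I \<in> idx \<Delta> \<Longrightarrow> cone_of \<Delta> I \<in> cones (lat \<Delta>)"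
proof -
  note m = multifan[unfolded is_multifan_def]
  show "is_lattice (lat \<Delta>)" "finite (idx \<Delta>)" "partial_order_on (idx \<Delta>) (leq \<Delta>)"
    using m by simp_all
  show "K \<in> idx \<Delta> \<and> I \<in> idx \<Delta>" if "(K, I) \<in> leq \<Delta>"
    using subsetD[OF m[THEN conjunct2, THEN conjunct2, THEN conjunct1] that] by simp
  show "cone_of \<Delta> I \<in> cones (lat \<Delta>)" if "I \<in> idx \<Delta>"
    using subsetD[OF m[THEN conjunct2, THEN conjunct2, THEN conjunct2, THEN conjunct2, THEN conjunct1]
      imageI[OF that]] .
qed

lemma faces_bij: "J \<in> idx \<Delta> \<Longrightarrow> bij_betw (cone_of \<Delta>) {I \<in> idx \<Delta>. (I, J) \<in> leq \<Delta>}
    {\<kappa> \<in> cones (lat \<Delta>). \<kappa> face_of cone_of \<Delta> J}"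
  and leq_iff_face: "(I, J) \<in> leq \<Delta> \<Longrightarrow> (I', J) \<in> leq \<Delta> \<Longrightarrow>
    (I, I') \<in> leq \<Delta> \<longleftrightarrow> cone_of \<Delta> I face_of cone_of \<Delta> I'"
proof -
  have m: "\<forall>J\<in>idx \<Delta>.
        bij_betw (cone_of \<Delta>) {I \<in> idx \<Delta>. (I, J) \<in> leq \<Delta>}
          {\<kappa> \<in> cones (lat \<Delta>). \<kappa> face_of cone_of \<Delta> J} \<and>
        (\<forall>I I'. (I, J) \<in> leq \<Delta> \<and> (I', J) \<in> leq \<Delta> \<longrightarrow>
           ((I, I') \<in> leq \<Delta> \<longleftrightarrow> cone_of \<Delta> I face_of cone_of \<Delta> I'))"
    using multifan unfolding is_multifan_def by (elim conjE)
  show "J \<in> idx \<Delta> \<Longrightarrow> bij_betw (cone_of \<Delta>) {I \<in> idx \<Delta>. (I, J) \<in> leq \<Delta>}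
    {\<kappa> \<in> cones (lat \<Delta>). \<kappa> face_of cone_of \<Delta> J}"
    by (rule bspec[OF m, THEN conjunct1])
  assume a: "(I, J) \<in> leq \<Delta>" "(I', J) \<in> leq \<Delta>"
  then have J: "J \<in> idx \<Delta>" using leq_idx by blast
  show "(I, I') \<in> leq \<Delta> \<longleftrightarrow> cone_of \<Delta> I face_of cone_of \<Delta> I'"
    by (rule bspec[OF m J, THEN conjunct2, THEN spec, THEN spec, THEN mp, OF conjI[OF a]])
qed

lemma leq_refl: "I \<in> idx \<Delta> \<Longrightarrow> (I, I) \<in> leq \<Delta>"
  using partial_order by (simp add: partial_order_on_def preorder_on_def refl_on_def)

lemma leq_trans: "(I, J) \<in> leq \<Delta> \<Longrightarrow> (J, K) \<in> leq \<Delta> \<Longrightarrow> (I, K) \<in> leq \<Delta>"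
  using partial_order by (auto simp: partial_order_on_def preorder_on_def elim: transE)

lemma leq_face: "(I, J) \<in> leq \<Delta> \<Longrightarrow> cone_of \<Delta> I face_of cone_of \<Delta> J"
  using leq_iff_face[of I J J] leq_refl leq_idx by blast

lemma cone_of_inj: "(I, J) \<in> leq \<Delta> \<Longrightarrow> (I', J) \<in> leq \<Delta> \<Longrightarrow> cone_of \<Delta> I = cone_of \<Delta> I' \<Longrightarrow> I = I'"
  using faces_bij[of J] leq_idx unfolding bij_betw_def inj_on_def by blast

lemma face_in_fan:
  assumes "J \<in> idx \<Delta>" "\<kappa> \<in> cones (lat \<Delta>)" "\<kappa> face_of cone_of \<Delta> J"
  obtains I where "(I, J) \<in> leq \<Delta>" "cone_of \<Delta> I = \<kappa>"
proof -
  have "\<kappa> \<in> cone_of \<Delta> ` {I \<in> idx \<Delta>. (I, J) \<in> leq \<Delta>}"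
    unfolding bij_betw_imp_surj_on[OF faces_bij[OF assms(1)]] using assms(2,3) by simp
  then show ?thesis using that by blast
qed

lemma finite_vs: "finite (vs I)"
  using finite_idx by (auto simp: verts_def idx_dim_def intro: finite_subset)

lemma prim_vec:
  assumes "i \<in> idx_dim \<Delta> 1"
  shows "p i \<in> lat \<Delta>" "p i \<noteq> 0" "cone_of \<Delta> i = nonneg_hull {p i}"
proof -
  have i: "i \<in> idx \<Delta>" "dim (cone_of \<Delta> i) = 1" using assms by (auto simp: idx_dim_def)
  obtain s where s: "s \<in> lat \<Delta>" "s \<noteq> 0" "cone_of \<Delta> i = nonneg_hull {s}"
    using cone_dim_one_ray[OF cone_cones[OF i(1)] i(2)] .
  obtain y where y: "primitive_in (lat \<Delta>) y" "nonneg_hull {s} = nonneg_hull {y}"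
    "\<And>z. z \<in> nonneg_hull {y} \<Longrightarrow> primitive_in (lat \<Delta>) z \<Longrightarrow> z = y"
    using ray_primitive_generator[OF lattice s(1,2)] by blast
  have "p i = y"
    unfolding prim_vec_def s(3) y(2)
    by (rule the_equality) (use y in \<open>auto simp: nonneg_hull_generator\<close>)
  with y s show "p i \<in> lat \<Delta>" "p i \<noteq> 0" "cone_of \<Delta> i = nonneg_hull {p i}"
    by (auto simp: primitive_in_def)
qed

lemma vs_ray: "i \<in> vs I \<Longrightarrow> i \<in> idx_dim \<Delta> 1" "i \<in> vs I \<Longrightarrow> (i, I) \<in> leq \<Delta>"
  by (auto simp: verts_def)

lemma pointed_subset_cone:
  assumes "I \<in> idx \<Delta>" "finite S" "S \<subseteq> lat \<Delta>" "nonneg_hull S \<subseteq> cone_of \<Delta> I"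
  shows "nonneg_hull S \<in> cones (lat \<Delta>)"
proof -
  have "x = 0" if "x \<in> nonneg_hull S" "- x \<in> nonneg_hull S" for x
    using cone_cones[OF assms(1)] that assms(4) unfolding cones_def by blast
  then show ?thesis using assms(2,3) unfolding cones_def by blast
qed

text \<open>The generators given by simpliciality need not be lattice vectors, so they are first matched
  with the rays of the fan.\<close>

lemma verts_dual_family:
  assumes I: "I \<in> idx \<Delta>"
  shows "\<exists>d. dual_family (vs I) p d" "cone_of \<Delta> I = nonneg_hull (p ` vs I)"
proof -
  obtain S where S: "finite S" "independent S" "cone_of \<Delta> I = nonneg_hull S"
    using simplicial I unfolding simplicial_def by blast
  obtain e where e: "dual_family S (\<lambda>s. s) e" using dual_family_exists[of S "\<lambda>s. s"] S by auto
  have S0: "s \<noteq> 0" if "s \<in> S" for s using S(2) that dependent_zero by blast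
  obtain S' where S': "finite S'" "S' \<subseteq> lat \<Delta>" "cone_of \<Delta> I = nonneg_hull S'"
    using cone_cones[OF I] by (auto simp: cones_def)
  \<comment> \<open>The ray of \<open>s\<close> is rational: \<open>s\<close> is a nonnegative
    combination of lattice vectors in \<open>S'\<close>, and since its ray is a face, some nonzero
    summand lies on it. The ray is therefore a face in the fan.\<close>
  have A: "\<exists>i\<in>vs I. cone_of \<Delta> i = nonneg_hull {s}" if s: "s \<in> S" for s
  proof -
    have face: "nonneg_hull {s} face_of nonneg_hull S"
      using simplicial_face[OF e, of "{s}"] s by simp
    have "s \<in> nonneg_hull S'" using S S' s by (metis nonneg_hull_generator)
    then obtain a where a: "\<forall>t\<in>S'. 0 \<le> a t" "s = (\<Sum>t\<in>S'. a t *\<^sub>R t)" by (auto simp: nonneg_hull_def)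
    have "\<exists>t\<in>S'. a t *\<^sub>R t \<noteq> 0"
    proof (rule ccontr)
      assume "\<not> ?thesis"
      then have "(\<Sum>t\<in>S'. a t *\<^sub>R t) = 0" by (intro sum.neutral) simp
      with a(2) S0[OF s] show False by simp
    qed
    then obtain t where t: "t \<in> S'" "a t *\<^sub>R t \<noteq> 0" by blast
    have "a t *\<^sub>R t \<in> nonneg_hull {s}"
    proof (rule face_of_cone_summand[OF face S'(1) _ _ t(1)])
      show "a t' *\<^sub>R t' \<in> nonneg_hull S" if "t' \<in> S'" for t'
      proof -
        have "t' \<in> nonneg_hull S" using nonneg_hull_generator[OF S'(1) that] S'(3) S(3) by simp
        then show ?thesis by (rule nonneg_hull_scale) (use a(1) that in blast)
      qed
      show "(\<Sum>t\<in>S'. a t *\<^sub>R t) \<in> nonneg_hull {s}"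
        unfolding a(2)[symmetric] by (simp add: nonneg_hull_generator)
    qed
    then obtain r where r: "0 \<le> r" "a t *\<^sub>R t = r *\<^sub>R s" by (auto simp: nonneg_hull_singleton)
    have pos: "0 < a t" "0 < r" using t r a(1) by (auto simp: less_le)
    have "t = (1 / a t) *\<^sub>R (a t *\<^sub>R t)" using pos by simp
    also have "\<dots> = (r / a t) *\<^sub>R s" using r by simp
    finally have hull: "nonneg_hull {t} = nonneg_hull {s}"
      using nonneg_hull_singleton_scale[of "r / a t" s] pos by simp
    have "nonneg_hull {t} \<in> cones (lat \<Delta>)"
    proof (rule pointed_subset_cone[OF I])
      show "nonneg_hull {t} \<subseteq> cone_of \<Delta> I"
        using face by (auto simp: hull S(3) dest: face_of_imp_subset)
    qed (use t S' in auto)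
    then obtain i where i: "(i, I) \<in> leq \<Delta>" "cone_of \<Delta> i = nonneg_hull {s}"
      using face_in_fan[OF I, of "nonneg_hull {s}"] face unfolding hull S(3) by blast
    have "dim (cone_of \<Delta> i) = card {s}"
      using i S0[OF s] by (intro dim_eq_card) (simp_all add: span_nonneg_hull)
    with i leq_idx show ?thesis by (intro bexI[of _ i]) (auto simp: verts_def idx_dim_def)
  qed
  \<comment> \<open>Conversely a ray of the fan below \<open>I\<close> is a face, hence spanned by
    those \<open>s\<close> that it contains; as it is not zero, there is at least one.\<close>
  have B: "\<exists>s\<in>S. \<exists>r>0. p i = r *\<^sub>R s" if i: "i \<in> vs I" for i
  proof -
    have "nonneg_hull {p i} face_of nonneg_hull ((\<lambda>s. s) ` S)"
      using leq_face[OF vs_ray(2)[OF i]] prim_vec(3)[OF vs_ray(1)[OF i]] S(3) by simp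
    from cone_face_of_simplicial[OF e this]
    have hull: "nonneg_hull {p i} = nonneg_hull {s \<in> S. s \<in> nonneg_hull {p i}}" by simp
    have "{s \<in> S. s \<in> nonneg_hull {p i}} \<noteq> {}"
    proof
      assume "{s \<in> S. s \<in> nonneg_hull {p i}} = {}"
      then have "nonneg_hull {p i} = nonneg_hull {}" using hull by (simp only:)
      moreover have "p i \<in> nonneg_hull {p i}" by (rule nonneg_hull_generator) auto
      ultimately have "p i \<in> nonneg_hull {}" by (simp only:)
      then show False using prim_vec(2)[OF vs_ray(1)[OF i]] by (simp add: nonneg_hull_def)
    qed
    then obtain s t where s: "s \<in> S" "0 \<le> t" "s = t *\<^sub>R p i" by (auto simp: nonneg_hull_singleton)
    have t: "0 < t" using s S0[OF s(1)] by (auto simp: less_le)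
    have "p i = (1 / t) *\<^sub>R s" using t unfolding s(3) by simp
    then show ?thesis using t s(1) by (intro bexI[of _ s] exI[of _ "1 / t"]) auto
  qed
  obtain \<sigma> where "\<forall>i\<in>vs I. \<sigma> i \<in> S \<and> (\<exists>r>0. p i = r *\<^sub>R \<sigma> i)"
    using bchoice[of "vs I" "\<lambda>i s. s \<in> S \<and> (\<exists>r>0. p i = r *\<^sub>R s)"] B by blast
  then have \<sigma>: "\<forall>i\<in>vs I. \<exists>r>0. p i = r *\<^sub>R \<sigma> i" "\<And>i. i \<in> vs I \<Longrightarrow> \<sigma> i \<in> S" by auto
  obtain r where "\<forall>i\<in>vs I. 0 < r i \<and> p i = r i *\<^sub>R \<sigma> i" using bchoice[OF \<sigma>(1)] by blast
  then have r: "\<And>i. i \<in> vs I \<Longrightarrow> 0 < r i" "\<And>i. i \<in> vs I \<Longrightarrow> p i = r i *\<^sub>R \<sigma> i" by auto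
  have cone: "cone_of \<Delta> i = nonneg_hull {\<sigma> i}" if "i \<in> vs I" for i
    using prim_vec(3)[OF vs_ray(1)[OF that]] r(1)[OF that] r(2)[OF that]
    by (simp add: nonneg_hull_singleton_scale)
  have inj: "\<sigma> i = \<sigma> j \<longleftrightarrow> i = j" if "i \<in> vs I" "j \<in> vs I" for i j
    using cone_of_inj[of i I j] cone[OF that(1)] cone[OF that(2)] vs_ray(2) that by auto
  \<comment> \<open>Since \<open>p i\<close> is \<open>r i\<close> times a generator in
    \<open>S\<close>, its coordinate functional is that of the generator divided by
    \<open>r i\<close>.\<close>
  have "dual_family (vs I) p (\<lambda>i y. e (\<sigma> i) y / r i)"
    unfolding dual_family_def
  proof (intro conjI ballI finite_vs)
    fix i assume i: "i \<in> vs I"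
    have le: "linear (e (\<sigma> i))" using dual_family_linear[OF e \<sigma>(2)[OF i]] .
    then show "linear (\<lambda>y. e (\<sigma> i) y / r i)"
      by (intro linearI) (simp_all add: linear_add linear_scale add_divide_distrib)
    fix j assume j: "j \<in> vs I"
    have "e (\<sigma> i) (p j) = r j * (if i = j then 1 else 0)"
      using le r(2)[OF j] dual_family_apply[OF e \<sigma>(2)[OF i] \<sigma>(2)[OF j]] inj[OF i j]
      by (simp add: linear_scale)
    then show "e (\<sigma> i) (p j) / r i = (if i = j then 1 else 0)" using r(1)[OF i] by auto
  qed
  then show "\<exists>d. dual_family (vs I) p d" by blast
  have fin: "finite (p ` vs I)" using finite_vs by simp
  have "p i \<in> nonneg_hull S" if "i \<in> vs I" for i
    unfolding r(2)[OF that]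
    by (rule nonneg_hull_scale[OF nonneg_hull_generator[OF S(1) \<sigma>(2)[OF that]]])
      (use r(1)[OF that] in simp)
  moreover have "s \<in> nonneg_hull (p ` vs I)" if s: "s \<in> S" for s
  proof -
    obtain i where i: "i \<in> vs I" "cone_of \<Delta> i = nonneg_hull {s}" using A[OF s] by blast
    have "s \<in> nonneg_hull {p i}"
      using prim_vec(3)[OF vs_ray(1)[OF i(1)]] i(2) by (auto simp: nonneg_hull_generator)
    also have "nonneg_hull {p i} \<subseteq> nonneg_hull (p ` vs I)"
      using i fin by (intro nonneg_hull_subset) (auto intro: nonneg_hull_generator)
    finally show ?thesis .
  qed
  ultimately show "cone_of \<Delta> I = nonneg_hull (p ` vs I)"
    unfolding S(3) by (intro subset_antisym nonneg_hull_subset) auto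
qed

lemma span_cone: "I \<in> idx \<Delta> \<Longrightarrow> span (cone_of \<Delta> I) = span (p ` vs I)"
  using verts_dual_family(2) finite_vs by (simp add: span_nonneg_hull)

lemma inj_p: "I \<in> idx \<Delta> \<Longrightarrow> inj_on p (vs I)" and independent_p: "I \<in> idx \<Delta> \<Longrightarrow> independent (p ` vs I)"
  using verts_dual_family(1) dual_family_inj dual_family_independent by blast+

lemma dim_cone: "I \<in> idx \<Delta> \<Longrightarrow> dim (cone_of \<Delta> I) = card (vs I)"
  using dim_eq_card[OF span_cone[symmetric] independent_p] card_image[OF inj_p] by simp

lemma vs_mono: "(K, I) \<in> leq \<Delta> \<Longrightarrow> vs K \<subseteq> vs I"
  by (auto simp: verts_def intro: leq_trans)

text \<open>The indices below \<open>I\<close> form the Boolean lattice of subsets of its rays,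
  which is what allows products over \<open>vs I\<close> to be expanded over faces. For
  surjectivity, any subset of the rays spans a face of the cone, and the fan axioms supply its
  index.\<close>

lemma vs_bij:
  assumes I: "I \<in> idx \<Delta>"
  shows "bij_betw vs {K \<in> idx \<Delta>. (K, I) \<in> leq \<Delta>} (Pow (vs I))"
proof (rule bij_betwI')
  fix K K' assume K: "K \<in> {K \<in> idx \<Delta>. (K, I) \<in> leq \<Delta>}" "K' \<in> {K \<in> idx \<Delta>. (K, I) \<in> leq \<Delta>}"
  then show "vs K = vs K' \<longleftrightarrow> K = K'"
    using verts_dual_family(2)[of K] verts_dual_family(2)[of K'] cone_of_inj[of K I K'] by auto
next
  fix K assume "K \<in> {K \<in> idx \<Delta>. (K, I) \<in> leq \<Delta>}"
  then show "vs K \<in> Pow (vs I)" using vs_mono by blast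
next
  fix W assume "W \<in> Pow (vs I)"
  then have W: "W \<subseteq> vs I" by simp
  obtain d where d: "dual_family (vs I) p d" using verts_dual_family(1)[OF I] by blast
  have finW: "finite W" using finite_vs W finite_subset by blast
  have face: "nonneg_hull (p ` W) face_of cone_of \<Delta> I"
    unfolding verts_dual_family(2)[OF I] by (rule simplicial_face[OF d W])
  have "nonneg_hull (p ` W) \<in> cones (lat \<Delta>)"
  proof (rule pointed_subset_cone[OF I])
    show "p ` W \<subseteq> lat \<Delta>" using W prim_vec(1) vs_ray(1) by blast
  qed (use finW face_of_imp_subset[OF face] in auto)
  then obtain K where K: "(K, I) \<in> leq \<Delta>" "cone_of \<Delta> K = nonneg_hull (p ` W)"
    using face_in_fan[OF I _ face] by blast
  have "vs K = W"
  proof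
    show "vs K \<subseteq> W"
    proof
      fix i assume i: "i \<in> vs K"
      then have iI: "i \<in> vs I" using vs_mono[OF K(1)] by blast
      have "p i \<in> cone_of \<Delta> K"
        using verts_dual_family(2)[of K] leq_idx[OF K(1)] i finite_vs by (auto intro: nonneg_hull_generator)
      then have "p i \<in> span (p ` W)" using nonneg_hull_subset_span[of "p ` W"] K(2) by auto
      then have "d i (p i) = 0" if "i \<notin> W" using dual_family_span_zero[OF d W] iI that by blast
      then show "i \<in> W" using dual_family_apply[OF d iI iI] by auto
    qed
    show "W \<subseteq> vs K"
    proof
      fix i assume i: "i \<in> W"
      have "cone_of \<Delta> i face_of cone_of \<Delta> K"
        using simplicial_face[OF dual_family_subset[OF d W], of "{i}"] i W K(2)
          prim_vec(3)[OF vs_ray(1), of i I] by auto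
      then have "(i, K) \<in> leq \<Delta>" using leq_iff_face[of i I K] K(1) vs_ray(2) i W by blast
      then show "i \<in> vs K" using vs_ray(1)[of i I] i W by (auto simp: verts_def)
    qed
  qed
  then show "\<exists>K\<in>{K \<in> idx \<Delta>. (K, I) \<in> leq \<Delta>}. W = vs K" using K leq_idx by blast
qed

text \<open>The type is an arbitrary real vector space; that it has finite dimension
  \<open>n\<close> comes from the lattice spanning it.\<close>

lemma extend_to_basis:
  fixes A :: "'a set"
  assumes "independent A"
  obtains B where "A \<subseteq> B" "independent B" "finite B" "card B = n" "span B = UNIV"
proof -
  obtain B where B: "A \<subseteq> B" "independent B" "UNIV \<subseteq> span B"
    using maximal_independent_subset_extend[OF subset_UNIV assms] by metis
  obtain E e where e: "dual_family E (\<lambda>a. a) e" and N: "lat \<Delta> = {y \<in> span E. \<forall>a\<in>E. e a y \<in> \<int>}"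
    using is_lattice_coords[OF lattice] .
  have "finite E" "span E = UNIV" using e lattice_span(2)[OF e N] span_lat by (auto simp: dual_family_def)
  then have "finite B" using real_vector.independent_span_bound[of E B] B(2) by simp
  moreover have "n = card B"
    unfolding fan_dim_def by (rule dim_eq_card[OF _ B(2)]) (use B(3) span_lat in auto)
  ultimately show ?thesis using B by (intro that[of B]) auto
qed

lemma card_vs_le: "I \<in> idx \<Delta> \<Longrightarrow> card (vs I) \<le> n"
proof -
  assume I: "I \<in> idx \<Delta>"
  obtain B where "p ` vs I \<subseteq> B" "independent B" "finite B" "card B = n" "span B = UNIV"
    by (rule extend_to_basis[OF independent_p[OF I]])
  then show ?thesis using card_mono[of B "p ` vs I"] card_image[OF inj_p[OF I]] by simp
qed

lemma top_idx: "I \<in> top \<Longrightarrow> I \<in> idx \<Delta>" and card_vs_top: "I \<in> top \<Longrightarrow> card (vs I) = n"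
  using dim_cone by (auto simp: top_def idx_dim_def)

lemma top_iff: "I \<in> top \<longleftrightarrow> I \<in> idx \<Delta> \<and> card (vs I) = n"
  using dim_cone by (auto simp: top_def idx_dim_def)

lemma finite_top: "finite top"
  using finite_idx by (simp add: top_def idx_dim_def)

lemma span_p_top:
  assumes "I \<in> top"
  shows "span (p ` vs I) = UNIV"
proof -
  obtain B where B: "p ` vs I \<subseteq> B" "independent B" "finite B" "card B = n" "span B = UNIV"
    by (rule extend_to_basis[OF independent_p[OF top_idx[OF assms]]])
  have "card (p ` vs I) = n" using card_image[OF inj_p] top_idx card_vs_top assms by simp
  then have "p ` vs I = B" using B by (intro card_subset_eq) auto
  then show ?thesis using B by simp
qed

text \<open>Makes the definite descriptions \<open>vertex\<close> and \<open>dual_vec\<close>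
  meaningful; both prescribe the values of a functional on the generators of a top-dimensional
  cone.\<close>

lemma ex1_linear_top:
  fixes f :: "'s \<Rightarrow> real"
  assumes "I \<in> top"
  shows "\<exists>!u. linear u \<and> (\<forall>j\<in>vs I. u (p j) = f j)"
proof (rule ex_ex1I)
  obtain d where d: "dual_family (vs I) p d" using verts_dual_family(1)[OF top_idx[OF assms]] by blast
  have "linear (\<lambda>y. \<Sum>i\<in>vs I. f i * d i y)"
    using dual_family_linear[OF d] by (intro linearI) (simp_all add: linear_add linear_scale
      distrib_left sum.distrib sum_distrib_left mult.left_commute)
  moreover have "(\<Sum>i\<in>vs I. f i * d i (p j)) = f j" if "j \<in> vs I" for j
  proof -
    have "(\<Sum>i\<in>vs I. f i * d i (p j)) = (\<Sum>i\<in>vs I. if i = j then f j else 0)"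
      using dual_family_apply[OF d _ that] by (intro sum.cong) auto
    then show ?thesis using finite_vs that by (simp add: sum.delta)
  qed
  ultimately show "\<exists>u. linear u \<and> (\<forall>j\<in>vs I. u (p j) = f j)" by blast
  fix u u' assume u: "linear u \<and> (\<forall>j\<in>vs I. u (p j) = f j)" "linear u' \<and> (\<forall>j\<in>vs I. u' (p j) = f j)"
  show "u = u'"
  proof
    fix y
    show "u y = u' y" by (rule linear_eq_on[of u u' y "p ` vs I"]) (use u span_p_top[OF assms] in auto)
  qed
qed

lemma dual_vec_family: "I \<in> top \<Longrightarrow> dual_family (vs I) p (dual_vec \<Delta> I)"
proof -
  assume I: "I \<in> top"
  have "linear (dual_vec \<Delta> I i) \<and> (\<forall>j\<in>vs I. dual_vec \<Delta> I i (p j) = (if j = i then 1 else 0))" for i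
    unfolding dual_vec_def by (rule theI'[OF ex1_linear_top[OF I]])
  then show ?thesis using finite_vs by (auto simp: dual_family_def)
qed

lemma dual_vec_expand:
  assumes I: "I \<in> top" and u: "linear u"
  shows "u y = (\<Sum>i\<in>vs I. u (p i) * dual_vec \<Delta> I i y)"
proof -
  have "u y = u (\<Sum>i\<in>vs I. dual_vec \<Delta> I i y *\<^sub>R p i)"
    using dual_family_expand[OF dual_vec_family[OF I] subset_refl, of y] span_p_top[OF I] by simp
  then show ?thesis using u by (simp add: linear_sum linear_scale mult.commute)
qed

text \<open>A vanishing coordinate would place \<open>v\<close> in the span of the facet opposite to
  \<open>i\<close>, which belongs to the fan and has dimension below \<open>n\<close>.\<close>

lemma generic_dual_vec_nonzero:
  assumes v: "generic \<Delta> v" and I: "I \<in> top" and i: "i \<in> vs I"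
  shows "dual_vec \<Delta> I i v \<noteq> 0"
proof
  assume zero: "dual_vec \<Delta> I i v = 0"
  obtain K where K: "K \<in> idx \<Delta>" "vs K = vs I - {i}"
  proof -
    have "vs I - {i} \<in> vs ` {K \<in> idx \<Delta>. (K, I) \<in> leq \<Delta>}"
      unfolding bij_betw_imp_surj_on[OF vs_bij[OF top_idx[OF I]]] by blast
    then show ?thesis using that by auto
  qed
  have "v \<in> span (p ` (vs I - {i}))"
    using dual_family_span_iff[OF dual_vec_family[OF I], of "vs I - {i}" v] zero i span_p_top[OF I] by auto
  then have "v \<in> span (cone_of \<Delta> K)" using span_cone[OF K(1)] K(2) by simp
  moreover have "dim (cone_of \<Delta> K) < n"
    using dim_cone[OF K(1)] K(2) i finite_vs[of I] card_vs_top[OF I] by (metis card_Diff1_less)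
  ultimately show False using v K(1) unfolding generic_def by blast
qed

text \<open>For \<open>K \<le> I\<close>, \<open>h\<close> lies in the cone of \<open>I\<close> modulo the span of the cone of \<open>K\<close> iff all its
  coordinates at \<open>i \<in> I - K\<close> are nonnegative.\<close>

lemma projected_cone_iff:
  assumes I: "I \<in> top" and K: "(K, I) \<in> leq \<Delta>"
  shows "quotient_map (span (cone_of \<Delta> K)) h \<in> quotient_map (span (cone_of \<Delta> K)) ` cone_of \<Delta> I
    \<longleftrightarrow> (\<forall>i\<in>vs I - vs K. 0 \<le> dual_vec \<Delta> I i h)"
proof -
  let ?\<pi> = "quotient_map (span (cone_of \<Delta> K))" and ?d = "dual_vec \<Delta> I"
  note \<pi> = quotient_map[of "cone_of \<Delta> K"]
  note df = dual_vec_family[OF I]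
  have KI: "vs K \<subseteq> vs I" by (rule vs_mono[OF K])
  have Kidx: "K \<in> idx \<Delta>" using leq_idx[OF K] by blast
  have cone: "y \<in> cone_of \<Delta> I \<longleftrightarrow> (\<forall>i\<in>vs I. 0 \<le> ?d i y)" for y
    using dual_family_nonneg_hull_iff[OF df subset_refl, of y] span_p_top[OF I]
      verts_dual_family(2)[OF top_idx[OF I]] by simp
  have ker: "y \<in> span (cone_of \<Delta> K) \<longleftrightarrow> (\<forall>i\<in>vs I - vs K. ?d i y = 0)" for y
    using dual_family_span_iff[OF df KI, of y] span_p_top[OF I] span_cone[OF Kidx] by simp
  have diff: "?d i (y - z) = ?d i y - ?d i z" if "i \<in> vs I" for i y z
    using dual_family_linear[OF df that] by (simp add: linear_diff)
  show ?thesis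
  proof
    assume "?\<pi> h \<in> ?\<pi> ` cone_of \<Delta> I"
    then obtain y where y: "y \<in> cone_of \<Delta> I" "?\<pi> h = ?\<pi> y" by blast
    then have "h - y \<in> span (cone_of \<Delta> K)" using \<pi>(1) by (simp add: linear_diff flip: \<pi>(2))
    then show "\<forall>i\<in>vs I - vs K. 0 \<le> ?d i h" using y(1) ker[of "h - y"] cone[of y] diff by auto
  next
    assume h: "\<forall>i\<in>vs I - vs K. 0 \<le> ?d i h"
    \<comment> \<open>This is \<open>h\<close> with its coordinates at the rays of \<open>K\<close>
      set to zero, a change within the kernel.\<close>
    let ?y = "\<Sum>i\<in>vs I - vs K. ?d i h *\<^sub>R p i"
    have dy: "?d i ?y = (if i \<in> vs K then 0 else ?d i h)" if "i \<in> vs I" for i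
      using dual_family_comb[OF df, of "vs I - vs K" i "\<lambda>i. ?d i h"] that by simp
    have "h - ?y \<in> span (cone_of \<Delta> K)" using dy diff by (auto simp: ker)
    then have "?\<pi> h = ?\<pi> ?y" using \<pi>(1) by (simp add: linear_diff flip: \<pi>(2))
    moreover have "?y \<in> cone_of \<Delta> I" using h dy by (auto simp: cone)
    ultimately show "?\<pi> h \<in> ?\<pi> ` cone_of \<Delta> I" by blast
  qed
qed

section \<open>Degrees of projected multi-fans\<close>

context
  fixes K assumes K: "K \<in> idx \<Delta>"
begin

abbreviation (input) "\<pi> \<equiv> quotient_map (span (cone_of \<Delta> K))"

lemma projected_simps:
  "lat (projected \<Delta> K) = \<pi> ` lat \<Delta>" "idx (projected \<Delta> K) = {J \<in> idx \<Delta>. (K, J) \<in> leq \<Delta>}"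
  "cone_of (projected \<Delta> K) J = \<pi> ` cone_of \<Delta> J" "weight (projected \<Delta> K) = weight \<Delta>"
  by (simp_all add: projected_def Let_def weight_def fun_eq_iff)

lemma dim_projected_image:
  assumes "independent B" "finite B" "p ` vs K \<subseteq> B" "span X = span B"
  shows "dim (\<pi> ` X) = card B - card (vs K)"
proof -
  have "dim (\<pi> ` X) = card B - card (p ` vs K)"
    by (rule dim_quotient_image[OF quotient_map(1) _ assms]) (simp only: quotient_map(2) span_cone[OF K])
  then show ?thesis using card_image[OF inj_p[OF K]] by simp
qed

lemma fan_dim_projected: "fan_dim (projected \<Delta> K) = n - card (vs K)"
proof -
  obtain B where "p ` vs K \<subseteq> B" "independent B" "finite B" "card B = n" "span B = UNIV"
    by (rule extend_to_basis[OF independent_p[OF K]])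
  then show ?thesis unfolding fan_dim_def[of "projected \<Delta> K"] projected_simps
    using span_lat by (subst dim_projected_image[of B]) auto
qed

lemma dim_projected_cone:
  assumes "(K, J) \<in> leq \<Delta>"
  shows "dim (\<pi> ` cone_of \<Delta> J) = card (vs J) - card (vs K)"
proof -
  have J: "J \<in> idx \<Delta>" using leq_idx[OF assms] by blast
  have "dim (\<pi> ` cone_of \<Delta> J) = card (p ` vs J) - card (vs K)"
    by (rule dim_projected_image)
      (use J independent_p finite_vs vs_mono[OF assms] span_cone in auto)
  then show ?thesis using card_image[OF inj_p[OF J]] by simp
qed

lemma projected_top: "idx_dim (projected \<Delta> K) (fan_dim (projected \<Delta> K)) = {J \<in> top. (K, J) \<in> leq \<Delta>}"
proof -
  \<comment> \<open>Truncated subtraction loses nothing here, since \<open>card (vs K)\<close> is at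
    most both \<open>card (vs J)\<close> and \<open>n\<close>.\<close>
  have "card (vs J) - card (vs K) = n - card (vs K) \<longleftrightarrow> card (vs J) = n" if J: "(K, J) \<in> leq \<Delta>" for J
    using card_mono[OF finite_vs vs_mono[OF J]] card_vs_le[OF K] by linarith
  then show ?thesis
    unfolding idx_dim_def fan_dim_projected projected_simps
    using dim_projected_cone by (auto simp: top_iff)
qed

text \<open>For \<open>J\<close> above \<open>K\<close> the kernel is contained in the span of the
  cone of \<open>J\<close>, so membership modulo the kernel lifts to membership of \<open>v\<close>
  itself.\<close>

lemma generic_projected:
  assumes v: "generic \<Delta> v"
  shows "generic (projected \<Delta> K) (\<pi> v)"
  unfolding generic_def projected_simps fan_dim_projected
proof (intro conjI ballI impI)
  note \<pi> = quotient_map[of "cone_of \<Delta> K"]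
  show "\<pi> v \<in> span (\<pi> ` lat \<Delta>)" by (simp add: linear_span_image[OF \<pi>(1)] span_lat)
  fix J assume J: "J \<in> {J \<in> idx \<Delta>. (K, J) \<in> leq \<Delta>}" and "dim (\<pi> ` cone_of \<Delta> J) < n - card (vs K)"
  then have lt: "dim (cone_of \<Delta> J) < n" using dim_projected_cone[of J] dim_cone[of J] by auto
  show "\<pi> v \<notin> span (\<pi> ` cone_of \<Delta> J)"
  proof
    assume "\<pi> v \<in> span (\<pi> ` cone_of \<Delta> J)"
    then obtain y where y: "y \<in> span (cone_of \<Delta> J)" "\<pi> v = \<pi> y"
      by (auto simp: linear_span_image[OF \<pi>(1)])
    have "v - y \<in> span (cone_of \<Delta> K)" using y(2) \<pi>(1) by (simp add: linear_diff flip: \<pi>(2))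
    moreover have "span (cone_of \<Delta> K) \<subseteq> span (cone_of \<Delta> J)"
      using J leq_face by (intro span_mono face_of_imp_subset) auto
    ultimately have "(v - y) + y \<in> span (cone_of \<Delta> J)" using y(1) by (blast intro: span_add)
    then show False using v lt J unfolding generic_def by auto
  qed
qed

lemma deg_at_projected_eq:
  assumes "generic \<Delta> h" "generic \<Delta> h'"
  shows "deg_at (projected \<Delta> K) (\<pi> h) = deg_at (projected \<Delta> K) (\<pi> h')"
  using complete K generic_projected[OF assms(1)] generic_projected[OF assms(2)]
  unfolding fan_complete_def pre_complete_def by metis

lemma deg_at_projected:
  assumes h: "generic \<Delta> h"
  shows "deg_at (projected \<Delta> K) (\<pi> h)
    = (\<Sum>I | I \<in> top \<and> (K, I) \<in> leq \<Delta>. weight \<Delta> I * (\<Prod>i\<in>vs I - vs K. of_bool (dual_vec \<Delta> I i h > 0)))"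
proof -
  have "deg_at (projected \<Delta> K) (\<pi> h)
      = (\<Sum>I | I \<in> {I \<in> top. (K, I) \<in> leq \<Delta>} \<and> \<pi> h \<in> \<pi> ` cone_of \<Delta> I. weight \<Delta> I)"
    unfolding deg_at_def projected_top projected_simps ..
  also have "\<dots> = (\<Sum>I | I \<in> top \<and> (K, I) \<in> leq \<Delta>. if \<pi> h \<in> \<pi> ` cone_of \<Delta> I then weight \<Delta> I else 0)"
    using finite_top by (subst sum.inter_filter[symmetric]) (auto intro!: sum.cong)
  also have "\<dots> = (\<Sum>I | I \<in> top \<and> (K, I) \<in> leq \<Delta>. weight \<Delta> I * (\<Prod>i\<in>vs I - vs K. of_bool (dual_vec \<Delta> I i h > 0)))"
  proof (rule sum.cong[OF refl])
    fix I assume "I \<in> {I. I \<in> top \<and> (K, I) \<in> leq \<Delta>}"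
    then have I: "I \<in> top" "(K, I) \<in> leq \<Delta>" by auto
    have "0 \<le> dual_vec \<Delta> I i h \<longleftrightarrow> 0 < dual_vec \<Delta> I i h" if "i \<in> vs I - vs K" for i
      using generic_dual_vec_nonzero[OF h I(1), of i] that by auto
    then have "(\<Prod>i\<in>vs I - vs K. of_bool (dual_vec \<Delta> I i h > 0)) = (of_bool (\<pi> h \<in> \<pi> ` cone_of \<Delta> I) :: int)"
      unfolding projected_cone_iff[OF I] using finite_vs by (auto simp: prod_zero_iff intro!: prod.neutral)
    then show "(if \<pi> h \<in> \<pi> ` cone_of \<Delta> I then weight \<Delta> I else 0)
        = weight \<Delta> I * (\<Prod>i\<in>vs I - vs K. of_bool (dual_vec \<Delta> I i h > 0))" by simp
  qed
  finally show ?thesis .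
qed

end

text \<open>Interchanging the sums over \<open>I\<close> and over its faces \<open>K\<close>
  separates the data: \<open>Q\<close> enters only through the rays of \<open>K\<close>, and
  \<open>h\<close> only through the position of its projection among the cones above
  \<open>K\<close>.\<close>

lemma crossing_expand:
  assumes h: "generic \<Delta> h"
  shows "(\<Sum>I\<in>top. weight \<Delta> I * (\<Prod>i\<in>vs I. of_bool (Q i) - of_bool (dual_vec \<Delta> I i h > 0)))
    = (\<Sum>K\<in>idx \<Delta>. (\<Prod>i\<in>vs K. of_bool (Q i)) * (- 1) ^ (n - card (vs K)) *
        deg_at (projected \<Delta> K) (quotient_map (span (cone_of \<Delta> K)) h))"
proof -
  let ?q = "\<lambda>i. of_bool (Q i) :: int" and ?e = "\<lambda>I i. of_bool (dual_vec \<Delta> I i h > 0) :: int"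
  have "(\<Prod>i\<in>vs I. ?q i - ?e I i)
      = (\<Sum>K | K \<in> idx \<Delta> \<and> (K, I) \<in> leq \<Delta>. (\<Prod>i\<in>vs K. ?q i) * (\<Prod>i\<in>vs I - vs K. - ?e I i))"
    if I: "I \<in> top" for I
  proof -
    have "(\<Prod>i\<in>vs I. ?q i - ?e I i) = (\<Sum>X\<in>Pow (vs I). (\<Prod>i\<in>X. ?q i) * (\<Prod>i\<in>vs I - X. - ?e I i))"
      using prod_add[OF finite_vs, of ?q "\<lambda>i. - ?e I i" I] by simp
    also have "\<dots> = (\<Sum>K | K \<in> idx \<Delta> \<and> (K, I) \<in> leq \<Delta>. (\<Prod>i\<in>vs K. ?q i) * (\<Prod>i\<in>vs I - vs K. - ?e I i))"
      by (rule sum.reindex_bij_betw[OF vs_bij[OF top_idx[OF I]], symmetric])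
    finally show ?thesis .
  qed
  then have "(\<Sum>I\<in>top. weight \<Delta> I * (\<Prod>i\<in>vs I. ?q i - ?e I i))
      = (\<Sum>I\<in>top. \<Sum>K | K \<in> idx \<Delta> \<and> (K, I) \<in> leq \<Delta>.
          weight \<Delta> I * ((\<Prod>i\<in>vs K. ?q i) * (\<Prod>i\<in>vs I - vs K. - ?e I i)))"
    by (simp add: sum_distrib_left)
  also have "\<dots> = (\<Sum>K\<in>idx \<Delta>. \<Sum>I | I \<in> top \<and> (K, I) \<in> leq \<Delta>.
      weight \<Delta> I * ((\<Prod>i\<in>vs K. ?q i) * (\<Prod>i\<in>vs I - vs K. - ?e I i)))"
    by (rule sum.swap_restrict[OF finite_top finite_idx])
  also have "\<dots> = (\<Sum>K\<in>idx \<Delta>. (\<Prod>i\<in>vs K. ?q i) * (- 1) ^ (n - card (vs K)) *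
      deg_at (projected \<Delta> K) (quotient_map (span (cone_of \<Delta> K)) h))"
  proof (rule sum.cong[OF refl])
    fix K assume K: "K \<in> idx \<Delta>"
    have "weight \<Delta> I * ((\<Prod>i\<in>vs K. ?q i) * (\<Prod>i\<in>vs I - vs K. - ?e I i))
        = (\<Prod>i\<in>vs K. ?q i) * (- 1) ^ (n - card (vs K)) * (weight \<Delta> I * (\<Prod>i\<in>vs I - vs K. ?e I i))"
      if "I \<in> top" "(K, I) \<in> leq \<Delta>" for I
    proof -
      have "(\<Prod>i\<in>vs I - vs K. - ?e I i) = (\<Prod>i\<in>vs I - vs K. (- 1) * ?e I i)" by simp
      also have "\<dots> = (- 1) ^ card (vs I - vs K) * (\<Prod>i\<in>vs I - vs K. ?e I i)"
        by (simp only: prod.distrib prod_constant)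
      also have "card (vs I - vs K) = n - card (vs K)"
        using card_Diff_subset[OF finite_vs vs_mono[OF that(2)]] card_vs_top[OF that(1)] by simp
      finally show ?thesis by (simp only: mult_ac)
    qed
    then show "(\<Sum>I | I \<in> top \<and> (K, I) \<in> leq \<Delta>.
        weight \<Delta> I * ((\<Prod>i\<in>vs K. ?q i) * (\<Prod>i\<in>vs I - vs K. - ?e I i)))
      = (\<Prod>i\<in>vs K. ?q i) * (- 1) ^ (n - card (vs K)) *
        deg_at (projected \<Delta> K) (quotient_map (span (cone_of \<Delta> K)) h)"
      unfolding deg_at_projected[OF K h] sum_distrib_left by (intro sum.cong) auto
  qed
  finally show ?thesis .
qed

text \<open>Here the pre-completeness of all projected multi-fans, and not just of the multi-fan
  itself, enters.\<close>

lemma crossing_eq: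
  assumes "generic \<Delta> h" "generic \<Delta> h'"
  shows "(\<Sum>I\<in>top. weight \<Delta> I * (\<Prod>i\<in>vs I. of_bool (Q i) - of_bool (dual_vec \<Delta> I i h > 0)))
    = (\<Sum>I\<in>top. weight \<Delta> I * (\<Prod>i\<in>vs I. of_bool (Q i) - of_bool (dual_vec \<Delta> I i h' > 0)))"
  unfolding crossing_expand[OF assms(1)] crossing_expand[OF assms(2)]
  using deg_at_projected_eq[OF _ assms] by (intro sum.cong) auto

lemma generic_uminus: "generic \<Delta> h \<Longrightarrow> generic \<Delta> (- h)"
  unfolding generic_def by (metis add.inverse_inverse span_neg)

text \<open>The line through \<open>y\<close> in direction \<open>v\<close> meets each forbidden
  subspace at most once, as \<open>v\<close> lies in none of them. So
  \<open>y + t *\<^sub>R v\<close> is generic for some \<open>t\<close>, and \<open>y\<close> is a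
  combination of two generic vectors.\<close>

lemma span_generic:
  assumes v: "generic \<Delta> v"
  shows "span {h. generic \<Delta> h} = UNIV"
proof -
  have "y \<in> span {h. generic \<Delta> h}" for y
  proof -
    define bad where "bad I = {t. y + t *\<^sub>R v \<in> span (cone_of \<Delta> I)}" for I
    let ?S = "{I \<in> idx \<Delta>. dim (cone_of \<Delta> I) < n}"
    have "finite (bad I)" if I: "I \<in> ?S" for I
    proof -
      have "t = t'" if "t \<in> bad I" "t' \<in> bad I" for t t'
      proof (rule ccontr)
        assume ne: "t \<noteq> t'"
        have "(y + t *\<^sub>R v) - (y + t' *\<^sub>R v) \<in> span (cone_of \<Delta> I)"
          using that unfolding bad_def by (intro span_diff) auto
        then have "(t - t') *\<^sub>R v \<in> span (cone_of \<Delta> I)" by (simp add: scaleR_diff_left)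
        then have "(1 / (t - t')) *\<^sub>R ((t - t') *\<^sub>R v) \<in> span (cone_of \<Delta> I)" by (rule span_scale)
        then have "v \<in> span (cone_of \<Delta> I)" using ne by simp
        then show False using v I unfolding generic_def by blast
      qed
      then show ?thesis by (metis finite.simps is_singletonI' is_singleton_def)
    qed
    then have "finite (\<Union>I\<in>?S. bad I)" using finite_idx by auto
    then obtain t where "t \<notin> (\<Union>I\<in>?S. bad I)" using ex_new_if_finite[OF infinite_UNIV_char_0] by metis
    then have "generic \<Delta> (y + t *\<^sub>R v)" using span_lat by (auto simp: generic_def bad_def)
    then have "(y + t *\<^sub>R v) - t *\<^sub>R v \<in> span {h. generic \<Delta> h}"
      using v by (intro span_diff span_scale span_base) auto
    then show ?thesis by simp
  qed
  then show ?thesis by blast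
qed

text \<open>The product is the indicator of \<open>- v\<close> lying in the cone, so the sum is the
  degree computed at \<open>- v\<close>, which is generic too. The existence of a generic vector
  also makes the definite description in \<open>fan_deg\<close> unique.\<close>

lemma fan_deg_eq:
  assumes v: "generic \<Delta> v"
  shows "fan_deg \<Delta> = (\<Sum>I\<in>top. weight \<Delta> I * (\<Prod>i\<in>vs I. of_bool True - of_bool (dual_vec \<Delta> I i v > 0)))"
proof -
  obtain k where k: "\<And>h. generic \<Delta> h \<Longrightarrow> deg_at \<Delta> h = k"
    using complete unfolding fan_complete_def pre_complete_def by blast
  have v': "generic \<Delta> (- v)" using generic_uminus[OF v] .
  have "fan_deg \<Delta> = k"
    unfolding fan_deg_def by (rule the_equality) (use k v in auto)
  also have "k = deg_at \<Delta> (- v)" using k[OF v'] by simp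
  also have "\<dots> = (\<Sum>I\<in>top. if - v \<in> cone_of \<Delta> I then weight \<Delta> I else 0)"
    unfolding deg_at_def top_def[symmetric]
    using finite_top by (simp add: sum.inter_filter)
  also have "\<dots> = (\<Sum>I\<in>top. weight \<Delta> I * (\<Prod>i\<in>vs I. of_bool True - of_bool (dual_vec \<Delta> I i v > 0)))"
  proof (rule sum.cong[OF refl])
    fix I assume I: "I \<in> top"
    have "- v \<in> cone_of \<Delta> I \<longleftrightarrow> (\<forall>i\<in>vs I. 0 \<le> dual_vec \<Delta> I i (- v))"
      using dual_family_nonneg_hull_iff[OF dual_vec_family[OF I] subset_refl, of "- v"] span_p_top[OF I]
        verts_dual_family(2)[OF top_idx[OF I]] by simp
    also have "\<dots> \<longleftrightarrow> (\<forall>i\<in>vs I. \<not> dual_vec \<Delta> I i v > 0)"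
    proof (intro ball_cong refl)
      fix i assume "i \<in> vs I"
      then have "dual_vec \<Delta> I i (- v) = - dual_vec \<Delta> I i v"
        using dual_family_linear[OF dual_vec_family[OF I]] by (simp add: linear_neg)
      then show "0 \<le> dual_vec \<Delta> I i (- v) \<longleftrightarrow> \<not> dual_vec \<Delta> I i v > 0" by auto
    qed
    finally have "(\<Prod>i\<in>vs I. of_bool True - of_bool (dual_vec \<Delta> I i v > 0)) = (of_bool (- v \<in> cone_of \<Delta> I) :: int)"
      using finite_vs by (auto simp: prod_zero_iff intro!: prod.neutral)
    then show "(if - v \<in> cone_of \<Delta> I then weight \<Delta> I else 0)
        = weight \<Delta> I * (\<Prod>i\<in>vs I. of_bool True - of_bool (dual_vec \<Delta> I i v > 0))" by simp
  qed
  finally show ?thesis .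
qed

end

section \<open>Lattice multi-polytopes\<close>

lemma level_set_inj:
  fixes y :: "'a::real_vector"
  assumes "y \<noteq> 0" "level_set y c = level_set y c'"
  shows "c = c'"
proof -
  obtain u where u: "linear u" "u y = c"
    using linear_functional_extend[of "{y}" "\<lambda>_. c"] assms(1) by auto
  then have "u \<in> level_set y c'" using assms(2) by (auto simp: level_set_def)
  with u show ?thesis by (simp add: level_set_def)
qed

text \<open>If \<open>z\<close> were off the line of \<open>y\<close>, functionals with the
  prescribed value at \<open>y\<close> could take any value at \<open>z\<close>. It identifies the
  normal vector of a given hyperplane with a multiple of the primitive vector.\<close>

lemma level_set_const_imp_scale:
  fixes y z :: "'a::real_vector"
  assumes "y \<noteq> 0" and const: "\<And>u u'. u \<in> level_set y c \<Longrightarrow> u' \<in> level_set y c \<Longrightarrow> u z = u' z"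
  obtains r where "z = r *\<^sub>R y"
proof (cases "z \<in> span {y}")
  case True
  then show ?thesis using that by (auto simp: span_singleton)
next
  case False
  then have ind: "independent {z, y}" "z \<noteq> y"
    using assms(1) by (auto simp: independent_insert span_base)
  have ext: "\<exists>u. linear u \<and> u y = c \<and> u z = e" for e :: real
  proof -
    obtain u where u: "linear u" "\<And>a. a \<in> {z, y} \<Longrightarrow> u a = (if a = y then c else e)"
      by (rule linear_functional_extend[OF ind(1), of "\<lambda>a. if a = y then c else e"]) blast
    then show ?thesis using u(2)[of y] u(2)[of z] ind(2) by auto
  qed
  obtain u where u: "linear u" "u y = c" "u z = 0" using ext by blast
  obtain u' where u': "linear u'" "u' y = c" "u' z = 1" using ext by blast
  have "u z = u' z" by (rule const) (use u u' in \<open>auto simp: level_set_def\<close>)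
  with u u' show ?thesis by simp
qed

lemma offset_eq:
  assumes "snd P i = level_set (prim_vec (fst P) i) c" "prim_vec (fst P) i \<noteq> 0"
  shows "offset P i = c"
  unfolding offset_def by (rule the_equality) (use assms level_set_inj in metis)+

text \<open>For integers, "sufficiently small" means less than 1; the eventual values in
  \<open>num_points\<close> and \<open>num_points_interior\<close> are thus attained on all of
  (0,1).\<close>

lemma int_less_shift_iff:
  fixes a b e :: real
  assumes "a \<in> \<int>" "b \<in> \<int>" "0 < e" "e < 1"
  shows "a < b + e \<longleftrightarrow> a \<le> b" "a < b - e \<longleftrightarrow> a < b" "a \<noteq> b + e" "a \<noteq> b - e"
proof -
  obtain k l where kl: "a = of_int k" "b = of_int l" using assms(1,2) by (auto elim!: Ints_cases)
  consider "k \<le> l - 1" | "k = l" | "l + 1 \<le> k" by linarith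
  then have "a \<le> b - 1 \<or> a = b \<or> b + 1 \<le> a" unfolding kl by cases linarith+
  then show "a < b + e \<longleftrightarrow> a \<le> b" "a < b - e \<longleftrightarrow> a < b" "a \<noteq> b + e" "a \<noteq> b - e"
    using assms(3,4) by auto
qed

lemma the_eventually_eq:
  fixes f :: "real \<Rightarrow> int"
  assumes "\<And>e. 0 < e \<Longrightarrow> e < 1 \<Longrightarrow> f e = k"
  shows "(THE k. \<forall>\<^sub>F e in at_right 0. f e = k) = k"
proof (rule the_equality)
  show ev: "\<forall>\<^sub>F e in at_right 0. f e = k"
    by (rule eventually_at_rightI[of 0 1]) (use assms in auto)
  fix k' assume "\<forall>\<^sub>F e in at_right 0. f e = k'"
  with ev have "\<forall>\<^sub>F e in at_right (0::real). k' = k" by eventually_elim simp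
  then show "k' = k" by simp
qed

context simplicial_fan
begin

lemma vertex_eq:
  assumes I: "I \<in> top" and P: "fst P = \<Delta>" "\<And>i. i \<in> idx_dim \<Delta> 1 \<Longrightarrow> snd P i = level_set (p i) (c i)"
  shows "linear (vertex P I)" "i \<in> vs I \<Longrightarrow> vertex P I (p i) = c i"
    "vertex P I = (\<lambda>y. \<Sum>i\<in>vs I. c i * dual_vec \<Delta> I i y)"
proof -
  have "vertex P I = (THE u. linear u \<and> (\<forall>i\<in>vs I. u (p i) = c i))"
    unfolding vertex_def P(1)
    by (rule arg_cong[where f = The], rule ext) (use P(2) vs_ray(1) in \<open>auto simp: level_set_def\<close>)
  then have *: "linear (vertex P I) \<and> (\<forall>i\<in>vs I. vertex P I (p i) = c i)"
    using theI'[OF ex1_linear_top[OF I]] by simp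
  then show "linear (vertex P I)" "i \<in> vs I \<Longrightarrow> vertex P I (p i) = c i" by auto
  show "vertex P I = (\<lambda>y. \<Sum>i\<in>vs I. c i * dual_vec \<Delta> I i y)"
  proof
    fix y
    have "vertex P I y = (\<Sum>i\<in>vs I. vertex P I (p i) * dual_vec \<Delta> I i y)"
      using * by (intro dual_vec_expand[OF I]) blast
    also have "\<dots> = (\<Sum>i\<in>vs I. c i * dual_vec \<Delta> I i y)" by (rule sum.cong) (use * in auto)
    finally show "vertex P I y = (\<Sum>i\<in>vs I. c i * dual_vec \<Delta> I i y)" .
  qed
qed

text \<open>In the dual basis a functional has coordinates \<open>u (p i)\<close> and the apex has
  coordinates \<open>c i\<close>, so the cone is an orthant whose directions are given by the signs
  of \<open>dual_vec \<Delta> I i v\<close>.\<close>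

lemma vertex_cone_iff:
  assumes I: "I \<in> top" and P: "fst P = \<Delta>" "\<And>i. i \<in> idx_dim \<Delta> 1 \<Longrightarrow> snd P i = level_set (p i) (c i)"
    and u: "linear u"
  shows "u \<in> vertex_cone P v I \<longleftrightarrow>
    (\<forall>i\<in>vs I. if dual_vec \<Delta> I i v > 0 then c i \<le> u (p i) else u (p i) \<le> c i)"
proof -
  define s where "s i = (if dual_vec \<Delta> I i v > 0 then 1 else - 1 :: real)" for i
  have dp: "dual_vec_pos \<Delta> v I i y = s i * dual_vec \<Delta> I i y" for i y
    by (simp add: dual_vec_pos_def s_def)
  have comb: "vertex P I y + (\<Sum>i\<in>vs I. a i * dual_vec_pos \<Delta> v I i y)
      = (\<Sum>i\<in>vs I. (c i + a i * s i) * dual_vec \<Delta> I i y)" for a y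
  proof -
    have "vertex P I y = (\<Sum>i\<in>vs I. c i * dual_vec \<Delta> I i y)"
      by (rule fun_cong[OF vertex_eq(3)[OF I P]])
    then show ?thesis unfolding dp by (simp add: sum.distrib distrib_right mult.assoc)
  qed
  have at_p: "(\<Sum>i\<in>vs I. b i * dual_vec \<Delta> I i (p j)) = b j" if j: "j \<in> vs I" for b j
  proof -
    have "(\<Sum>i\<in>vs I. b i * dual_vec \<Delta> I i (p j)) = (\<Sum>i\<in>vs I. if i = j then b j else 0)"
      using dual_family_apply[OF dual_vec_family[OF I] _ j] by (intro sum.cong) auto
    then show ?thesis using finite_vs j by (simp add: sum.delta)
  qed
  show ?thesis
  proof
    assume "u \<in> vertex_cone P v I"
    then obtain a where a: "\<forall>i\<in>vs I. 0 \<le> a i" "u = (\<lambda>y. \<Sum>i\<in>vs I. (c i + a i * s i) * dual_vec \<Delta> I i y)"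
      unfolding vertex_cone_def P(1) comb by auto
    have "u (p j) = c j + a j * s j" if "j \<in> vs I" for j
      unfolding a(2) by (rule at_p[OF that])
    then show "\<forall>i\<in>vs I. if dual_vec \<Delta> I i v > 0 then c i \<le> u (p i) else u (p i) \<le> c i"
      using a(1) by (simp add: s_def)
  next
    assume *: "\<forall>i\<in>vs I. if dual_vec \<Delta> I i v > 0 then c i \<le> u (p i) else u (p i) \<le> c i"
    \<comment> \<open>The absolute value fits both orientations: by assumption
      \<open>u (p i) - c i\<close> has the sign \<open>s i\<close> or is zero.\<close>
    let ?a = "\<lambda>i. \<bar>u (p i) - c i\<bar>"
    have "u = (\<lambda>y. \<Sum>i\<in>vs I. (c i + ?a i * s i) * dual_vec \<Delta> I i y)"
    proof
      fix y
      have "u y = (\<Sum>i\<in>vs I. u (p i) * dual_vec \<Delta> I i y)" by (rule dual_vec_expand[OF I u])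
      also have "\<dots> = (\<Sum>i\<in>vs I. (c i + ?a i * s i) * dual_vec \<Delta> I i y)"
        by (rule sum.cong) (use * in \<open>auto simp: s_def\<close>)
      finally show "u y = (\<Sum>i\<in>vs I. (c i + ?a i * s i) * dual_vec \<Delta> I i y)" .
    qed
    then show "u \<in> vertex_cone P v I"
      unfolding vertex_cone_def P(1) comb mem_Collect_eq by (intro exI[of _ ?a]) simp
  qed
qed

lemma DH_eq:
  assumes P: "fst P = \<Delta>" "\<And>i. i \<in> idx_dim \<Delta> 1 \<Longrightarrow> snd P i = level_set (p i) (c i)"
    and u: "linear u"
  shows "DH P v u = (\<Sum>I\<in>top. weight \<Delta> I * (\<Prod>i\<in>vs I.
    if dual_vec \<Delta> I i v > 0 then - of_bool (c i \<le> u (p i)) else of_bool (u (p i) \<le> c i)))"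
  unfolding DH_def P(1) top_def[symmetric]
proof (rule sum.cong[OF refl])
  fix I assume I: "I \<in> top"
  let ?Q = "\<lambda>i. if dual_vec \<Delta> I i v > 0 then c i \<le> u (p i) else u (p i) \<le> c i"
  have "(\<Prod>i\<in>vs I. if dual_vec \<Delta> I i v > 0 then - of_bool (c i \<le> u (p i)) else of_bool (u (p i) \<le> c i) :: int)
      = (\<Prod>i\<in>vs I. (if dual_vec \<Delta> I i v > 0 then - 1 else 1) * of_bool (?Q i))"
    by (rule prod.cong) auto
  also have "\<dots> = (\<Prod>i\<in>vs I. if dual_vec \<Delta> I i v > 0 then - 1 else 1) * (\<Prod>i\<in>vs I. of_bool (?Q i))"
    by (rule prod.distrib)
  also have "(\<Prod>i\<in>vs I. if dual_vec \<Delta> I i v > 0 then - 1 else 1 :: int)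
      = (- 1) ^ card {i \<in> vs I. dual_vec \<Delta> I i v > 0}"
    using finite_vs[of I] by (simp add: prod.If_cases Int_def)
  also have "(\<Prod>i\<in>vs I. of_bool (?Q i) :: int) = indicator (vertex_cone P v I) u"
    using vertex_cone_iff[OF I P u, of v] finite_vs[of I]
    by (auto simp: indicator_def prod_zero_iff intro!: prod.neutral)
  finally show "(- 1) ^ card {i \<in> vs I. dual_vec \<Delta> I i v > 0} * weight \<Delta> I *
        indicator (vertex_cone P v I) u
      = weight \<Delta> I * (\<Prod>i\<in>vs I. if dual_vec \<Delta> I i v > 0 then - of_bool (c i \<le> u (p i))
          else of_bool (u (p i) \<le> c i))"
    by (simp only: mult_ac)
qed

text \<open>With equality excluded, \<open>- of_bool (c i \<le> u (p i))\<close> equals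
  \<open>of_bool (u (p i) < c i) - 1\<close>, which merges the two cases into one difference of
  indicators.\<close>

lemma DH_off_hyperplanes:
  assumes P: "fst P = \<Delta>" "\<And>i. i \<in> idx_dim \<Delta> 1 \<Longrightarrow> snd P i = level_set (p i) (c i)"
    and u: "linear u" and off: "\<And>I i. I \<in> top \<Longrightarrow> i \<in> vs I \<Longrightarrow> u (p i) \<noteq> c i"
  shows "DH P v u = (\<Sum>I\<in>top. weight \<Delta> I * (\<Prod>i\<in>vs I.
    of_bool (u (p i) < c i) - of_bool (dual_vec \<Delta> I i v > 0)))"
proof -
  have "DH P v u = (\<Sum>I\<in>top. weight \<Delta> I * (\<Prod>i\<in>vs I.
      if dual_vec \<Delta> I i v > 0 then - of_bool (c i \<le> u (p i)) else of_bool (u (p i) \<le> c i)))"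
    by (rule DH_eq[OF P u])
  also have "\<dots> = (\<Sum>I\<in>top. weight \<Delta> I * (\<Prod>i\<in>vs I.
      of_bool (u (p i) < c i) - of_bool (dual_vec \<Delta> I i v > 0)))"
  proof (intro sum.cong refl arg_cong2[where f = "(*)"] prod.cong)
    fix I i assume "I \<in> top" "i \<in> vs I"
    then show "(if dual_vec \<Delta> I i v > 0 then - of_bool (c i \<le> u (p i)) else of_bool (u (p i) \<le> c i))
        = (of_bool (u (p i) < c i) - of_bool (dual_vec \<Delta> I i v > 0) :: int)"
      using off[of I i] by auto
  qed
  finally show ?thesis .
qed

end

locale lattice_simple_multipolytope = simplicial_fan +
  fixes F :: "'a \<Rightarrow> ('b \<Rightarrow> real) set" and v :: 'b
  assumes polytope: "is_multipolytope (\<Delta>, F)" and lattice_polytope: "lattice_multipolytope (\<Delta>, F)"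
    and v: "generic \<Delta> v"
begin

abbreviation "c \<equiv> offset (\<Delta>, F)"

lemma hyperplane:
  assumes i: "i \<in> idx_dim \<Delta> 1"
  shows "F i = level_set (p i) (c i)"
proof -
  have *: "(\<exists>x c. x \<noteq> 0 \<and> F i = level_set x c) \<and>
      (\<forall>x\<in>cone_of \<Delta> i. \<forall>u\<in>F i. \<forall>u'\<in>F i. u x = u' x)"
    using polytope i unfolding is_multipolytope_def by simp
  then obtain y b where y: "y \<noteq> 0" "F i = level_set y b" by blast
  have "p i \<in> cone_of \<Delta> i" unfolding prim_vec(3)[OF i] by (simp add: nonneg_hull_generator)
  then have const: "u (p i) = u' (p i)" if "u \<in> level_set y b" "u' \<in> level_set y b" for u u'
    using * that unfolding y(2) by blast
  obtain r where r: "p i = r *\<^sub>R y" using level_set_const_imp_scale[OF y(1) const] .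
  then have "r \<noteq> 0" using prim_vec(2)[OF i] by auto
  then have F: "F i = level_set (p i) (r * b)"
    unfolding y(2) r level_set_def by (auto simp: linear_scale)
  then have "c i = r * b" using prim_vec(2)[OF i] by (intro offset_eq) auto
  with F show ?thesis by simp
qed

lemma snd_polytope: "i \<in> idx_dim \<Delta> 1 \<Longrightarrow> snd (\<Delta>, F) i = level_set (p i) (c i)"
  by (simp add: hyperplane)

lemma snd_shift_dilate:
  "i \<in> idx_dim \<Delta> 1 \<Longrightarrow> snd (shift e (dilate \<nu> (\<Delta>, F))) i = level_set (p i) (of_int \<nu> * c i + e)"
  using prim_vec(2)[of i] offset_eq[of "dilate \<nu> (\<Delta>, F)" i "of_int \<nu> * c i"]
  by (simp add: shift_def dilate_def)

lemma fst_shift_dilate: "fst (shift e (dilate \<nu> (\<Delta>, F))) = \<Delta>"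
  by (simp add: shift_def dilate_def)

lemma vertex_in_dual_lattice: "I \<in> top \<Longrightarrow> (\<lambda>y. \<Sum>i\<in>vs I. c i * dual_vec \<Delta> I i y) \<in> dual_lattice (lat \<Delta>)"
  using lattice_polytope vertex_eq(3)[of I "(\<Delta>, F)", OF _ _ snd_polytope]
  unfolding lattice_multipolytope_def by (auto simp: top_def)

lemma offset_int:
  assumes "I \<in> top" "i \<in> vs I"
  shows "c i \<in> \<int>"
proof -
  have "vertex (\<Delta>, F) I \<in> dual_lattice (lat \<Delta>)"
    using lattice_polytope assms(1) unfolding lattice_multipolytope_def by (auto simp: top_def)
  then have "vertex (\<Delta>, F) I (p i) \<in> \<int>"
    using prim_vec(1)[OF vs_ray(1)[OF assms(2)]] by (rule dual_lattice_apply_int)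
  then show ?thesis
    using vertex_eq(2)[of I "(\<Delta>, F)", OF assms(1) _ snd_polytope assms(2)] by simp
qed

text \<open>The same choice as in \<open>mp_volume\<close>, so that the volume becomes an integral
  in these coordinates by mere unfolding.\<close>

definition B :: "('b \<Rightarrow> real) set" where "B = (SOME B. dual_lattice_basis (lat \<Delta>) B)"

lemma B: "dual_lattice_basis (lat \<Delta>) B"
  unfolding B_def by (rule someI_ex[OF dual_lattice_basis_exists[OF lattice span_lat]])

definition x :: "('b \<Rightarrow> real) \<Rightarrow> 'b" where
  "x = (SOME x. \<forall>b\<in>B. \<forall>b'\<in>B. b (x b') = (if b = b' then 1 else 0))"

lemmas B_coords = dual_lattice_basis_coords[OF lattice span_lat B]

sublocale dual_cones top vs p "dual_vec \<Delta>" "weight \<Delta>" c n "{h. generic \<Delta> h}" v B x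
proof (rule dual_cones.intro)
  show "finite top" by (rule finite_top)
  show "finite (vs I)" for I by (rule finite_vs)
  show "card (vs I) = n" if "I \<in> top" for I by (rule card_vs_top[OF that])
  show "u y = (\<Sum>i\<in>vs I. u (p i) * dual_vec \<Delta> I i y)" if "I \<in> top" "linear u" for I u y
    by (rule dual_vec_expand[OF that])
  show "linear (dual_vec \<Delta> I i)" if "I \<in> top" "i \<in> vs I" for I i
    by (rule dual_family_linear[OF dual_vec_family[OF that(1)] that(2)])
  show "dual_vec \<Delta> I i (p j) = (if i = j then 1 else 0)" if "I \<in> top" "i \<in> vs I" "j \<in> vs I" for I i j
    by (rule dual_family_apply[OF dual_vec_family[OF that(1)] that(2,3)])
  show "dual_vec \<Delta> I i h \<noteq> 0" if "h \<in> {h. generic \<Delta> h}" "I \<in> top" "i \<in> vs I" for h I i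
    using generic_dual_vec_nonzero that by simp
  show "v \<in> {h. generic \<Delta> h}" using v by simp
  show "- h \<in> {h. generic \<Delta> h}" if "h \<in> {h. generic \<Delta> h}" for h using generic_uminus that by simp
  show "span {h. generic \<Delta> h} = UNIV" by (rule span_generic[OF v])
  show "(\<Sum>I\<in>top. weight \<Delta> I * (\<Prod>i\<in>vs I. of_bool (Q i) - of_bool (dual_vec \<Delta> I i h > 0))) =
      (\<Sum>I\<in>top. weight \<Delta> I * (\<Prod>i\<in>vs I. of_bool (Q i) - of_bool (dual_vec \<Delta> I i h' > 0)))"
    if "h \<in> {h. generic \<Delta> h}" "h' \<in> {h. generic \<Delta> h}" for h h' Q
    by (rule crossing_eq) (use that in auto)
  show "finite B" by (rule B_coords(1))
  show "linear b" if "b \<in> B" for b using B_coords(2) that by (auto simp: dual_lattice_def)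
  show "card B = n" unfolding fan_dim_def by (rule B_coords(3))
  show "b (x b') = (if b = b' then 1 else 0)" if "b \<in> B" "b' \<in> B" for b b'
    using someI_ex[OF B_coords(4)] that unfolding x_def by blast
  show "b (p i) \<in> \<int>" if "I \<in> top" "i \<in> vs I" "b \<in> B" for I i b
    using B_coords(2) that prim_vec(1)[OF vs_ray(1)[OF that(2)]] by (auto intro: dual_lattice_apply_int)
  show "\<exists>b\<in>B. b (p i) \<noteq> 0" if "I \<in> top" "i \<in> vs I" for I i
    by (rule B_coords(5)[OF prim_vec(2)[OF vs_ray(1)[OF that(2)]]])
  show "\<exists>k. (\<lambda>y. \<Sum>i\<in>vs I. c i * dual_vec \<Delta> I i y) = (\<lambda>y. \<Sum>b\<in>B. of_int (k b) * b y)"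
    if "I \<in> top" for I
    using vertex_in_dual_lattice[OF that] unfolding dual_lattice_eq_comb[OF B] by blast
qed

lemma Lat_eq: "Lat = dual_lattice (lat \<Delta>)"
  unfolding Lat_def comb_def dual_lattice_eq_comb[OF B] ..

lemma DH_shift:
  assumes u: "u \<in> dual_lattice (lat \<Delta>)" and e: "0 < e" "e < 1"
  shows "DH (shift e (dilate \<nu> (\<Delta>, F))) v u = closed_at (of_int \<nu>) u"
    and "DH (shift (- e) (dilate \<nu> (\<Delta>, F))) v u = open_at (of_int \<nu>) u"
proof -
  have lin: "linear u" using u by (simp add: dual_lattice_def)
  have int: "u (p i) \<in> \<int>" "of_int \<nu> * c i \<in> \<int>" if "I \<in> top" "i \<in> vs I" for I i
    using Lat_p_int[of u] u that offset_int by (auto simp: Lat_eq)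
  have iff: "u (p i) < of_int \<nu> * c i + e \<longleftrightarrow> u (p i) \<le> of_int \<nu> * c i"
    "u (p i) < of_int \<nu> * c i + - e \<longleftrightarrow> u (p i) < of_int \<nu> * c i"
    "u (p i) \<noteq> of_int \<nu> * c i + e" "u (p i) \<noteq> of_int \<nu> * c i + - e"
    if "I \<in> top" "i \<in> vs I" for I i
    using int_less_shift_iff[OF int[OF that] e] by simp_all
  have "DH (shift e (dilate \<nu> (\<Delta>, F))) v u = (\<Sum>I\<in>top. weight \<Delta> I * (\<Prod>i\<in>vs I.
      of_bool (u (p i) < of_int \<nu> * c i + e) - of_bool (dual_vec \<Delta> I i v > 0)))"
    by (rule DH_off_hyperplanes[OF fst_shift_dilate snd_shift_dilate lin iff(3)])
  then show "DH (shift e (dilate \<nu> (\<Delta>, F))) v u = closed_at (of_int \<nu>) u"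
    unfolding closed_at_def crossing_def by (simp only: iff(1) cong: sum.cong prod.cong)
  have "DH (shift (- e) (dilate \<nu> (\<Delta>, F))) v u = (\<Sum>I\<in>top. weight \<Delta> I * (\<Prod>i\<in>vs I.
      of_bool (u (p i) < of_int \<nu> * c i + - e) - of_bool (dual_vec \<Delta> I i v > 0)))"
    by (rule DH_off_hyperplanes[OF fst_shift_dilate snd_shift_dilate lin iff(4)])
  then show "DH (shift (- e) (dilate \<nu> (\<Delta>, F))) v u = open_at (of_int \<nu>) u"
    unfolding open_at_def crossing_def by (simp only: iff(2) cong: sum.cong prod.cong)
qed

lemma DH_sum_shift:
  assumes e: "0 < e" "e < 1"
  shows "DH_sum (shift e (dilate \<nu> (\<Delta>, F))) v = closed_count (of_int \<nu>)"
    and "DH_sum (shift (- e) (dilate \<nu> (\<Delta>, F))) v = open_count (of_int \<nu>)"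
  unfolding DH_sum_def closed_count_def open_count_def Lat_eq fst_shift_dilate
  using DH_shift[OF _ e] by (auto intro!: sum.cong)

lemma num_points_eq: "num_points (dilate \<nu> (\<Delta>, F)) v = closed_count (of_int \<nu>)"
  unfolding num_points_def by (rule the_eventually_eq) (rule DH_sum_shift(1))

lemma num_points_interior_eq: "num_points_interior (dilate \<nu> (\<Delta>, F)) v = open_count (of_int \<nu>)"
  unfolding num_points_interior_def by (rule the_eventually_eq) (rule DH_sum_shift(2))

text \<open>The volume is defined with overlapping closed cones, \<open>closed_at\<close> with
  half-open ones; they differ only on the hyperplanes, a null set.\<close>

lemma mp_volume_eq:
  "mp_volume (\<Delta>, F) v = (\<integral>t. of_int (closed_at 1 (comb t)) \<partial>(\<Pi>\<^sub>M b\<in>B. lborel))"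
proof -
  have "mp_volume (\<Delta>, F) v = (\<integral>t. of_int (DH (\<Delta>, F) v (comb t)) \<partial>(\<Pi>\<^sub>M b\<in>B. lborel))"
    unfolding mp_volume_def Let_def fst_conv B_def[symmetric] comb_def ..
  also have "\<dots> = (\<integral>t. of_int (closed_at 1 (comb t)) \<partial>(\<Pi>\<^sub>M b\<in>B. lborel))"
  proof (rule integral_cong_AE)
    have eq: "DH (\<Delta>, F) v (comb t) = (\<Sum>I\<in>top. weight \<Delta> I * (\<Prod>i\<in>vs I.
        if dual_vec \<Delta> I i v > 0 then - of_bool (c i \<le> comb t (p i)) else of_bool (comb t (p i) \<le> c i)))" for t
      by (rule DH_eq[OF fst_conv snd_polytope linear_comb])
    show "(\<lambda>t. real_of_int (DH (\<Delta>, F) v (comb t))) \<in> borel_measurable (\<Pi>\<^sub>M b\<in>B. lborel)"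
      unfolding eq of_int_sum of_int_mult of_int_prod if_distrib[of real_of_int] of_int_minus of_int_of_bool
      unfolding of_bool_def by measurable
    show "(\<lambda>t. real_of_int (closed_at 1 (comb t))) \<in> borel_measurable (\<Pi>\<^sub>M b\<in>B. lborel)"
      unfolding closed_at_def crossing_def of_int_sum of_int_mult of_int_prod of_int_diff
        of_int_of_bool unfolding of_bool_def by measurable
    show "AE t in \<Pi>\<^sub>M b\<in>B. lborel. real_of_int (DH (\<Delta>, F) v (comb t)) = of_int (closed_at 1 (comb t))"
      using AE_off_hyperplanes
    proof eventually_elim
      case (elim t)
      have "DH (\<Delta>, F) v (comb t) = (\<Sum>I\<in>top. weight \<Delta> I * (\<Prod>i\<in>vs I.
          of_bool (comb t (p i) < c i) - of_bool (dual_vec \<Delta> I i v > 0)))"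
        by (rule DH_off_hyperplanes[OF fst_conv snd_polytope linear_comb]) (use elim in auto)
      also have "\<dots> = closed_at 1 (comb t)"
        unfolding closed_at_def crossing_def
        by (intro sum.cong refl arg_cong2[where f = "(*)"] prod.cong) (use elim in \<open>auto simp: less_le\<close>)
      finally show ?case by simp
    qed
  qed
  finally show ?thesis .
qed

end

theorem theorem7p2:
  fixes \<Delta> :: "('s, 'a::real_vector) multifan"
    and F :: "'s \<Rightarrow> ('a \<Rightarrow> real) set"
    and P :: "('s, 'a) multipolytope"
    and n :: nat
    and v :: 'a
  assumes P: "P = (\<Delta>, F)"
    and simple: "simple_multipolytope P"
    and lattice: "lattice_multipolytope P"
    and n: "n = fan_dim \<Delta>"
    and v: "generic \<Delta> v"
  shows "\<exists>p q :: real poly.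
       degree p \<le> n \<and> (\<forall>\<nu>::int. real_of_int (num_points (dilate \<nu> P) v) = poly p (of_int \<nu>)) \<and>
       degree q \<le> n \<and> (\<forall>\<nu>::int. real_of_int (num_points_interior (dilate \<nu> P) v) = poly q (of_int \<nu>)) \<and>
       (\<forall>\<nu>::int. num_points_interior (dilate \<nu> P) v = (- 1) ^ n * num_points (dilate (- \<nu>) P) v) \<and>
       coeff p n = mp_volume P v \<and>
       coeff p 0 = of_int (fan_deg \<Delta>)"
proof -
  interpret lattice_simple_multipolytope \<Delta> F v
    using simple lattice v
    by unfold_locales (auto simp: P simple_multipolytope_def is_multipolytope_def)
  obtain p :: "real poly" where p: "degree p \<le> n"
    "\<And>\<nu>. of_int (closed_count (of_int \<nu>)) = poly p (of_int \<nu>)"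
    using closed_count_polynomial unfolding n by blast
  \<comment> \<open>The polynomial that sends \<nu> to \<open>(- 1) ^ n\<close> times the value of
    \<open>p\<close> at \<open>- \<nu>\<close>, as dictated by reciprocity.\<close>
  define q where "q = smult ((- 1) ^ n) (pcompose p [:0, - 1:])"
  have reciprocity: "num_points_interior (dilate \<nu> P) v = (- 1) ^ n * num_points (dilate (- \<nu>) P) v" for \<nu>
    unfolding P num_points_eq num_points_interior_eq n of_int_minus by (rule open_count_reciprocity)
  have count: "real_of_int (num_points (dilate \<nu> P) v) = poly p (of_int \<nu>)" for \<nu>
    unfolding P num_points_eq by (rule p(2))
  have "degree q \<le> n" using p(1) by (simp add: q_def degree_pcompose)
  moreover have "real_of_int (num_points_interior (dilate \<nu> P) v) = poly q (of_int \<nu>)" for \<nu>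
    by (simp add: reciprocity count q_def poly_pcompose)
  moreover have "coeff p n = mp_volume P v"
  proof (rule LIMSEQ_unique[OF coeff_limit_of_poly[OF p(1)]])
    show "(\<lambda>m. poly p (real (Suc m)) / real (Suc m) ^ n) \<longlonglongrightarrow> mp_volume P v"
      using closed_count_tendsto_integral p(2)[of "int (Suc _)"]
      unfolding P mp_volume_eq n of_int_of_nat_eq by simp
  qed
  moreover have "coeff p 0 = of_int (fan_deg \<Delta>)"
    using p(2)[of 0] closed_count_zero fan_deg_eq[OF v]
    by (simp add: poly_0_coeff_0 crossing_def)
  ultimately show ?thesis using p(1) count reciprocity by blast
qed

end
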